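(* Let $f(T) = T^2 + c \in \overline{\mathbb Q}[T]$. If $0$ is periodic for $f$ (i.e. there exists an integer $n\ge 1$ with $f^n(0)=0$), then there exists a constant $C = C(f) > 0$ such that $\hat h_f(\alpha) \ge C$ for all wandering algebraic integers $\alpha \in \mathbb Q(c)^{\mathrm{cyc}}$.
   Context: For a polynomial $f$ of degree at least $2$ over a number field $K$, $f^0(T)=T$ and $f^n$ denotes the $n$-fold iterate. An element $\alpha\in\overline{\mathbb Q}$ is preperiodic (for $f$) if its forward orbit $\{f^n(\alpha): n\ge 0\}$ is finite, and wandering otherwise. The canonical (Call--Silverman) height is the unique function $\hat h_f\colon \overline{\mathbb Q}\to\mathbb R_{\ge 0}$ such that $\hat h_f(f(\alpha))=\deg f\cdot \hat h_f(\alpha)$ for all $\alpha$ and $\hat h_f(\alpha)=h(\alpha)+O(1)$, where $h$ is the absolute logarithmic Weil height. For a number field $K$, the cyclotomic closure is $K^{\mathrm{cyc}}=\bigcup_{n\ge 1}K(\zeta_n)$, with $\zeta_n$ a primitive $n$th root of unity. *)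

theory Defs
  imports
    "HOL-Algebra.Generated_Fields"
    "HOL-Algebra.Algebraic_Closure_Type"
    "HOL-Analysis.Analysis"
    "Berlekamp_Zassenhaus.Mahler_Measure"
begin

(* The field of all algebraic numbers is realised throughout as the set of algebraic elements
   of type complex. *)

(* An irreducible element of Z[X] that has a root is non-constant and primitive, so this is the
   primitive multiple, with positive leading coefficient, of the minimal polynomial over Q.
   Meaningful for algebraic x only. *)
definition min_int_poly :: "complex \<Rightarrow> int poly" where
  "min_int_poly x =
     (THE p. irreducible p \<and> lead_coeff p > 0 \<and> poly (map_poly of_int p) x = 0)"

(* If a * (X - x_1) * ... * (X - x_d) is the minimal polynomial of x over Z, this is
   (ln a + ln (max 1 |x_1|) + ... + ln (max 1 |x_d|)) / d, where ln a collects the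
   non-archimedean local contributions and the other terms the archimedean ones. *)
definition weil_height :: "complex \<Rightarrow> real" where
  "weil_height x = ln (mahler_measure (min_int_poly x)) / real (degree (min_int_poly x))"

(* Meaningful for f of degree at least 2 with algebraic coefficients. A function whose domain is
   the set of algebraic numbers is represented by its extensional version on complex, which is
   what makes it unique. *)
definition canonical_height :: "complex poly \<Rightarrow> complex \<Rightarrow> real" where
  "canonical_height f =
     (THE h. h \<in> {x. algebraic x} \<rightarrow>\<^sub>E {0..} \<and>
             (\<forall>x. algebraic x \<longrightarrow> h (poly f x) = real (degree f) * h x) \<and>
             (\<exists>B. \<forall>x. algebraic x \<longrightarrow> \<bar>h x - weil_height x\<bar> \<le> B))"

definition preperiodic :: "complex poly \<Rightarrow> complex \<Rightarrow> bool" where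
  "preperiodic f x \<longleftrightarrow> finite (range (\<lambda>n::nat. (poly f ^^ n) x))"

abbreviation wandering :: "complex poly \<Rightarrow> complex \<Rightarrow> bool" where
  "wandering f x \<equiv> \<not> preperiodic f x"

(* The smallest subfield of the complex numbers containing S; it contains Q automatically, so
   Q(c) is generated_subfield {c}. *)
definition generated_subfield :: "complex set \<Rightarrow> complex set" where
  "generated_subfield S = generate_field ring_of_type_algebra S"

definition cyclotomic_closure :: "complex set \<Rightarrow> complex set" where
  "cyclotomic_closure K =
     (\<Union>n\<in>{1::nat..}. generated_subfield (K \<union> {cis (2 * pi / real n)}))"

end

theory Submission
  imports Defs "Jordan_Normal_Form.Char_Poly" "HOL-Number_Theory.Residues"
begin

text \<open>
  Let \<open>f = T\<^sup>2 + c\<close> and \<open>f\<^sup>n 0 = 0\<close>. Then \<open>c\<close> is zero or a unit, \<open>f\<^sup>n x \<equiv> x\<^sup>q\<close> modulo 2 with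
  \<open>q = 2\<^sup>n\<close>, and 2 is unramified in \<open>\<rat>(c)\<close>. As \<open>x \<equiv> y\<close> modulo an ideal dividing 2 implies
  \<open>f x \<equiv> f y\<close> modulo its square, a few applications of \<open>f\<close> turn a weak congruence
  between an iterate of \<open>\<alpha>\<close> and an iterate of a conjugate of \<open>\<alpha>\<close> into one modulo 4. By the
  product formula the geometric mean of the absolute values of their difference is then at least 4,
  unless they are equal. But all complex filled Julia sets of \<open>f\<close> lie in a disc of some radius
  \<open>r < 2\<close>, so points near them differ by less than 4; hence on average the conjugates of the iterate
  have escaped by a definite amount, which bounds the canonical height from below.

  Let \<open>\<alpha>\<close> lie in the field \<open>L\<^sub>k\<close> generated by \<open>c\<close>, a root of unity of order \<open>2\<^sup>k\<close> and
  one of odd order. For \<open>k = 3\<close> the conjugate comes from an automorphism inducing \<open>x \<mapsto> x\<^sup>q\<close> modulo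
  the prime above 2; equality would make \<open>\<alpha>\<close> preperiodic. For larger \<open>k\<close> and
  \<open>\<alpha>\<close> not in \<open>L\<^bsub>k-1\<^esub>\<close> it comes from a generator of the wild inertia group of
  \<open>L\<^sub>k\<close> over \<open>L\<^bsub>k-2\<^esub>\<close>; equality forces \<open>c = 0\<close> and allows one to divide \<open>\<alpha>\<close> by a root of
  unity and to descend to \<open>L\<^bsub>k-1\<^esub>\<close>.
\<close>

section \<open>Algebraic integers\<close>

text \<open>The obstacle is uniformity in \<open>k\<close>. Every application of \<open>f\<close>
  doubles the height, so the number of applications may not depend on \<open>k\<close>; but a
  congruence modulo a prime of \<open>L\<^sub>k\<close> above 2, where the ramification index is
  \<open>2 ^ (k - 1)\<close>, needs \<open>k\<close> of them to become one modulo 4. Frobenius is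
  therefore used only at \<open>k = 3\<close>, and higher levels start from a congruence modulo
  \<open>1 - \<i>\<close>. There the automorphism must have order 4: the one of order 2 over the
  next smaller field may send \<alpha> to -\<alpha>, which \<open>f\<close> cannot separate, whereas
  for order 4 an image \<alpha> or -\<alpha> would put \<alpha> into that smaller field. Prime
  ideals never appear. Congruences are modulo the element \<open>1 - xi r\<close> of the ring
  generated by \<open>c\<close> and the roots of unity. This ring need not be integrally closed, but
  a power of Frobenius is the identity modulo \<open>1 - xi r\<close>, so the quotient is reduced;
  hence an odd multiple of each algebraic integer of the field lies in the ring, and odd factors are
  harmless at 2.\<close>

interpretation zmod: Modules.module "\<lambda>(k::int) (x::complex). of_int k * x"
  by unfold_locales (simp_all add: algebra_simps)

text \<open>The determinant trick: multiplication by \<open>x\<close> is given by an integer matrix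
  with respect to \<open>W\<close>, and the vector of the elements of \<open>W\<close>, nonzero
  because of \<open>w0\<close>, is an eigenvector for \<open>x\<close>. The characteristic
  polynomial is monic and integral.\<close>

lemma algebraic_int_if_stable:
  assumes fin: "finite W" and w0: "w0 \<in> W" "w0 \<noteq> 0"
    and st: "\<And>w. w \<in> W \<Longrightarrow> x * w \<in> zmod.span W"
  shows "algebraic_int x"
proof -
  obtain ws where ws: "set ws = W" "distinct ws"
    using finite_distinct_list[OF fin] by blast
  define n where "n = length ws"
  have "\<forall>w\<in>W. \<exists>u. x * w = (\<Sum>v\<in>W. of_int (u v) * v)"
    using st zmod.span_finite[OF fin] by auto
  then obtain a where a: "\<And>w. w \<in> W \<Longrightarrow> x * w = (\<Sum>v\<in>W. of_int (a w v) * v)"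
    by metis
  define A where "A = mat n n (\<lambda>(i,j). a (ws ! i) (ws ! j))"
  define B :: "complex mat" where "B = map_mat of_int A"
  have A: "A \<in> carrier_mat n n" by (simp add: A_def)
  have B: "B \<in> carrier_mat n n" by (simp add: A_def B_def)
  define v where "v = vec n (\<lambda>i. ws ! i)"
  have sum_eq: "(\<Sum>j<n. g (ws ! j)) = (\<Sum>w\<in>W. g w)" for g :: "complex \<Rightarrow> complex"
    using sum.reindex_bij_betw[OF bij_betw_nth[OF ws(2), of "{..<n}" W]] ws(1)
    by (simp add: n_def)
  have "B *\<^sub>v v = x \<cdot>\<^sub>v v"
  proof (rule eq_vecI)
    fix i assume "i < dim_vec (x \<cdot>\<^sub>v v)"
    then have i: "i < n" by (simp add: v_def)
    then have "ws ! i \<in> W" using ws n_def by auto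
    have "(B *\<^sub>v v) $ i = (\<Sum>j<n. of_int (a (ws ! i) (ws ! j)) * (ws ! j))"
      using i by (simp add: B_def A_def v_def mult_mat_vec_def scalar_prod_def lessThan_atLeast0)
    also have "\<dots> = x * (ws ! i)"
      using sum_eq[of "\<lambda>w. of_int (a (ws ! i) w) * w"] a[OF \<open>ws ! i \<in> W\<close>] by simp
    finally show "(B *\<^sub>v v) $ i = (x \<cdot>\<^sub>v v) $ i" using i by (simp add: v_def)
  qed (simp add: B_def A_def v_def)
  moreover have "v \<noteq> 0\<^sub>v n"
  proof
    assume "v = 0\<^sub>v n"
    obtain i where "i < n" "ws ! i = w0" using w0 ws n_def by (metis in_set_conv_nth)
    then have "v $ i = w0" by (simp add: v_def)
    with \<open>v = 0\<^sub>v n\<close> \<open>i < n\<close> w0 show False by simp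
  qed
  ultimately have "eigenvalue B x"
    unfolding eigenvalue_def eigenvector_def using B by (intro exI[of _ v]) (auto simp: v_def)
  then have "poly (char_poly B) x = 0"
    using eigenvalue_root_char_poly[OF B] by blast
  moreover have "char_poly B = map_poly of_int (char_poly A)"
    unfolding B_def using of_int_hom.char_poly_hom[OF A] by simp
  moreover have "lead_coeff (char_poly A) = 1"
    using degree_monic_char_poly[OF A] by simp
  ultimately show ?thesis
    unfolding algebraic_int_altdef_ipoly by metis
qed

lemma zmod_span_mult:
  assumes "\<And>w. w \<in> W \<Longrightarrow> x * w \<in> zmod.span V" "y \<in> zmod.span W"
  shows "x * y \<in> zmod.span V"
  using assms(2)
proof (induction rule: zmod.span_induct_alt)
  case base
  then show ?case by (simp add: zmod.span_zero)
next
  case (step k b z)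
  have "of_int k * (x * b) + x * z \<in> zmod.span V"
    using step assms(1) by (intro zmod.span_add zmod.span_scale) auto
  then show ?case by (simp add: algebra_simps)
qed

text \<open>For fixed \<open>W\<close> such \<open>x\<close> form a ring. Closure of the algebraic
  integers under sums and products thus reduces to finding one \<open>W\<close> for finitely many
  integers, as in \<open>int_stable_common\<close>.\<close>

definition int_stable :: "complex set \<Rightarrow> complex \<Rightarrow> bool" where
  "int_stable W x \<longleftrightarrow> (\<forall>w\<in>W. x * w \<in> zmod.span W)"

lemma int_stable_span: "int_stable W x \<Longrightarrow> y \<in> zmod.span W \<Longrightarrow> x * y \<in> zmod.span W"
  unfolding int_stable_def by (rule zmod_span_mult) auto

lemma int_stable_add: "int_stable W x \<Longrightarrow> int_stable W y \<Longrightarrow> int_stable W (x + y)"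
  unfolding int_stable_def by (auto simp: ring_distribs intro: zmod.span_add)

lemma int_stable_mult: "int_stable W x \<Longrightarrow> int_stable W y \<Longrightarrow> int_stable W (x * y)"
  using int_stable_span unfolding int_stable_def by (metis mult.assoc)

text \<open>The integral dependence of \<open>y\<close> on coefficients acting on the module spanned by \<open>W\<close> makes the
  products \<open>w * y ^ j\<close> span a module on which all coefficients and \<open>y\<close> act.\<close>

lemma int_stable_extend:
  assumes W: "finite W" "1 \<in> W"
    and p: "lead_coeff p = 1" "poly p y = 0" "\<And>i. int_stable W (coeff p i)"
  obtains V where "finite V" "1 \<in> V" "int_stable V y" "\<And>x. int_stable W x \<Longrightarrow> int_stable V x"
proof -
  define n where "n = degree p"
  have n0: "n > 0"
  proof (rule ccontr)
    assume "\<not> n > 0"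
    then have "degree p = 0" by (simp add: n_def)
    then obtain a where "p = [:a:]" by (rule degree_eq_zeroE)
    with p show False by auto
  qed
  define V where "V = (\<lambda>(w, j). w * y ^ j) ` (W \<times> {..<n})"
  have V: "finite V" using W by (simp add: V_def)
  have inV: "w * y ^ j \<in> V" if "w \<in> W" "j < n" for w j
    using that by (force simp: V_def)
  have lift: "z * y ^ j \<in> zmod.span V" if "z \<in> zmod.span W" "j < n" for z j
  proof -
    have "y ^ j * z \<in> zmod.span V"
      using that inV by (intro zmod_span_mult[OF _ that(1)] zmod.span_base) (simp add: mult.commute)
    then show ?thesis by (simp add: mult.commute)
  qed
  have yn: "y ^ n = - (\<Sum>i<n. coeff p i * y ^ i)"
  proof -
    have "0 = (\<Sum>i\<le>n. coeff p i * y ^ i)" using p(2) by (simp add: poly_altdef n_def)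
    also have "\<dots> = (\<Sum>i<n. coeff p i * y ^ i) + y ^ n"
      using p(1) by (simp add: n_def lessThan_Suc_atMost[symmetric])
    finally show ?thesis by (simp add: eq_neg_iff_add_eq_0 add.commute)
  qed
  show ?thesis
  proof
    show "finite V" by fact
    have "1 * y ^ 0 \<in> V" using n0 W by (intro inV) auto
    then show "1 \<in> V" by simp
    show "int_stable V y" unfolding int_stable_def
    proof
      fix v assume "v \<in> V"
      then obtain w j where v: "v = w * y ^ j" "w \<in> W" "j < n" by (auto simp: V_def)
      show "y * v \<in> zmod.span V"
      proof (cases "Suc j = n")
        case False
        then have "w * y ^ Suc j \<in> V" using v by (intro inV) auto
        then show ?thesis using v by (intro zmod.span_base) (simp add: mult_ac)
      next
        case True
        have "y * v = w * y ^ n" using v True by (simp add: mult_ac power_Suc[symmetric] del: power_Suc)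
        also have "\<dots> = - (\<Sum>i<n. (coeff p i * w) * y ^ i)"
          unfolding yn by (simp add: sum_distrib_left mult.commute mult.left_commute)
        also have "\<dots> \<in> zmod.span V"
          using p(3) v unfolding int_stable_def
          by (intro zmod.span_neg zmod.span_sum lift) auto
        finally show ?thesis .
      qed
    qed
    fix x assume x: "int_stable W x"
    show "int_stable V x" unfolding int_stable_def
    proof
      fix v assume "v \<in> V"
      then obtain w j where v: "v = w * y ^ j" "w \<in> W" "j < n" by (auto simp: V_def)
      have "x * w * y ^ j \<in> zmod.span V" using x v unfolding int_stable_def by (intro lift) auto
      then show "x * v \<in> zmod.span V" using v by (simp add: mult_ac)
    qed
  qed
qed

lemma algebraic_int_if_int_stable:
  assumes "finite W" "1 \<in> W" "int_stable W x"
  shows "algebraic_int x"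
  using assms by (intro algebraic_int_if_stable[of W 1]) (auto simp: int_stable_def)

lemma int_stable_of_int: "int_stable W (of_int k)"
  unfolding int_stable_def by (auto intro: zmod.span_scale zmod.span_base)

lemma int_stable_common:
  assumes "finite S" "\<And>x. x \<in> S \<Longrightarrow> algebraic_int x"
  shows "\<exists>W. finite W \<and> 1 \<in> W \<and> (\<forall>x\<in>S. int_stable W x)"
  using assms
proof (induction S rule: finite_induct)
  case empty
  show ?case by (intro exI[of _ "{1}"]) simp
next
  case (insert y S)
  then obtain W where W: "finite W" "1 \<in> W" "\<forall>x\<in>S. int_stable W x" by auto
  from insert have "algebraic_int y" by simp
  then obtain p where p: "lead_coeff p = 1" "\<forall>i. coeff p i \<in> \<int>" "poly p y = 0"
    by (rule algebraic_int.cases) auto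
  have "int_stable W (coeff p i)" for i
    using p(2) int_stable_of_int by (metis Ints_cases)
  from int_stable_extend[OF W(1,2) p(1,3) this] W(3) show ?case by (metis insert_iff)
qed

lemma algebraic_int_add:
  assumes "algebraic_int (x::complex)" "algebraic_int y"
  shows "algebraic_int (x + y)"
proof -
  obtain W where "finite W" "1 \<in> W" "int_stable W x" "int_stable W y"
    using int_stable_common[of "{x, y}"] assms by auto
  then show ?thesis using algebraic_int_if_int_stable int_stable_add by blast
qed

lemma algebraic_int_mult:
  assumes "algebraic_int (x::complex)" "algebraic_int y"
  shows "algebraic_int (x * y)"
proof -
  obtain W where "finite W" "1 \<in> W" "int_stable W x" "int_stable W y"
    using int_stable_common[of "{x, y}"] assms by auto
  then show ?thesis using algebraic_int_if_int_stable int_stable_mult by blast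
qed

text \<open>Transitivity of integrality: a module stable under all coefficients is enlarged to one
  stable under \<open>y\<close> as well.\<close>

lemma algebraic_int_integral:
  fixes y :: complex
  assumes "lead_coeff p = 1" "poly p y = 0" "\<And>i. algebraic_int (coeff p i)"
  shows "algebraic_int y"
proof -
  have "finite (range (coeff p))"
    by (rule finite_subset[of _ "insert 0 (coeff p ` {..degree p})"])
       (auto simp: image_iff not_le coeff_eq_0, metis atMost_iff coeff_eq_0 not_le)
  then obtain W where W: "finite W" "1 \<in> W" "\<forall>x\<in>range (coeff p). int_stable W x"
    using int_stable_common[of "range (coeff p)"] assms(3) by blast
  have "int_stable W (coeff p i)" for i using W(3) by simp
  from int_stable_extend[OF W(1,2) assms(1,2) this] show ?thesis
    using algebraic_int_if_int_stable by metis
qed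

lemma algebraic_int_diff:
  "algebraic_int (x::complex) \<Longrightarrow> algebraic_int y \<Longrightarrow> algebraic_int (x - y)"
  using algebraic_int_add[of x "- y"] by simp

lemma algebraic_int_power: "algebraic_int (x::complex) \<Longrightarrow> algebraic_int (x ^ n)"
  by (induction n) (auto intro: algebraic_int_mult)

lemma algebraic_int_sum: "(\<And>i. i \<in> I \<Longrightarrow> algebraic_int (g i :: complex)) \<Longrightarrow> algebraic_int (sum g I)"
  by (induction I rule: infinite_finite_induct) (auto intro: algebraic_int_add)

lemma algebraic_int_prod: "(\<And>i. i \<in> I \<Longrightarrow> algebraic_int (g i :: complex)) \<Longrightarrow> algebraic_int (prod g I)"
  by (induction I rule: infinite_finite_induct) (auto intro: algebraic_int_mult)

lemma algebraic_int_of_power: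
  assumes "algebraic_int ((x::complex) ^ n)" "n > 0"
  shows "algebraic_int x"
proof -
  define p where "p = monom 1 n - [:x ^ n:]"
  have 1: "coeff p n = 1" using assms(2) by (cases n) (auto simp: p_def)
  have "degree p \<le> n"
    unfolding p_def by (intro degree_diff_le) (auto simp: degree_monom_le)
  moreover have "n \<le> degree p" using 1 by (intro le_degree) simp
  ultimately have "lead_coeff p = 1" using 1 by simp
  moreover have "poly p x = 0" by (simp add: p_def poly_monom)
  moreover have "algebraic_int (coeff p i)" for i
    using assms by (auto simp: p_def coeff_pCons intro!: algebraic_int_diff split: nat.splits)
  ultimately show ?thesis
    by (rule algebraic_int_integral)
qed

lemma algebraic_int_root_of_unity: "(x::complex) ^ n = 1 \<Longrightarrow> n > 0 \<Longrightarrow> algebraic_int x"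
  by (rule algebraic_int_of_power[of _ n]) auto

lemma algebraic_int_of_int_over_int:
  assumes "algebraic_int (of_int a / of_int b :: complex)" "b \<noteq> 0"
  shows "b dvd a"
proof -
  have "of_int a / of_int b \<in> (\<int> :: complex set)"
    using assms by (intro rational_algebraic_int_is_int) auto
  then obtain k where "of_int a / of_int b = (of_int k :: complex)" by (auto elim: Ints_cases)
  then have "(of_int a :: complex) = of_int (k * b)" using assms by (simp add: field_simps)
  then have "a = k * b" using of_int_eq_iff by blast
  then show ?thesis by simp
qed

section \<open>Algebraic numbers\<close>

lemma algebraic_int_lead_coeff_mult_root:
  fixes x :: complex
  assumes p: "p \<noteq> 0" "poly p x = 0" "\<And>i. algebraic_int (coeff p i)"
  shows "algebraic_int (lead_coeff p * x)"
proof -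
  define a where "a = lead_coeff p"
  define n where "n = degree p"
  have n0: "n > 0"
  proof (rule ccontr)
    assume "\<not> n > 0"
    then have "degree p = 0" by (simp add: n_def)
    then obtain b where "p = [:b:]" by (rule degree_eq_zeroE)
    with p show False by auto
  qed
  \<comment> \<open>This is \<open>a ^ (n - 1) * p (X / a)\<close>: monic, with integral
    coefficients and root \<open>a * x\<close>.\<close>
  define q :: "complex poly" where
    "q = monom 1 n + (\<Sum>i<n. monom (coeff p i * a ^ (n - 1 - i)) i)"
  have deg: "degree (\<Sum>i<n. monom (coeff p i * a ^ (n - 1 - i)) i) < n"
    using n0 by (intro degree_sum_less) (auto intro: le_less_trans[OF degree_monom_le])
  have dq: "degree q = n" unfolding q_def
    using deg by (subst degree_add_eq_left) (auto simp: degree_monom_eq)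
  have lq: "lead_coeff q = 1" using deg unfolding dq by (simp add: q_def coeff_eq_0)
  have "algebraic_int (coeff p j * a ^ (n - 1 - j))" for j
    unfolding a_def by (intro algebraic_int_mult algebraic_int_power p(3))
  then have cq: "algebraic_int (coeff q i)" for i
    unfolding q_def coeff_add coeff_sum coeff_monom
    by (intro algebraic_int_add algebraic_int_sum) simp_all
  have "poly q (a * x) = a ^ (n-1) * (\<Sum>i\<le>n. coeff p i * x ^ i)"
  proof -
    have "poly q (a * x) = (a * x) ^ n + (\<Sum>i<n. coeff p i * a ^ (n - 1 - i) * (a * x) ^ i)"
      by (simp add: q_def poly_sum poly_monom)
    also have "(a * x) ^ n = a ^ (n-1) * (coeff p n * x ^ n)"
      using n0 by (cases n) (simp_all add: a_def n_def power_mult_distrib mult_ac)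
    also have "(\<Sum>i<n. coeff p i * a ^ (n - 1 - i) * (a * x) ^ i)
      = a ^ (n-1) * (\<Sum>i<n. coeff p i * x ^ i)"
      unfolding sum_distrib_left
    proof (rule sum.cong)
      fix i assume "i \<in> {..<n}"
      then have "a ^ (n-1) = a ^ (n - 1 - i) * a ^ i"
        by (subst power_add[symmetric]) auto
      then show "coeff p i * a ^ (n - 1 - i) * (a * x) ^ i = a ^ (n-1) * (coeff p i * x ^ i)"
        by (simp add: power_mult_distrib mult_ac)
    qed simp
    finally show ?thesis by (simp add: lessThan_Suc_atMost[symmetric] ring_distribs)
  qed
  also have "(\<Sum>i\<le>n. coeff p i * x ^ i) = 0"
    using p(2) by (simp add: poly_altdef n_def)
  finally have "poly q (a * x) = 0" by simp
  from algebraic_int_integral[OF lq this cq] show ?thesis by (simp only: a_def)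
qed

lemma algebraic_scaled_int:
  assumes "algebraic (x::complex)"
  obtains k :: int where "k \<noteq> 0" "algebraic_int (of_int k * x)"
proof -
  obtain p where p: "p \<noteq> 0" "poly (map_poly of_int p) x = 0" using assms by (rule algebraicE')
  have "algebraic_int (lead_coeff (map_poly of_int p) * x)"
  proof (rule algebraic_int_lead_coeff_mult_root)
    show "map_poly of_int p \<noteq> (0 :: complex poly)" using p(1) by simp
    show "algebraic_int (coeff (map_poly of_int p :: complex poly) i)" for i by simp
  qed (rule p(2))
  then have "algebraic_int (of_int (lead_coeff p) * x)" by simp
  with p(1) show ?thesis by (intro that[of "lead_coeff p"]) simp_all
qed

lemma algebraic_if_scaled:
  assumes "algebraic (of_int k * x :: complex)" "k \<noteq> 0"
  shows "algebraic x"
proof -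
  obtain p where p: "p \<noteq> 0" "poly (map_poly of_int p) (of_int k * x) = 0"
    using assms(1) by (rule algebraicE')
  define q where "q = pcompose p [:0, k:]"
  have "q \<noteq> 0" using p assms(2) by (simp add: q_def pcompose_eq_0_iff)
  moreover have "map_poly of_int [:0, k:] = [:0, of_int k :: complex:]"
    by (rule poly_eqI) (simp add: coeff_pCons split: nat.split)
  then have "poly (map_poly of_int q) x = poly (map_poly of_int p) (of_int k * x)"
    unfolding q_def of_int_hom.map_poly_pcompose poly_pcompose by (simp add: mult.commute)
  ultimately show ?thesis
    using p by (intro algebraicI[of "map_poly of_int q"]) auto
qed

lemma algebraic_add:
  assumes "algebraic (x::complex)" "algebraic y"
  shows "algebraic (x + y)"
proof -
  obtain k where k: "k \<noteq> 0" "algebraic_int (of_int k * x)" using assms(1) by (rule algebraic_scaled_int)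
  obtain l where l: "l \<noteq> 0" "algebraic_int (of_int l * y)" using assms(2) by (rule algebraic_scaled_int)
  have "algebraic_int (of_int l * (of_int k * x) + of_int k * (of_int l * y))"
    using k(2) l(2)
    by (intro algebraic_int_add algebraic_int_mult[OF algebraic_int_of_int, where y = "_ * _"])
  also have "of_int l * (of_int k * x) + of_int k * (of_int l * y) = of_int (k * l) * (x + y)"
    by (simp add: algebra_simps)
  finally have "algebraic_int (of_int (k * l) * (x + y))" .
  from algebraic_if_scaled[OF algebraic_int_imp_algebraic[OF this]] k l show ?thesis by simp
qed

lemma algebraic_mult:
  assumes "algebraic (x::complex)" "algebraic y"
  shows "algebraic (x * y)"
proof -
  obtain k where k: "k \<noteq> 0" "algebraic_int (of_int k * x)" using assms(1) by (rule algebraic_scaled_int)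
  obtain l where l: "l \<noteq> 0" "algebraic_int (of_int l * y)" using assms(2) by (rule algebraic_scaled_int)
  have "algebraic_int ((of_int k * x) * (of_int l * y))"
    using k l by (intro algebraic_int_mult[of "of_int k * x"])
  also have "(of_int k * x) * (of_int l * y) = of_int (k * l) * (x * y)"
    by (simp add: algebra_simps)
  finally have "algebraic_int (of_int (k * l) * (x * y))" .
  from algebraic_if_scaled[OF algebraic_int_imp_algebraic[OF this]] k l show ?thesis by simp
qed

lemma algebraic_of_int [simp]: "algebraic (of_int k :: complex)"
  by auto

lemma algebraic_uminus: "algebraic (x::complex) \<Longrightarrow> algebraic (- x)"
  using algebraic_mult[OF algebraic_of_int[of "-1"], of x] by simp

lemma algebraic_diff: "algebraic (x::complex) \<Longrightarrow> algebraic y \<Longrightarrow> algebraic (x - y)"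
  using algebraic_add[of x "- y"] algebraic_uminus by simp

lemma algebraic_sum: "(\<And>i. i \<in> I \<Longrightarrow> algebraic (g i :: complex)) \<Longrightarrow> algebraic (sum g I)"
  by (induction I rule: infinite_finite_induct) (auto intro: algebraic_add)

lemma algebraic_power: "algebraic (x::complex) \<Longrightarrow> algebraic (x ^ n)"
  by (induction n) (auto intro: algebraic_mult)

section \<open>Finitely generated subrings and subfields\<close>

inductive_set int_adjoin :: "complex set \<Rightarrow> complex set" for S where
  one: "1 \<in> int_adjoin S"
| incl: "x \<in> S \<Longrightarrow> x \<in> int_adjoin S"
| uminus: "x \<in> int_adjoin S \<Longrightarrow> - x \<in> int_adjoin S"
| add: "x \<in> int_adjoin S \<Longrightarrow> y \<in> int_adjoin S \<Longrightarrow> x + y \<in> int_adjoin S"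
| mult: "x \<in> int_adjoin S \<Longrightarrow> y \<in> int_adjoin S \<Longrightarrow> x * y \<in> int_adjoin S"

lemma int_adjoin_zero [simp]: "0 \<in> int_adjoin S"
  using int_adjoin.add[OF int_adjoin.one int_adjoin.uminus[OF int_adjoin.one]] by simp

declare int_adjoin.one [simp]

lemma int_adjoin_diff: "x \<in> int_adjoin S \<Longrightarrow> y \<in> int_adjoin S \<Longrightarrow> x - y \<in> int_adjoin S"
  using int_adjoin.add[OF _ int_adjoin.uminus, of x S y] by simp

lemma int_adjoin_power: "x \<in> int_adjoin S \<Longrightarrow> x ^ n \<in> int_adjoin S"
  by (induction n) (auto intro: int_adjoin.mult)

lemma int_adjoin_of_nat [simp]: "of_nat n \<in> int_adjoin S"
  by (induction n) (auto intro: int_adjoin.add)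

lemma int_adjoin_of_int [simp]: "of_int k \<in> int_adjoin S"
  by (cases k) (auto intro: int_adjoin.uminus simp del: of_nat_Suc)

lemma int_adjoin_numeral [simp]: "numeral n \<in> int_adjoin S"
  using int_adjoin_of_nat[of "numeral n" S] by simp

lemma int_adjoin_sum: "(\<And>i. i \<in> I \<Longrightarrow> g i \<in> int_adjoin S) \<Longrightarrow> sum g I \<in> int_adjoin S"
  by (induction I rule: infinite_finite_induct) (auto intro: int_adjoin.add)

lemma int_adjoin_poly:
  "(\<And>i. coeff p i \<in> int_adjoin S) \<Longrightarrow> x \<in> int_adjoin S \<Longrightarrow> poly p x \<in> int_adjoin S"
  unfolding poly_altdef by (intro int_adjoin_sum int_adjoin.mult int_adjoin_power)

lemma int_adjoin_least:
  assumes "S \<subseteq> int_adjoin T"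
  shows "int_adjoin S \<subseteq> int_adjoin T"
proof
  fix x assume "x \<in> int_adjoin S"
  then show "x \<in> int_adjoin T"
    by induction (use assms in \<open>auto intro: int_adjoin.intros\<close>)
qed

lemma int_adjoin_algebraic:
  assumes "x \<in> int_adjoin S" "\<And>s. s \<in> S \<Longrightarrow> algebraic s"
  shows "algebraic x"
  using assms(1) by induction (use assms(2) in \<open>auto intro: algebraic_add algebraic_mult algebraic_uminus\<close>)

lemma int_adjoin_algebraic_int:
  assumes "x \<in> int_adjoin S" "\<And>s. s \<in> S \<Longrightarrow> algebraic_int s"
  shows "algebraic_int x"
  using assms(1) by induction (use assms(2) in \<open>auto intro: algebraic_int_add algebraic_int_mult\<close>)

text \<open>The fraction field of \<open>int_adjoin S\<close> when all elements of \<open>S\<close> are algebraic: rational integers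
  then suffice as denominators.\<close>

definition field_adjoin :: "complex set \<Rightarrow> complex set" where
  "field_adjoin S = {x. \<exists>k::int. k \<noteq> 0 \<and> of_int k * x \<in> int_adjoin S}"

lemma field_adjoinI: "k \<noteq> 0 \<Longrightarrow> of_int k * x \<in> int_adjoin S \<Longrightarrow> x \<in> field_adjoin S"
  unfolding field_adjoin_def by blast

lemma field_adjoinE:
  assumes "x \<in> field_adjoin S"
  obtains k :: int where "k \<noteq> 0" "of_int k * x \<in> int_adjoin S"
  using assms unfolding field_adjoin_def by blast

lemma int_adjoin_subset_field_adjoin: "int_adjoin S \<subseteq> field_adjoin S"
  using field_adjoinI[of 1] by auto

lemma field_adjoin_mono:
  assumes "int_adjoin S \<subseteq> int_adjoin T"
  shows "field_adjoin S \<subseteq> field_adjoin T"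
  using assms unfolding field_adjoin_def by blast

lemma field_adjoin_uminus: "x \<in> field_adjoin S \<Longrightarrow> - x \<in> field_adjoin S"
  by (erule field_adjoinE) (auto intro!: field_adjoinI dest: int_adjoin.uminus)

lemma field_adjoin_add:
  assumes "x \<in> field_adjoin S" "y \<in> field_adjoin S"
  shows "x + y \<in> field_adjoin S"
proof -
  obtain k where k: "k \<noteq> 0" "of_int k * x \<in> int_adjoin S" using assms(1) by (rule field_adjoinE)
  obtain l where l: "l \<noteq> 0" "of_int l * y \<in> int_adjoin S" using assms(2) by (rule field_adjoinE)
  have "of_int l * (of_int k * x) + of_int k * (of_int l * y) \<in> int_adjoin S"
    using k(2) l(2)
    by (intro int_adjoin.add int_adjoin.mult[OF int_adjoin_of_int, where y = "_ * _"])
  also have "of_int l * (of_int k * x) + of_int k * (of_int l * y) = of_int (k * l) * (x + y)"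
    by (simp add: algebra_simps)
  finally show ?thesis by (rule field_adjoinI[rotated]) (use k l in simp)
qed

lemma field_adjoin_mult:
  assumes "x \<in> field_adjoin S" "y \<in> field_adjoin S"
  shows "x * y \<in> field_adjoin S"
proof -
  obtain k where k: "k \<noteq> 0" "of_int k * x \<in> int_adjoin S" using assms(1) by (rule field_adjoinE)
  obtain l where l: "l \<noteq> 0" "of_int l * y \<in> int_adjoin S" using assms(2) by (rule field_adjoinE)
  have "(of_int k * x) * (of_int l * y) \<in> int_adjoin S"
    using k l by (intro int_adjoin.mult[of "of_int k * x"])
  also have "(of_int k * x) * (of_int l * y) = of_int (k * l) * (x * y)"
    by (simp add: algebra_simps)
  finally show ?thesis by (rule field_adjoinI[rotated]) (use k l in simp)
qed

lemma field_adjoin_diff: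
  "x \<in> field_adjoin S \<Longrightarrow> y \<in> field_adjoin S \<Longrightarrow> x - y \<in> field_adjoin S"
  using field_adjoin_add[OF _ field_adjoin_uminus, of x S y] by simp

lemma field_adjoin_incl: "x \<in> S \<Longrightarrow> x \<in> field_adjoin S"
  using int_adjoin_subset_field_adjoin int_adjoin.incl by blast

lemma field_adjoin_of_int [simp]: "of_int k \<in> field_adjoin S"
  using int_adjoin_subset_field_adjoin int_adjoin_of_int by blast

lemma field_adjoin_one [simp]: "1 \<in> field_adjoin S"
  using field_adjoin_of_int[of 1] by simp

lemma field_adjoin_zero [simp]: "0 \<in> field_adjoin S"
  using field_adjoin_of_int[of 0] by simp

lemma field_adjoin_power: "x \<in> field_adjoin S \<Longrightarrow> x ^ n \<in> field_adjoin S"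
  by (induction n) (auto intro: field_adjoin_mult)

lemma field_adjoin_algebraic:
  assumes "x \<in> field_adjoin S" "\<And>s. s \<in> S \<Longrightarrow> algebraic s"
  shows "algebraic x"
  using assms(1) by (rule field_adjoinE) (metis int_adjoin_algebraic algebraic_if_scaled assms(2))

text \<open>Solving the integral equation of \<open>x\<close> for \<open>inverse x\<close> leaves
  only a rational integer as denominator, which is what makes \<open>field_adjoin\<close> a
  field.\<close>

lemma poly_inverse_identity:
  fixes x :: complex
  assumes "poly (map_poly of_int p) x = 0" "coeff p 0 \<noteq> 0" "x \<noteq> 0"
  shows "of_int (coeff p 0) * inverse x = - poly (map_poly of_int (poly_shift 1 p)) x"
proof -
  have "p = pCons (coeff p 0) (poly_shift 1 p)"
    by (rule poly_eqI) (simp add: coeff_pCons coeff_poly_shift split: nat.split)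
  then have "map_poly of_int p = pCons (of_int (coeff p 0)) (map_poly of_int (poly_shift 1 p) :: complex poly)"
    by (intro poly_eqI) (simp add: coeff_pCons coeff_poly_shift split: nat.split)
  then have "of_int (coeff p 0) + x * poly (map_poly of_int (poly_shift 1 p)) x = 0"
    using assms(1) by simp
  then show ?thesis using assms(3) by (simp add: field_simps eq_neg_iff_add_eq_0)
qed

lemma field_adjoin_inverse:
  assumes "x \<in> field_adjoin S" "\<And>s. s \<in> S \<Longrightarrow> algebraic s"
  shows "inverse x \<in> field_adjoin S"
proof (cases "x = 0")
  case False
  obtain k where k: "k \<noteq> 0" "of_int k * x \<in> int_adjoin S" using assms(1) by (rule field_adjoinE)
  define y where "y = of_int k * x"
  have y0: "y \<noteq> 0" using False k by (simp add: y_def)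
  have "algebraic y" using k(2) assms(2) unfolding y_def by (rule int_adjoin_algebraic)
  then obtain p where p: "coeff p 0 \<noteq> 0" "poly (map_poly of_int p) y = 0"
    using algebraicE'_nonzero y0 by metis
  have "of_int (coeff p 0) * inverse y \<in> int_adjoin S"
    unfolding poly_inverse_identity[OF p(2,1) y0]
    using k by (intro int_adjoin.uminus int_adjoin_poly) (auto simp: y_def)
  then have "inverse y \<in> field_adjoin S" using p by (intro field_adjoinI)
  then have "of_int k * inverse y \<in> field_adjoin S" by (intro field_adjoin_mult) auto
  also have "of_int k * inverse y = inverse x" using k False by (simp add: y_def)
  finally show ?thesis .
qed auto

lemma field_adjoin_divide:
  assumes "x \<in> field_adjoin S" "y \<in> field_adjoin S" "\<And>s. s \<in> S \<Longrightarrow> algebraic s"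
  shows "x / y \<in> field_adjoin S"
  using assms by (simp add: divide_inverse field_adjoin_mult field_adjoin_inverse)

lemma algebraic_divide: "algebraic (x::complex) \<Longrightarrow> algebraic y \<Longrightarrow> algebraic (x / y)"
  by (simp add: divide_inverse algebraic_mult algebraic_inverse)

lemma generated_subfield_subset_field_adjoin:
  assumes "T \<subseteq> field_adjoin S" "\<And>s. s \<in> S \<Longrightarrow> algebraic s"
  shows "generated_subfield T \<subseteq> field_adjoin S"
proof
  let ?R = "ring_of_type_algebra :: complex ring"
  interpret R: field ?R by (rule field_from_type_algebra)
  have car: "carrier ?R = UNIV" and zero: "\<zero>\<^bsub>?R\<^esub> = 0" and one_eq: "\<one>\<^bsub>?R\<^esub> = 1"
    and add: "\<And>x y. x \<oplus>\<^bsub>?R\<^esub> y = x + y" and mult: "\<And>x y. x \<otimes>\<^bsub>?R\<^esub> y = x * y"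
    by (simp_all add: ring_of_type_algebra_def)
  have neg: "\<ominus>\<^bsub>?R\<^esub> x = - x" for x
    by (rule R.minus_equality) (simp_all add: car zero add)
  have inv: "inv\<^bsub>?R\<^esub> x = inverse x" if "x \<noteq> 0" for x
    by (rule R.inv_unique'[symmetric]) (simp_all add: car one_eq mult that)
  fix x assume "x \<in> generated_subfield T"
  then have "x \<in> generate_field ?R T" by (simp add: generated_subfield_def)
  then show "x \<in> field_adjoin S"
  proof induction
    case one
    then show ?case by (simp add: one_eq)
  next
    case (incl h)
    then show ?case using assms by auto
  next
    case (a_inv h)
    then show ?case by (simp add: neg field_adjoin_uminus)
  next
    case (m_inv h)
    then show ?case using assms(2) by (simp add: inv zero field_adjoin_inverse)
  next
    case (eng_add h1 h2)
    then show ?case by (simp add: add field_adjoin_add)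
  next
    case (eng_mult h1 h2)
    then show ?case by (simp add: mult field_adjoin_mult)
  qed
qed

section \<open>Automorphisms of the field of algebraic numbers\<close>

text \<open>The graph of a ring homomorphism from a ring of algebraic numbers into \<open>\<complex>\<close>.\<close>

definition partial_hom :: "(complex \<times> complex) set \<Rightarrow> bool" where
  "partial_hom r \<longleftrightarrow> (1, 1) \<in> r \<and> (\<forall>a b. (a, b) \<in> r \<longrightarrow> algebraic a \<and> (- a, - b) \<in> r) \<and>
     (\<forall>a b c d. (a, b) \<in> r \<longrightarrow> (c, d) \<in> r \<longrightarrow> (a + c, b + d) \<in> r \<and> (a * c, b * d) \<in> r) \<and>
     (\<forall>b. (0, b) \<in> r \<longrightarrow> b = 0)"

definition rel_poly :: "(complex \<times> complex) set \<Rightarrow> complex poly \<Rightarrow> complex poly \<Rightarrow> bool" where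
  "rel_poly r u v \<longleftrightarrow> (\<forall>i. (coeff u i, coeff v i) \<in> r)"

text \<open>The only candidate for an extension of the homomorphism \<open>r\<close> that sends
  \<open>x\<close> to \<open>y\<close>. It is single-valued when polynomials vanishing at
  \<open>x\<close> have images vanishing at \<open>y\<close>.\<close>

definition adjoin_rel :: "(complex \<times> complex) set \<Rightarrow> complex \<Rightarrow> complex \<Rightarrow> (complex \<times> complex) set" where
  "adjoin_rel r x y = {(poly u x, poly v y) | u v. rel_poly r u v}"

section \<open>Partial homomorphisms and their coefficientwise action on polynomials\<close>

context
  fixes r assumes r: "partial_hom r"
begin

lemma ph_one: "(1, 1) \<in> r"
  and ph_alg: "(a, b) \<in> r \<Longrightarrow> algebraic a"
  and ph_neg: "(a, b) \<in> r \<Longrightarrow> (- a, - b) \<in> r"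
  and ph_add: "(a, b) \<in> r \<Longrightarrow> (c, d) \<in> r \<Longrightarrow> (a + c, b + d) \<in> r"
  and ph_mult: "(a, b) \<in> r \<Longrightarrow> (c, d) \<in> r \<Longrightarrow> (a * c, b * d) \<in> r"
  and ph_zeroD: "(0, b) \<in> r \<Longrightarrow> b = 0"
  using r unfolding partial_hom_def by blast+

lemma ph_diff: "(a, b) \<in> r \<Longrightarrow> (c, d) \<in> r \<Longrightarrow> (a - c, b - d) \<in> r"
  using ph_add[OF _ ph_neg, of a b c d] by simp

lemma ph_zero: "(0, 0) \<in> r"
  using ph_diff[OF ph_one ph_one] by simp

lemma ph_unique: "(a, b) \<in> r \<Longrightarrow> (a, c) \<in> r \<Longrightarrow> b = c"
  using ph_zeroD[of "b - c"] ph_diff[of a b a c] by simp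

lemma ph_of_nat: "(of_nat n, of_nat n) \<in> r"
  by (induction n) (auto intro: ph_zero ph_add ph_one)

lemma ph_of_int: "(of_int k, of_int k) \<in> r"
  using ph_of_nat[of "nat k"] ph_neg[OF ph_of_nat[of "nat (- k)"]] by (cases "k \<ge> 0") auto

lemma ph_sum: "(\<And>i. i \<in> I \<Longrightarrow> (g i, h i) \<in> r) \<Longrightarrow> (sum g I, sum h I) \<in> r"
  by (induction I rule: infinite_finite_induct) (auto intro: ph_add ph_zero)

lemma ph_ipoly:
  "(a, b) \<in> r \<Longrightarrow> (poly (map_poly of_int p) a, poly (map_poly of_int p) b) \<in> r"
  by (induction p) (simp_all add: of_int_hom.map_poly_pCons_hom ph_zero ph_add ph_mult ph_of_int)

lemma ph_ipoly_root:
  "(a, b) \<in> r \<Longrightarrow> poly (map_poly of_int p) a = 0 \<Longrightarrow> poly (map_poly of_int p) b = 0"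
  using ph_ipoly[of a b p] ph_zeroD by auto

text \<open>The domain is only a ring, so \<open>a\<close> need not have an inverse there. Instead,
  an integral equation of \<open>a\<close> with nonzero constant term holds for \<open>b\<close>
  too.\<close>

lemma ph_nonzero:
  assumes "(a, b) \<in> r" "a \<noteq> 0"
  shows "b \<noteq> 0"
proof
  assume "b = 0"
  obtain p where p: "coeff p 0 \<noteq> 0" "poly (map_poly of_int p) a = 0"
    using algebraicE'_nonzero[OF ph_alg[OF assms(1)] assms(2)] by metis
  then have "poly (map_poly of_int p) b = 0" using ph_ipoly_root[OF assms(1)] by blast
  with p(1) \<open>b = 0\<close> show False by (simp add: poly_0_coeff_0)
qed

lemma rel_poly_add: "rel_poly r u v \<Longrightarrow> rel_poly r u' v' \<Longrightarrow> rel_poly r (u + u') (v + v')"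
  and rel_poly_neg: "rel_poly r u v \<Longrightarrow> rel_poly r (- u) (- v)"
  and rel_poly_diff: "rel_poly r u v \<Longrightarrow> rel_poly r u' v' \<Longrightarrow> rel_poly r (u - u') (v - v')"
  by (simp_all add: rel_poly_def ph_add ph_neg ph_diff)

lemma rel_poly_mult:
  assumes "rel_poly r u v" "rel_poly r u' v'"
  shows "rel_poly r (u * u') (v * v')"
  unfolding rel_poly_def coeff_mult
proof
  fix n
  show "(\<Sum>i\<le>n. coeff u i * coeff u' (n - i), \<Sum>i\<le>n. coeff v i * coeff v' (n - i)) \<in> r"
    using assms by (intro ph_sum ph_mult) (simp_all add: rel_poly_def)
qed

lemma rel_poly_pCons: "(a, b) \<in> r \<Longrightarrow> rel_poly r u v \<Longrightarrow> rel_poly r (pCons a u) (pCons b v)"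
  by (simp add: rel_poly_def coeff_pCons split: nat.split)

lemma rel_poly_zero: "rel_poly r 0 0"
  by (simp add: rel_poly_def ph_zero)

lemma rel_poly_monom: "(a, b) \<in> r \<Longrightarrow> rel_poly r (monom a n) (monom b n)"
  by (simp add: rel_poly_def ph_zero)

lemma rel_poly_of_int: "rel_poly r (map_poly of_int p) (map_poly of_int p)"
  by (simp add: rel_poly_def ph_of_int)

lemma rel_poly_zeroD: "rel_poly r 0 v \<Longrightarrow> v = 0"
  by (rule poly_eqI) (auto simp: rel_poly_def intro: ph_zeroD)

lemma rel_poly_degree: "rel_poly r u v \<Longrightarrow> degree v = degree u"
proof (rule antisym)
  assume uv: "rel_poly r u v"
  show "degree v \<le> degree u"
    by (rule degree_le) (metis coeff_eq_0 ph_zeroD rel_poly_def uv)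
  show "degree u \<le> degree v"
    by (rule degree_le) (metis coeff_eq_0 ph_nonzero rel_poly_def uv)
qed

text \<open>Division with remainder by a monic polynomial, carried out on both sides of the
  homomorphism at once, so that quotient and remainder of \<open>v\<close> are the images of those
  of \<open>u\<close>.\<close>

lemma rel_poly_divide:
  assumes pq: "rel_poly r p q" "lead_coeff p = 1"
    and uv: "rel_poly r u v"
  shows "\<exists>s s' t t'. rel_poly r s s' \<and> rel_poly r t t' \<and> u = p * s + t \<and> v = q * s' + t' \<and>
           (t = 0 \<or> degree t < degree p)"
  using uv
proof (induction "degree u" arbitrary: u v rule: less_induct)
  case (less u v)
  show ?case
  proof (cases "u = 0 \<or> degree u < degree p")
    case True
    then show ?thesis using less.prems rel_poly_zero by (intro exI[of _ 0] exI[of _ u] exI[of _ v]) auto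
  next
    case False
    define n where "n = degree u - degree p"
    define a where "a = lead_coeff u"
    define b where "b = coeff v (degree u)"
    have ab: "(a, b) \<in> r" using less.prems by (simp add: a_def b_def rel_poly_def)
    define u' where "u' = u - p * monom a n"
    define v' where "v' = v - q * monom b n"
    have r': "rel_poly r u' v'"
      unfolding u'_def v'_def using less.prems pq ab
      by (intro rel_poly_diff rel_poly_mult rel_poly_monom)
    have "u' = 0 \<or> degree u' < degree u"
    \<comment> \<open>Constants are special because their degree cannot drop: here
      \<open>p = 1\<close> and the remainder is zero.\<close>
    proof (cases "degree u = 0")
      case True
      with False have d: "degree p = 0" "n = 0" by (auto simp: n_def)
      with True pq(2) have "p = 1" "u = [:a:]"
        by (auto elim!: degree_eq_zeroE simp: a_def)
      then show ?thesis by (simp add: u'_def d monom_0)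
    next
      case nz: False
      have "degree (p * monom a n) \<le> degree u"
        using False degree_mult_le[of p "monom a n"] degree_monom_le[of a n]
        unfolding n_def by linarith
      then have "degree u' \<le> degree u" unfolding u'_def by (intro degree_diff_le) auto
      moreover have "coeff u' (degree u) = 0"
      proof -
        have "degree u = degree p + n" using False by (simp add: n_def)
        then have "coeff (p * monom a n) (degree u) = a"
          using pq(2) by (simp add: mult.commute[of p] coeff_monom_mult)
        then show ?thesis by (simp add: u'_def a_def)
      qed
      ultimately show ?thesis
        using nz by (metis degree_0 eq_zero_or_degree_less gr_zeroI)
    qed
    then obtain s s' t t' where st: "rel_poly r s s'" "rel_poly r t t'" "u' = p * s + t"
      "v' = q * s' + t'" "t = 0 \<or> degree t < degree p"
    proof
      assume "u' = 0"
      with r' have "v' = 0" using rel_poly_zeroD by blast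
      with \<open>u' = 0\<close> show ?thesis using that[of 0 0 0 0] rel_poly_zero by simp
    next
      assume "degree u' < degree u"
      from less.hyps[OF this r'] show ?thesis using that by blast
    qed
    show ?thesis
    proof (intro exI conjI)
      show "rel_poly r (s + monom a n) (s' + monom b n)"
        using st ab by (intro rel_poly_add rel_poly_monom)
      show "u = p * (s + monom a n) + t" using st(3) by (simp add: u'_def algebra_simps)
      show "v = q * (s' + monom b n) + t'" using st(4) by (simp add: v'_def algebra_simps)
    qed (use st in auto)
  qed
qed

lemma adjoin_relI: "rel_poly r u v \<Longrightarrow> (poly u x, poly v y) \<in> adjoin_rel r x y"
  unfolding adjoin_rel_def by blast

lemma adjoin_rel_extends: "r \<subseteq> adjoin_rel r x y"
proof
  fix z assume "z \<in> r"
  then show "z \<in> adjoin_rel r x y"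
    using adjoin_relI[OF rel_poly_pCons[OF _ rel_poly_zero], of "fst z" "snd z" x y] by simp
qed

lemma adjoin_rel_incl: "(x, y) \<in> adjoin_rel r x y"
  using adjoin_relI[OF rel_poly_pCons[OF ph_zero rel_poly_pCons[OF ph_one rel_poly_zero]], of x y]
  by simp

lemma partial_hom_adjoin_rel:
  assumes x: "algebraic x"
    and van: "\<And>u v. rel_poly r u v \<Longrightarrow> poly u x = 0 \<Longrightarrow> poly v y = 0"
  shows "partial_hom (adjoin_rel r x y)"
  unfolding partial_hom_def
proof (intro conjI allI impI)
  show "(1, 1) \<in> adjoin_rel r x y" using adjoin_rel_extends ph_one by blast
next
  fix a b assume "(a, b) \<in> adjoin_rel r x y"
  then obtain u v where uv: "rel_poly r u v" "a = poly u x" "b = poly v y"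
    unfolding adjoin_rel_def by blast
  show "algebraic a" unfolding uv(2) poly_altdef
    using uv(1) x ph_alg by (intro algebraic_sum algebraic_mult algebraic_power) (auto simp: rel_poly_def)
  show "(- a, - b) \<in> adjoin_rel r x y"
    using adjoin_relI[OF rel_poly_neg[OF uv(1)], of x y] uv by simp
next
  fix a b c d assume "(a, b) \<in> adjoin_rel r x y" "(c, d) \<in> adjoin_rel r x y"
  then obtain u v u' v' where uv: "rel_poly r u v" "a = poly u x" "b = poly v y"
    "rel_poly r u' v'" "c = poly u' x" "d = poly v' y"
    unfolding adjoin_rel_def by blast
  show "(a + c, b + d) \<in> adjoin_rel r x y"
    using adjoin_relI[OF rel_poly_add[OF uv(1,4)], of x y] uv by simp
  show "(a * c, b * d) \<in> adjoin_rel r x y"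
    using adjoin_relI[OF rel_poly_mult[OF uv(1,4)], of x y] uv by simp
next
  fix b assume "(0, b) \<in> adjoin_rel r x y"
  then obtain u v where "rel_poly r u v" "0 = poly u x" "b = poly v y"
    unfolding adjoin_rel_def by blast
  then show "b = 0" using van by simp
qed

text \<open>A homomorphism extends to the fraction field of its domain; a maximal one is therefore
  defined on a field.\<close>

lemma partial_hom_fractions:
  "partial_hom {(a / d, b / e) | a b d e. (a, b) \<in> r \<and> (d, e) \<in> r \<and> d \<noteq> 0}"
proof -
  define s where "s = {(a / d, b / e) | a b d e. (a, b) \<in> r \<and> (d, e) \<in> r \<and> d \<noteq> 0}"
  have I: "(x, y) \<in> s" if "(a, b) \<in> r" "(d, e) \<in> r" "d \<noteq> 0" "x = a / d" "y = b / e" for a b d e x y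
    using that unfolding s_def by blast
  have E: "\<exists>a b d e. x = a / d \<and> y = b / e \<and> (a, b) \<in> r \<and> (d, e) \<in> r \<and> d \<noteq> 0 \<and> e \<noteq> 0"
    if "(x, y) \<in> s" for x y
    using that ph_nonzero unfolding s_def by blast
  have "partial_hom s"
    unfolding partial_hom_def
  proof (intro conjI allI impI)
    show "(1, 1) \<in> s" using I[OF ph_one ph_one] by simp
  next
    fix x y assume "(x, y) \<in> s"
    then obtain a b d e where *: "x = a / d" "y = b / e" "(a, b) \<in> r" "(d, e) \<in> r" "d \<noteq> 0"
      using E by blast
    show "algebraic x" using * ph_alg algebraic_divide by blast
    show "(- x, - y) \<in> s" using * by (intro I[OF ph_neg[OF *(3)] *(4,5)]) simp_all
  next
    fix x y x' y' assume "(x, y) \<in> s" "(x', y') \<in> s"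
    then obtain a b d e a' b' d' e'
      where *: "x = a / d" "y = b / e" "(a, b) \<in> r" "(d, e) \<in> r" "d \<noteq> 0" "e \<noteq> 0"
      "x' = a' / d'" "y' = b' / e'" "(a', b') \<in> r" "(d', e') \<in> r" "d' \<noteq> 0" "e' \<noteq> 0"
      using E by metis
    have m: "(d * d', e * e') \<in> r" "d * d' \<noteq> 0" using * by (auto intro: ph_mult)
    have "(a * d' + a' * d, b * e' + b' * e) \<in> r"
      using * by (intro ph_add ph_mult)
    from I[OF this m] show "(x + x', y + y') \<in> s"
      using * by (simp add: add_frac_eq mult.commute)
    from I[OF ph_mult[OF *(3,9)] m] show "(x * x', y * y') \<in> s"
      using * by simp
  next
    fix y assume "(0, y) \<in> s"
    then show "y = 0" using E ph_zeroD by fastforce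
  qed
  then show ?thesis by (simp only: s_def)
qed

text \<open>\<open>p\<close> is the minimal polynomial of \<open>x\<close> over the domain, now a
  field, and \<open>q\<close> its image. Divisibility is transported as well, so every root of
  \<open>q\<close> is an admissible image of \<open>x\<close>.\<close>

lemma rel_poly_minimal:
  assumes "algebraic x" and inv: "\<And>a b. (a, b) \<in> r \<Longrightarrow> a \<noteq> 0 \<Longrightarrow> (1 / a, 1 / b) \<in> r"
  obtains p q where "rel_poly r p q" "lead_coeff p = 1" "poly p x = 0"
    "\<And>u v. rel_poly r u v \<Longrightarrow> poly u x = 0 \<Longrightarrow> \<exists>s s'. rel_poly r s s' \<and> u = p * s \<and> v = q * s'"
proof -
  obtain P where P: "P \<noteq> 0" "poly (map_poly of_int P) x = 0" using assms(1) by (rule algebraicE')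
  have "\<exists>p q. rel_poly r p q \<and> p \<noteq> 0 \<and> poly p x = 0"
    using rel_poly_of_int P by (metis of_int_poly_hom.hom_0_iff)
  then obtain p0 where "\<exists>q. rel_poly r p0 q \<and> p0 \<noteq> 0 \<and> poly p0 x = 0"
    and min: "\<And>p'. \<exists>q. rel_poly r p' q \<and> p' \<noteq> 0 \<and> poly p' x = 0 \<Longrightarrow> degree p0 \<le> degree p'"
    using ex_has_least_nat[of "\<lambda>p. \<exists>q. rel_poly r p q \<and> p \<noteq> 0 \<and> poly p x = 0" _ degree] by metis
  then obtain q0 where p0: "rel_poly r p0 q0" "p0 \<noteq> 0" "poly p0 x = 0" by blast
  define l l' where "l = lead_coeff p0" and "l' = coeff q0 (degree p0)"
  have l: "l \<noteq> 0" "(l, l') \<in> r" using p0 by (auto simp: l_def l'_def rel_poly_def)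
  define p q where "p = [:1 / l:] * p0" and "q = [:1 / l':] * q0"
  have "rel_poly r [:1 / l:] [:1 / l':]" using inv[OF l(2,1)] rel_poly_zero by (intro rel_poly_pCons)
  then have pq: "rel_poly r p q" using p0 unfolding p_def q_def by (intro rel_poly_mult)
  have lead: "lead_coeff p = 1" using l by (simp add: p_def l_def)
  have deg: "degree p = degree p0" using l by (simp add: p_def)
  show ?thesis
  proof
    show "rel_poly r p q" "lead_coeff p = 1" by fact+
    show "poly p x = 0" using p0 by (simp add: p_def)
    fix u v assume uv: "rel_poly r u v" "poly u x = 0"
    obtain s s' t t' where st: "rel_poly r s s'" "rel_poly r t t'" "u = p * s + t"
      "v = q * s' + t'" "t = 0 \<or> degree t < degree p"
      using rel_poly_divide[OF pq lead uv(1)] by blast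
    have "poly t x = 0" using st(3) uv(2) \<open>poly p x = 0\<close> by simp
    then have "t = 0" using min[of t] st(2,5) deg by force
    with st(2) have "t' = 0" using rel_poly_zeroD by blast
    with \<open>t = 0\<close> st show "\<exists>s s'. rel_poly r s s' \<and> u = p * s \<and> v = q * s'" by auto
  qed
qed

end

text \<open>Values at transcendental arguments are arbitrary; all rules below assume algebraic
  arguments.\<close>

definition alg_hom :: "(complex \<Rightarrow> complex) \<Rightarrow> bool" where
  "alg_hom g \<longleftrightarrow> g 1 = 1 \<and>
     (\<forall>x y. algebraic x \<longrightarrow> algebraic y \<longrightarrow> g (x + y) = g x + g y \<and> g (x * y) = g x * g y)"

text \<open>By maximality the domain is a field. The image of the minimal polynomial of
  \<open>x\<close> has a complex root, and sending \<open>x\<close> to it gives an extension, which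
  must be \<open>M\<close> itself.\<close>

lemma maximal_partial_hom_total:
  assumes M: "partial_hom M" and max: "\<And>r. partial_hom r \<Longrightarrow> M \<subseteq> r \<Longrightarrow> r = M"
    and x: "algebraic x"
  shows "\<exists>y. (x, y) \<in> M"
proof -
  let ?s = "{(a / d, b / e) | a b d e. (a, b) \<in> M \<and> (d, e) \<in> M \<and> d \<noteq> 0}"
  have "M \<subseteq> ?s"
  proof
    fix z assume "z \<in> M"
    then have "(fst z / 1, snd z / 1) \<in> ?s" using ph_one[OF M] by (metis (mono_tags, lifting) mem_Collect_eq prod.collapse zero_neq_one)
    then show "z \<in> ?s" by simp
  qed
  then have s: "?s = M" using max[OF partial_hom_fractions[OF M]] by blast
  have inv: "(1 / a, 1 / b) \<in> M" if "(a, b) \<in> M" "a \<noteq> 0" for a b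
    using that ph_one[OF M] s by blast
  obtain p q where pq: "rel_poly M p q" "lead_coeff p = 1" "poly p x = 0"
    "\<And>u v. rel_poly M u v \<Longrightarrow> poly u x = 0 \<Longrightarrow> \<exists>s s'. rel_poly M s s' \<and> u = p * s \<and> v = q * s'"
    using rel_poly_minimal[OF M x inv] by blast
  have "degree p \<noteq> 0"
  proof
    assume "degree p = 0"
    then obtain a where "p = [:a:]" by (rule degree_eq_zeroE)
    with pq(2,3) show False by simp
  qed
  then have "\<not> constant (poly q)"
    using rel_poly_degree[OF M pq(1)] constant_degree by metis
  then obtain y where y: "poly q y = 0" using fundamental_theorem_of_algebra by blast
  have "partial_hom (adjoin_rel M x y)"
    using partial_hom_adjoin_rel[OF M x] pq(4) y by (metis mult_eq_0_iff poly_mult)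
  then have "adjoin_rel M x y = M" using max adjoin_rel_extends[OF M] by blast
  then show ?thesis using adjoin_rel_incl[OF M, of x y] by auto
qed

theorem partial_hom_extends:
  assumes r: "partial_hom r"
  obtains g where "alg_hom g" "\<And>a b. (a, b) \<in> r \<Longrightarrow> g a = b"
proof -
  let ?A = "{s. partial_hom s \<and> r \<subseteq> s}"
  have "\<exists>m\<in>?A. \<forall>z\<in>?A. m \<subseteq> z \<longrightarrow> z = m"
  proof (rule subset_Zorn_nonempty)
    show "?A \<noteq> {}" using r by blast
    fix C assume C: "C \<noteq> {}" "subset.chain ?A C"
    then have ph: "\<And>s. s \<in> C \<Longrightarrow> partial_hom s" and sub: "\<And>s. s \<in> C \<Longrightarrow> r \<subseteq> s"
      unfolding subset.chain_def by blast+
    have two: "\<exists>s\<in>C. z \<in> s \<and> w \<in> s" if zw: "z \<in> \<Union> C" "w \<in> \<Union> C" for z w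
    proof -
      from zw obtain s t where st: "s \<in> C" "t \<in> C" "z \<in> s" "w \<in> t" by blast
      then have "s \<subseteq> t \<or> t \<subseteq> s" using C(2) unfolding subset_chain_def by blast
      with st show ?thesis by blast
    qed
    have "partial_hom (\<Union> C)"
      unfolding partial_hom_def
    proof (intro conjI allI impI)
      show "(1, 1) \<in> \<Union> C" using C(1) ph ph_one by blast
    next
      fix a b assume "(a, b) \<in> \<Union> C"
      then obtain s where "s \<in> C" "(a, b) \<in> s" by blast
      then show "algebraic a" "(- a, - b) \<in> \<Union> C" using ph ph_alg ph_neg by blast+
    next
      fix a b c d assume "(a, b) \<in> \<Union> C" "(c, d) \<in> \<Union> C"
      from two[OF this] obtain s where "s \<in> C" "(a, b) \<in> s" "(c, d) \<in> s" by blast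
      then show "(a + c, b + d) \<in> \<Union> C" "(a * c, b * d) \<in> \<Union> C" using ph ph_add ph_mult by blast+
    next
      fix b assume "(0, b) \<in> \<Union> C"
      then show "b = 0" using ph ph_zeroD by blast
    qed
    then show "\<Union> C \<in> ?A" using C(1) sub by blast
  qed
  then obtain M where M: "partial_hom M" "r \<subseteq> M"
    and max: "\<And>s. partial_hom s \<Longrightarrow> M \<subseteq> s \<Longrightarrow> s = M"
    by (metis (mono_tags, lifting) mem_Collect_eq order_trans)
  define g where "g x = (THE y. (x, y) \<in> M)" for x
  have gI: "g a = b" if "(a, b) \<in> M" for a b
    unfolding g_def using that ph_unique[OF M(1)] by blast
  have gM: "(x, g x) \<in> M" if "algebraic x" for x
    using maximal_partial_hom_total[OF M(1) max that] gI by blast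
  have "alg_hom g"
    unfolding alg_hom_def using gI gM ph_one[OF M(1)] ph_add[OF M(1)] ph_mult[OF M(1)] by metis
  then show ?thesis using that gI M(2) by blast
qed

text \<open>Reduces the construction of Galois automorphisms fixing a ring to a vanishing test for
  polynomials over that ring; used for conjugates, for Frobenius and for wild inertia.\<close>

theorem automorphism_exists:
  assumes x: "algebraic x" and S: "\<And>s. s \<in> S \<Longrightarrow> algebraic s"
    and van: "\<And>u. (\<And>i. coeff u i \<in> int_adjoin S) \<Longrightarrow> poly u x = 0 \<Longrightarrow> poly u y = 0"
  obtains g where "alg_hom g" "\<And>a. a \<in> int_adjoin S \<Longrightarrow> g a = a" "g x = y"
proof -
  define r where "r = Id_on (int_adjoin S)"
  have r: "partial_hom r"
    using int_adjoin_algebraic[OF _ S] unfolding partial_hom_def r_def Id_on_iff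
    by (auto intro: int_adjoin.intros)
  have eq: "u = v" if "rel_poly r u v" for u v
    using that by (intro poly_eqI) (simp add: rel_poly_def r_def Id_on_iff)
  have "partial_hom (adjoin_rel r x y)"
  proof (rule partial_hom_adjoin_rel[OF r x])
    fix u v assume uv: "rel_poly r u v" "poly u x = 0"
    then have "v = u" "\<And>i. coeff u i \<in> int_adjoin S"
      using eq[OF uv(1)] by (auto simp: rel_poly_def r_def Id_on_iff)
    with uv van show "poly v y = 0" by blast
  qed
  then obtain g where g: "alg_hom g" "\<And>a b. (a, b) \<in> adjoin_rel r x y \<Longrightarrow> g a = b"
    using partial_hom_extends by blast
  show ?thesis
  proof
    show "alg_hom g" by fact
    show "g x = y" using g(2) adjoin_rel_incl[OF r] by blast
    fix a assume "a \<in> int_adjoin S"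
    then have "(a, a) \<in> adjoin_rel r x y" using adjoin_rel_extends[OF r, of x y] by (auto simp: r_def)
    then show "g a = a" by (rule g(2))
  qed
qed

section \<open>Elementary properties of homomorphisms of the field of algebraic numbers\<close>

context
  fixes g assumes g: "alg_hom g"
begin

lemma ah_one: "g 1 = 1"
  and ah_add: "algebraic x \<Longrightarrow> algebraic y \<Longrightarrow> g (x + y) = g x + g y"
  and ah_mult: "algebraic x \<Longrightarrow> algebraic y \<Longrightarrow> g (x * y) = g x * g y"
  using g unfolding alg_hom_def by blast+

lemma ah_zero: "g 0 = 0"
  using ah_add[of 0 0] by simp

lemma ah_uminus: "algebraic x \<Longrightarrow> g (- x) = - g x"
  using ah_add[of x "- x"] ah_zero by (simp add: eq_neg_iff_add_eq_0 add.commute)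

lemma ah_diff: "algebraic x \<Longrightarrow> algebraic y \<Longrightarrow> g (x - y) = g x - g y"
  using ah_add[of x "- y"] ah_uminus by simp

lemma ah_power: "algebraic x \<Longrightarrow> g (x ^ n) = g x ^ n"
  by (induction n) (auto simp: ah_one ah_mult algebraic_power)

lemma ah_of_int: "g (of_int k) = of_int k"
proof -
  have nat: "g (of_nat n) = of_nat n" for n
    by (induction n) (auto simp: ah_zero ah_one ah_add algebraic_int_imp_algebraic)
  show ?thesis
    using nat[of "nat k"] nat[of "nat (- k)"] ah_uminus[of "of_nat (nat (- k))"]
    by (cases "k \<ge> 0") (auto simp: algebraic_int_imp_algebraic)
qed

lemma ah_ipoly:
  assumes "algebraic x"
  shows "g (poly (map_poly of_int p) x) = poly (map_poly of_int p) (g x)"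
proof (induction p)
  case 0
  show ?case by (simp add: ah_zero)
next
  case (pCons a p)
  have "algebraic (poly (map_poly of_int p) x)"
    unfolding poly_altdef using assms
    by (intro algebraic_sum algebraic_mult algebraic_power) auto
  then show ?case using pCons assms
    by (simp add: of_int_hom.map_poly_pCons_hom ah_add ah_mult ah_of_int algebraic_mult)
qed

lemma ah_ipoly_root:
  "algebraic x \<Longrightarrow> poly (map_poly of_int p) x = 0 \<Longrightarrow> poly (map_poly of_int p) (g x) = 0"
  using ah_ipoly[of x p] ah_zero by simp

lemma ah_algebraic: "algebraic x \<Longrightarrow> algebraic (g x)"
proof -
  assume x: "algebraic x"
  then obtain p where p: "p \<noteq> 0" "poly (map_poly of_int p) x = 0" by (rule algebraicE')
  then show ?thesis
    using ah_ipoly_root[OF x p(2)] by (intro algebraicI[of "map_poly of_int p"]) auto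
qed

lemma ah_algebraic_int:
  assumes "algebraic_int x"
  shows "algebraic_int (g x)"
proof -
  obtain p where "poly (map_poly of_int p) x = 0" "lead_coeff p = 1"
    using assms algebraic_int_altdef_ipoly by blast
  then show ?thesis
    using ah_ipoly_root[OF algebraic_int_imp_algebraic[OF assms]] algebraic_int_altdef_ipoly by blast
qed

lemma ah_nonzero: "algebraic x \<Longrightarrow> x \<noteq> 0 \<Longrightarrow> g x \<noteq> 0"
  using ah_mult[of x "inverse x"] ah_one algebraic_inverse[of x] by auto

lemma ah_inverse:
  assumes "algebraic x"
  shows "g (inverse x) = inverse (g x)"
proof (cases "x = 0")
  case False
  then have "g x * g (inverse x) = 1"
    using ah_mult[OF assms algebraic_inverse[OF assms]] ah_one by simp
  then show ?thesis by (rule inverse_unique[symmetric])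
qed (simp add: ah_zero)

lemma ah_divide: "algebraic x \<Longrightarrow> algebraic y \<Longrightarrow> g (x / y) = g x / g y"
  by (simp add: divide_inverse ah_mult ah_inverse algebraic_inverse)

lemma ah_inj: "algebraic x \<Longrightarrow> algebraic y \<Longrightarrow> g x = g y \<Longrightarrow> x = y"
  using ah_nonzero[of "x - y"] ah_diff[of x y] algebraic_diff by auto

end

lemma alg_hom_comp: "alg_hom g \<Longrightarrow> alg_hom h \<Longrightarrow> alg_hom (g \<circ> h)"
  unfolding alg_hom_def[of "g \<circ> h"]
  by (simp add: ah_one[of g] ah_one[of h] ah_add[of g] ah_add[of h] ah_mult[of g] ah_mult[of h]
      ah_algebraic[of h])

lemma alg_hom_id: "alg_hom id"
  by (simp add: alg_hom_def)

section \<open>Conjugates\<close>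

abbreviation ipoly :: "int poly \<Rightarrow> complex \<Rightarrow> complex" where
  "ipoly p x \<equiv> poly (map_poly of_int p) x"

lemma ipoly_add: "ipoly (p + q) x = ipoly p x + ipoly q x"
  and ipoly_mult: "ipoly (p * q) x = ipoly p x * ipoly q x"
  and ipoly_smult: "ipoly (smult k p) x = of_int k * ipoly p x"
  by (simp_all add: of_int_poly_hom.hom_add of_int_poly_hom.hom_mult of_int_hom.map_poly_hom_smult)

lemma irreducible_int_poly_dvd_iff:
  assumes x: "algebraic x"
  obtains p where "irreducible p" "lead_coeff p > 0" "degree p > 0" "\<And>q. ipoly q x = 0 \<longleftrightarrow> p dvd q"
proof -
  obtain P where P: "P \<noteq> 0" "ipoly P x = 0" using x by (rule algebraicE')
  then obtain p0 where p0: "p0 \<noteq> 0" "ipoly p0 x = 0"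
    and min: "\<And>q. q \<noteq> 0 \<Longrightarrow> ipoly q x = 0 \<Longrightarrow> degree p0 \<le> degree q"
    using ex_has_least_nat[of "\<lambda>p. p \<noteq> 0 \<and> ipoly p x = 0" P degree] by metis
  define p where "p = smult (sgn (lead_coeff p0)) (primitive_part p0)"
  have sgn: "sgn (lead_coeff p0) = 1 \<or> sgn (lead_coeff p0) = - 1"
    using p0(1) by (simp add: sgn_if)
  have p0_eq: "p0 = smult (Polynomial.content p0) (primitive_part p0)"
    by (simp add: content_times_primitive_part)
  have c0: "Polynomial.content p0 > 0"
  proof -
    have "\<bar>Polynomial.content p0\<bar> = Polynomial.content p0"
      using normalize_content[of p0] by simp
    moreover have "Polynomial.content p0 \<noteq> 0" using p0(1) by simp
    ultimately show ?thesis by linarith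
  qed
  have "Polynomial.content p = 1"
    using sgn p0(1) by (auto simp: p_def)
  have pnz: "p \<noteq> 0" using sgn p0(1) by (auto simp: p_def)
  have deg: "degree p = degree p0" using sgn by (auto simp: p_def)
  have "of_int (Polynomial.content p0) * ipoly (primitive_part p0) x = ipoly p0 x"
    using arg_cong[OF p0_eq, of "\<lambda>p. ipoly p x"] by (simp only: ipoly_smult)
  then have "ipoly (primitive_part p0) x = 0" using p0 c0 by simp
  then have root: "ipoly p x = 0" by (simp add: p_def ipoly_smult)
  have lead: "lead_coeff p > 0"
  proof -
    have l: "lead_coeff p0 = Polynomial.content p0 * lead_coeff (primitive_part p0)"
      using arg_cong[OF p0_eq, of lead_coeff] by (simp only: lead_coeff_smult)
    have "lead_coeff p = sgn (lead_coeff p0) * lead_coeff (primitive_part p0)"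
      by (simp add: p_def lead_coeff_smult)
    also have "sgn (lead_coeff p0) = sgn (lead_coeff (primitive_part p0))"
      using c0 by (subst l) (simp add: sgn_mult)
    finally have "lead_coeff p = \<bar>lead_coeff (primitive_part p0)\<bar>"
      by (simp add: abs_sgn mult.commute)
    moreover have "lead_coeff (primitive_part p0) \<noteq> 0"
      by (rule leading_coeff_neq_0) (use p0(1) in simp)
    ultimately show ?thesis by (metis zero_less_abs_iff)
  qed
  have degp: "degree p > 0"
  proof (rule ccontr)
    assume "\<not> degree p > 0"
    then have "degree p = 0" by simp
    then obtain a where "p = [:a:]" by (rule degree_eq_zeroE)
    with pnz root show False by simp
  qed
  have irr: "irreducible p"
  proof (rule irreducibleI)
    show "p \<noteq> 0" by fact
    show "\<not> p dvd 1" using degp dvd_imp_degree_le[of p 1] by auto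
    have unit: "b dvd 1" if "p = a * b" "ipoly a x = 0" for a b
    proof -
      from that pnz have nz: "a \<noteq> 0" "b \<noteq> 0" by auto
      then have "degree p \<le> degree a" using min[of a] that deg by simp
      then have "degree b = 0" using that nz by (simp add: degree_mult_eq)
      then obtain k where b: "b = [:k:]" by (rule degree_eq_zeroE)
      then have "p = [:k:] * a" using that(1) by (simp only: mult.commute)
      then have "[:k:] dvd p" by (rule dvdI)
      then have "k dvd 1" using \<open>Polynomial.content p = 1\<close> by (simp add: const_poly_dvd_iff_dvd_content)
      then show ?thesis by (simp add: b is_unit_const_poly_iff)
    qed
    fix a b assume ab: "p = a * b"
    then have "ipoly a x = 0 \<or> ipoly b x = 0" using root by (simp add: ipoly_add ipoly_mult ipoly_smult)
    then show "a dvd 1 \<or> b dvd 1" using unit[of a b] unit[of b a] ab by (auto simp: mult.commute)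
  qed
  have "p dvd q" if q: "ipoly q x = 0" for q
  proof -
    obtain s r where sr: "pseudo_divmod q p = (s, r)" by fastforce
    define k where "k = coeff p (degree p) ^ (Suc (degree q) - degree p)"
    have k: "smult k q = p * s + r" "r = 0 \<or> degree r < degree p"
      using pseudo_divmod[OF pnz sr] by (auto simp: k_def)
    have "k \<noteq> 0" using pnz by (simp add: k_def)
    have "ipoly (smult k q) x = ipoly p x * ipoly s x + ipoly r x"
      by (simp add: k(1) ipoly_add ipoly_mult ipoly_smult)
    then have "ipoly r x = 0" using q root by (simp add: ipoly_add ipoly_mult ipoly_smult)
    then have "r = 0" using min[of r] k(2) deg by force
    then have "p dvd [:k:] * q" using k by simp
    then have "p dvd [:k:] \<or> p dvd q"
      by (rule prime_elem_dvd_multD[OF irreducible_imp_prime_elem[OF irr]])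
    moreover have "\<not> p dvd [:k:]"
    proof
      assume "p dvd [:k:]"
      then have "degree p \<le> degree [:k:]" using \<open>k \<noteq> 0\<close> by (intro dvd_imp_degree_le) auto
      with degp show False by simp
    qed
    ultimately show "p dvd q" by blast
  qed
  moreover have "ipoly q x = 0" if "p dvd q" for q
    using that root by (auto simp: ipoly_add ipoly_mult ipoly_smult elim!: dvdE)
  ultimately show ?thesis using that irr lead degp by blast
qed

lemma irreducible_int_poly_unique:
  assumes x: "algebraic x" and p: "irreducible p" "lead_coeff p > 0" "ipoly p x = 0"
    and q: "irreducible q" "lead_coeff q > 0" "ipoly q x = 0"
  shows "p = q"
proof -
  have assoc: "r = m"
    if r: "irreducible r" "lead_coeff r > 0" "m dvd r" and m: "irreducible m" "lead_coeff m > 0" for r m :: "int poly"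
  proof -
    obtain u where u: "r = m * u" using r(3) by (rule dvdE)
    have "u dvd 1" using irreducibleD[OF r(1) u] irreducible_not_unit[OF m(1)] by blast
    then obtain k where k: "u = [:k:]" "k dvd 1" by (auto elim: is_unit_polyE)
    have "lead_coeff r = lead_coeff m * k" using u k by (simp add: lead_coeff_mult)
    with r(2) m(2) have "k > 0" by (simp add: zero_less_mult_iff)
    with k(2) have "k = 1" by simp
    then show ?thesis using u k by simp
  qed
  obtain m where m: "irreducible m" "lead_coeff m > 0" "\<And>r. ipoly r x = 0 \<longleftrightarrow> m dvd r"
    using irreducible_int_poly_dvd_iff[OF x] by metis
  show ?thesis using assoc[OF p(1,2) _ m(1,2)] assoc[OF q(1,2) _ m(1,2)] m(3) p(3) q(3) by simp
qed

lemma min_int_poly_eqI: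
  assumes "irreducible p" "lead_coeff p > 0" "ipoly p x = 0"
  shows "min_int_poly x = p"
proof -
  have "p \<noteq> 0" using assms by auto
  then have "algebraic x"
    using assms(3) by (intro algebraicI[of "map_poly of_int p"]) auto
  then show ?thesis
    unfolding min_int_poly_def using irreducible_int_poly_unique assms by (intro the_equality) blast+
qed

lemma
  assumes x: "algebraic x"
  shows min_int_poly_irreducible: "irreducible (min_int_poly x)"
    and min_int_poly_lead: "lead_coeff (min_int_poly x) > 0"
    and min_int_poly_degree: "degree (min_int_poly x) > 0"
    and min_int_poly_dvd_iff: "min_int_poly x dvd q \<longleftrightarrow> ipoly q x = 0"
    and min_int_poly_root: "ipoly (min_int_poly x) x = 0"
proof -
  obtain p where p: "irreducible p" "lead_coeff p > 0" "degree p > 0" "\<And>q. ipoly q x = 0 \<longleftrightarrow> p dvd q"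
    using irreducible_int_poly_dvd_iff[OF x] by metis
  then have "ipoly p x = 0" by simp
  with p have "min_int_poly x = p" by (intro min_int_poly_eqI)
  with p \<open>ipoly p x = 0\<close> show "irreducible (min_int_poly x)" "lead_coeff (min_int_poly x) > 0"
    "degree (min_int_poly x) > 0" "min_int_poly x dvd q \<longleftrightarrow> ipoly q x = 0"
    "ipoly (min_int_poly x) x = 0"
    by simp_all
qed

lemma min_int_poly_nonzero: "algebraic x \<Longrightarrow> min_int_poly x \<noteq> 0"
  using min_int_poly_degree[of x] by auto

definition conjugates :: "complex \<Rightarrow> complex set" where
  "conjugates x = {y. ipoly (min_int_poly x) y = 0}"

lemma conjugates_self: "algebraic x \<Longrightarrow> x \<in> conjugates x"
  by (simp add: conjugates_def min_int_poly_root)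

lemma finite_conjugates: "algebraic x \<Longrightarrow> finite (conjugates x)"
  unfolding conjugates_def by (intro poly_roots_finite) (simp add: min_int_poly_nonzero)

lemma conjugates_algebraic: "algebraic x \<Longrightarrow> y \<in> conjugates x \<Longrightarrow> algebraic y"
  by (rule algebraicI[of "map_poly of_int (min_int_poly x)"]) (auto simp: conjugates_def min_int_poly_nonzero)

lemma min_int_poly_conjugate: "algebraic x \<Longrightarrow> y \<in> conjugates x \<Longrightarrow> min_int_poly y = min_int_poly x"
  by (intro min_int_poly_eqI) (auto simp: conjugates_def min_int_poly_irreducible min_int_poly_lead)

lemma conjugates_eq: "algebraic x \<Longrightarrow> y \<in> conjugates x \<Longrightarrow> conjugates y = conjugates x"
  unfolding conjugates_def[of x] conjugates_def[of y]
  by (subst min_int_poly_conjugate) (simp_all add: conjugates_def)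

lemma alg_hom_conjugates:
  assumes "alg_hom g" "algebraic x"
  shows "g x \<in> conjugates x"
  using ah_ipoly_root[OF assms min_int_poly_root[OF assms(2)]] by (simp add: conjugates_def)

lemma conjugate_alg_hom:
  assumes x: "algebraic x" and y: "y \<in> conjugates x"
  obtains g where "alg_hom g" "g x = y"
proof -
  have van: "poly u y = 0" if u: "\<And>i. coeff u i \<in> int_adjoin {}" "poly u x = 0" for u
  proof -
    have "z \<in> \<int>" if "z \<in> int_adjoin {}" for z
      using that by induction auto
    with u(1) have "coeff u i \<in> \<int>" for i by blast
    then obtain q where q: "u = map_poly of_int q" by (rule intpolyE)
    then obtain s where "q = min_int_poly x * s" using u(2) min_int_poly_dvd_iff[OF x] by blast
    with q y show ?thesis by (simp add: conjugates_def ipoly_mult)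
  qed
  show ?thesis
  proof (rule automorphism_exists[OF x, of "{}" y])
    show "\<And>s. s \<in> {} \<Longrightarrow> algebraic s" by simp
    show "\<And>u. (\<And>i. coeff u i \<in> int_adjoin {}) \<Longrightarrow> poly u x = 0 \<Longrightarrow> poly u y = 0"
      by (rule van)
    show thesis if "alg_hom g" "g x = y" for g using \<open>\<And>g. alg_hom g \<Longrightarrow> g x = y \<Longrightarrow> thesis\<close> that .
  qed
qed

text \<open>A common root of the polynomial and its derivative is a conjugate, hence has the same
  minimal polynomial, which would then divide a nonzero polynomial of smaller degree.\<close>

lemma rsquarefree_min_int_poly:
  assumes x: "algebraic x"
  shows "rsquarefree (map_poly of_int (min_int_poly x) :: complex poly)"
  unfolding rsquarefree_roots
proof (intro allI notI)
  fix y assume y: "ipoly (min_int_poly x) y = 0 \<and> poly (pderiv (map_poly of_int (min_int_poly x))) y = 0"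
  then have "y \<in> conjugates x" by (simp add: conjugates_def)
  then have m: "algebraic y" "min_int_poly y = min_int_poly x"
    using conjugates_algebraic min_int_poly_conjugate x by blast+
  have "ipoly (pderiv (min_int_poly x)) y = 0" using y by (simp add: of_int_hom.map_poly_pderiv)
  then have dvd: "min_int_poly x dvd pderiv (min_int_poly x)"
    using min_int_poly_dvd_iff[OF m(1), of "pderiv (min_int_poly x)"] unfolding m(2) by simp
  have "pderiv (min_int_poly x) \<noteq> 0"
    using min_int_poly_degree[OF x] by (simp add: pderiv_eq_0_iff)
  then have "degree (min_int_poly x) \<le> degree (pderiv (min_int_poly x))"
    using dvd by (rule dvd_imp_degree_le[rotated])
  then show False using min_int_poly_degree[OF x] by (simp add: degree_pderiv)
qed

lemma min_int_poly_factorization: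
  assumes x: "algebraic x"
  shows "map_poly of_int (min_int_poly x) = smult (of_int (lead_coeff (min_int_poly x))) (\<Prod>y\<in>conjugates x. [:- y, 1:])"
  using complex_poly_decompose_rsquarefree[OF rsquarefree_min_int_poly[OF x]]
  by (simp add: conjugates_def)

lemma degree_min_int_poly:
  assumes x: "algebraic x"
  shows "degree (min_int_poly x) = card (conjugates x)"
proof -
  have "degree (min_int_poly x) = degree (map_poly of_int (min_int_poly x) :: complex poly)" by simp
  also have "\<dots> = degree (smult (complex_of_int (lead_coeff (min_int_poly x))) (\<Prod>y\<in>conjugates x. [:- y, 1:]))"
    by (rule arg_cong[OF min_int_poly_factorization[OF x]])
  also have "\<dots> = degree (\<Prod>y\<in>conjugates x. [:- y, 1:])"
    using min_int_poly_nonzero[OF x] by simp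
  also have "\<dots> = card (conjugates x)" by (simp add: degree_prod_sum_eq)
  finally show ?thesis .
qed

lemma card_conjugates_pos: "algebraic x \<Longrightarrow> card (conjugates x) > 0"
  using degree_min_int_poly min_int_poly_degree by metis

lemma min_int_poly_monic:
  assumes "algebraic_int x"
  shows "lead_coeff (min_int_poly x) = 1"
proof -
  have x: "algebraic x" using assms by auto
  obtain q where q: "ipoly q x = 0" "lead_coeff q = 1"
    using assms algebraic_int_altdef_ipoly by blast
  then obtain s where "q = min_int_poly x * s" using min_int_poly_dvd_iff[OF x] by blast
  then have "lead_coeff (min_int_poly x) * lead_coeff s = 1" using q by (simp add: lead_coeff_mult)
  then show ?thesis using min_int_poly_lead[OF x] by (simp add: zmult_eq_1_iff)
qed

section \<open>Embeddings of number fields\<close>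

text \<open>Restriction identifies automorphisms that agree on the field; this makes the set finite
  for finite \<open>S\<close>.\<close>

definition embeddings :: "complex set \<Rightarrow> (complex \<Rightarrow> complex) set" where
  "embeddings S = (\<lambda>g. restrict g (field_adjoin S)) ` {g. alg_hom g}"

text \<open>Averaging makes the value independent of the number field: by
  \<open>sum_embeddings\<close> it is also the average over the embeddings of any field containing
  \<open>x\<close>. Hence elements of different degrees can be compared in a common field.\<close>

definition conj_avg :: "(complex \<Rightarrow> real) \<Rightarrow> complex \<Rightarrow> real" where
  "conj_avg G x = (\<Sum>y\<in>conjugates x. G y) / card (conjugates x)"

lemma alg_hom_eq_on_field_adjoin:
  assumes g: "alg_hom g" and h: "alg_hom h" and S: "\<And>s. s \<in> S \<Longrightarrow> algebraic s"
    and eq: "\<And>s. s \<in> S \<Longrightarrow> g s = h s" and x: "x \<in> field_adjoin S"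
  shows "g x = h x"
proof -
  have *: "g y = h y" if "y \<in> int_adjoin S" for y
    using that
  proof induction
    case (uminus y)
    then show ?case using int_adjoin_algebraic[OF uminus.hyps S] by (simp add: ah_uminus[OF g] ah_uminus[OF h])
  next
    case (add y z)
    then show ?case using int_adjoin_algebraic[OF _ S, of y] int_adjoin_algebraic[OF _ S, of z]
      by (simp add: ah_add[OF g] ah_add[OF h])
  next
    case (mult y z)
    then show ?case using int_adjoin_algebraic[OF _ S, of y] int_adjoin_algebraic[OF _ S, of z]
      by (simp add: ah_mult[OF g] ah_mult[OF h])
  qed (simp_all add: eq ah_one[OF g] ah_one[OF h])
  obtain k where k: "k \<noteq> 0" "of_int k * x \<in> int_adjoin S" using x by (rule field_adjoinE)
  have ax: "algebraic x" using x S by (rule field_adjoin_algebraic)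
  have "of_int k * g x = of_int k * h x"
    using *[OF k(2)] ax by (simp add: ah_mult[OF g] ah_mult[OF h] ah_of_int[OF g] ah_of_int[OF h])
  then show ?thesis using k by simp
qed

lemma embeddingsE:
  assumes "\<phi> \<in> embeddings S"
  obtains g where "alg_hom g" "\<phi> = restrict g (field_adjoin S)"
  using assms unfolding embeddings_def by blast

context
  fixes S :: "complex set"
  assumes S: "\<And>s. s \<in> S \<Longrightarrow> algebraic s" and finS: "finite S"
begin

lemma finite_embeddings: "finite (embeddings S)"
proof (rule finite_imageD)
  show "finite ((\<lambda>\<phi>. restrict \<phi> S) ` embeddings S)"
  proof (rule finite_subset)
    show "(\<lambda>\<phi>. restrict \<phi> S) ` embeddings S \<subseteq> PiE S conjugates"
      by (auto simp: embeddings_def field_adjoin_incl S alg_hom_conjugates)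
    show "finite (PiE S conjugates)"
      using finS S finite_conjugates by (intro finite_PiE) auto
  qed
  show "inj_on (\<lambda>\<phi>. restrict \<phi> S) (embeddings S)"
  proof (rule inj_onI)
    fix \<phi> \<psi> assume "\<phi> \<in> embeddings S" "\<psi> \<in> embeddings S" and eq: "restrict \<phi> S = restrict \<psi> S"
    then obtain g h where g: "alg_hom g" "\<phi> = restrict g (field_adjoin S)"
      and h: "alg_hom h" "\<psi> = restrict h (field_adjoin S)"
      unfolding embeddings_def by blast
    have "g s = h s" if "s \<in> S" for s
      using fun_cong[OF eq, of s] that by (simp add: g(2) h(2) field_adjoin_incl)
    then have "g x = h x" if "x \<in> field_adjoin S" for x
      using alg_hom_eq_on_field_adjoin[OF g(1) h(1) S _ that] by blast
    then show "\<phi> = \<psi>" by (auto simp: g(2) h(2) restrict_def)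
  qed
qed

lemma embeddings_nonempty: "embeddings S \<noteq> {}"
  using alg_hom_id unfolding embeddings_def by blast

lemma card_embeddings_pos: "card (embeddings S) > 0"
  using finite_embeddings embeddings_nonempty by (simp add: card_gt_0_iff)

text \<open>Composition with an automorphism taking one conjugate of \<open>x\<close> to another permutes the
  embeddings, so each conjugate of \<open>x\<close> is the image of \<open>x\<close> under equally many embeddings.\<close>

lemma card_embeddings_fiber_le:
  assumes x: "x \<in> field_adjoin S" and y: "y \<in> conjugates x" and z: "z \<in> conjugates x"
  shows "card {\<phi>\<in>embeddings S. \<phi> x = y} \<le> card {\<phi>\<in>embeddings S. \<phi> x = z}"
proof -
  have ax: "algebraic x" using x S by (rule field_adjoin_algebraic)
  have ay: "algebraic y" using conjugates_algebraic ax y by blast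
  have zy: "z \<in> conjugates y" using conjugates_eq[OF ax y] z by simp
  obtain h where h: "alg_hom h" "h y = z" by (rule conjugate_alg_hom[OF ay zy])
  define L where "L = field_adjoin S"
  have alg: "algebraic w" if "w \<in> L" for w
    using that S unfolding L_def by (rule field_adjoin_algebraic)
  show ?thesis
  proof (rule card_inj_on_le)
    show "finite {\<phi>\<in>embeddings S. \<phi> x = z}" using finite_embeddings by simp
    show "(\<lambda>\<phi>. restrict (h \<circ> \<phi>) L) ` {\<phi>\<in>embeddings S. \<phi> x = y} \<subseteq> {\<phi>\<in>embeddings S. \<phi> x = z}"
    proof (rule image_subsetI)
      fix \<phi> assume "\<phi> \<in> {\<phi>\<in>embeddings S. \<phi> x = y}"
      then obtain g where g: "alg_hom g" "\<phi> = restrict g L" "\<phi> x = y"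
        unfolding embeddings_def L_def by blast
      then have gx: "g x = y" using x by (simp add: L_def)
      have "restrict (h \<circ> \<phi>) L = restrict (h \<circ> g) L" by (auto simp: g(2))
      then show "restrict (h \<circ> \<phi>) L \<in> {\<phi>\<in>embeddings S. \<phi> x = z}"
        using alg_hom_comp[OF h(1) g(1)] gx h(2) x unfolding embeddings_def by (auto simp: L_def)
    qed
    show "inj_on (\<lambda>\<phi>. restrict (h \<circ> \<phi>) L) {\<phi>\<in>embeddings S. \<phi> x = y}"
    proof (rule inj_onI)
      fix \<phi> \<psi> assume a: "\<phi> \<in> {\<phi>\<in>embeddings S. \<phi> x = y}" "\<psi> \<in> {\<phi>\<in>embeddings S. \<phi> x = y}"
        and eq: "restrict (h \<circ> \<phi>) L = restrict (h \<circ> \<psi>) L"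
      obtain g1 where g1: "alg_hom g1" "\<phi> = restrict g1 L" using a(1) unfolding embeddings_def L_def by blast
      obtain g2 where g2: "alg_hom g2" "\<psi> = restrict g2 L" using a(2) unfolding embeddings_def L_def by blast
      have "g1 w = g2 w" if "w \<in> L" for w
      proof -
        have "h (g1 w) = h (g2 w)" using fun_cong[OF eq, of w] that by (simp add: g1 g2)
        then show ?thesis using ah_inj[OF h(1)] ah_algebraic g1(1) g2(1) alg[OF that] by blast
      qed
      then show "\<phi> = \<psi>" by (auto simp: g1 g2 restrict_def)
    qed
  qed
qed

lemma sum_embeddings:
  assumes x: "x \<in> field_adjoin S"
  shows "(\<Sum>\<phi>\<in>embeddings S. G (\<phi> x)) = real (card (embeddings S)) * conj_avg G x"
    and "card (embeddings S) = card {\<phi>\<in>embeddings S. \<phi> x = x} * card (conjugates x)"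
    and "y \<in> conjugates x \<Longrightarrow> card {\<phi>\<in>embeddings S. \<phi> x = y} = card {\<phi>\<in>embeddings S. \<phi> x = x}"
proof -
  have ax: "algebraic x" using x S by (rule field_adjoin_algebraic)
  let ?E = "embeddings S"
  define k where "k = card {\<phi>\<in>?E. \<phi> x = x}"
  have k: "card {\<phi>\<in>?E. \<phi> x = y} = k" if "y \<in> conjugates x" for y
    unfolding k_def using card_embeddings_fiber_le[OF x] that conjugates_self[OF ax] by (intro antisym) auto
  have img: "(\<lambda>\<phi>. \<phi> x) ` ?E \<subseteq> conjugates x"
  proof (rule image_subsetI)
    fix \<phi> assume "\<phi> \<in> ?E"
    then obtain g where "alg_hom g" "\<phi> = restrict g (field_adjoin S)" by (rule embeddingsE)
    with x have "alg_hom g" "\<phi> x = g x" by simp_all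
    then show "\<phi> x \<in> conjugates x" using alg_hom_conjugates[OF _ ax] by simp
  qed
  have G: "(\<Sum>\<phi>\<in>?E. H (\<phi> x)) = k * (\<Sum>y\<in>conjugates x. H y)" for H :: "complex \<Rightarrow> real"
  proof -
    have "(\<Sum>\<phi>\<in>?E. H (\<phi> x)) = (\<Sum>y\<in>conjugates x. \<Sum>\<phi>\<in>{\<phi>\<in>?E. \<phi> x = y}. H (\<phi> x))"
      using sum.group[OF finite_embeddings finite_conjugates[OF ax] img, of "\<lambda>\<phi>. H (\<phi> x)"] by simp
    also have "\<dots> = (\<Sum>y\<in>conjugates x. k * H y)"
      by (rule sum.cong) (auto simp: k)
    finally show ?thesis by (simp add: sum_distrib_left)
  qed
  have "real (card ?E) = real (k * card (conjugates x))" using G[of "\<lambda>_. 1"] by simp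
  then show card: "card ?E = card {\<phi>\<in>?E. \<phi> x = x} * card (conjugates x)"
    unfolding k_def by (simp only: of_nat_eq_iff)
  show "(\<Sum>\<phi>\<in>?E. G (\<phi> x)) = real (card ?E) * conj_avg G x"
    unfolding G card using card_conjugates_pos[OF ax] by (simp add: conj_avg_def k_def)
  show "y \<in> conjugates x \<Longrightarrow> card {\<phi>\<in>?E. \<phi> x = y} = card {\<phi>\<in>?E. \<phi> x = x}"
    using k unfolding k_def .
qed

text \<open>The norm of a nonzero algebraic integer is a nonzero rational integer, up to sign the
  constant coefficient of the minimal polynomial.\<close>

lemma sum_ln_embeddings_nonneg:
  assumes x: "x \<in> field_adjoin S" "algebraic_int x" "x \<noteq> 0"
  shows "(\<Sum>\<phi>\<in>embeddings S. ln (cmod (\<phi> x))) \<ge> 0"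
proof -
  have ax: "algebraic x" using x by auto
  have "of_int (coeff (min_int_poly x) 0) = ipoly (min_int_poly x) 0"
    by (simp add: poly_0_coeff_0)
  also have "\<dots> = (\<Prod>y\<in>conjugates x. - y)"
    by (subst min_int_poly_factorization[OF ax]) (simp add: min_int_poly_monic[OF x(2)] poly_prod)
  finally have eq: "cmod (of_int (coeff (min_int_poly x) 0)) = (\<Prod>y\<in>conjugates x. cmod y)"
    by (simp add: prod_norm[symmetric])
  have nz: "y \<noteq> 0" if "y \<in> conjugates x" for y
  proof -
    obtain g where "alg_hom g" "g x = y"
      by (rule conjugate_alg_hom[OF ax \<open>y \<in> conjugates x\<close>])
    then show ?thesis using ah_nonzero[OF _ ax x(3)] by blast
  qed
  have "(\<Prod>y\<in>conjugates x. cmod y) \<noteq> 0" using nz finite_conjugates[OF ax] by simp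
  with eq have "coeff (min_int_poly x) 0 \<noteq> 0" by (metis norm_zero of_int_0)
  then have "1 \<le> (\<Prod>y\<in>conjugates x. cmod y)" unfolding eq[symmetric] by simp
  then have "0 \<le> ln (\<Prod>y\<in>conjugates x. cmod y)" by simp
  also have "\<dots> = (\<Sum>y\<in>conjugates x. ln (cmod y))"
    using finite_conjugates[OF ax] nz by (intro ln_prod) auto
  finally show ?thesis
    unfolding sum_embeddings(1)[OF x(1), of "\<lambda>y. ln (cmod y)"] conj_avg_def by simp
qed

end

section \<open>Weil heights\<close>

definition ln_plus :: "complex \<Rightarrow> real" where
  "ln_plus y = ln (max 1 (cmod y))"

lemma ln_plus_nonneg: "ln_plus y \<ge> 0"
  by (simp add: ln_plus_def)

lemma conj_avg_mono:
  "(\<And>y. G y \<le> H y) \<Longrightarrow> conj_avg G x \<le> conj_avg H x"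
  unfolding conj_avg_def by (intro divide_right_mono sum_mono) auto

lemma conj_avg_nonneg: "(\<And>y. G y \<ge> 0) \<Longrightarrow> conj_avg G x \<ge> 0"
  unfolding conj_avg_def by (intro divide_nonneg_nonneg sum_nonneg) auto

lemma weil_height_eq:
  assumes x: "algebraic x"
  shows "weil_height x = ln (lead_coeff (min_int_poly x)) / card (conjugates x) + conj_avg ln_plus x"
proof -
  let ?a = "lead_coeff (min_int_poly x)"
  obtain ys where ys: "set ys = conjugates x" "distinct ys"
    using finite_distinct_list[OF finite_conjugates[OF x]] by blast
  have pos: "?a > 0" by (rule min_int_poly_lead[OF x])
  have "map_poly of_int (min_int_poly x) = smult (of_int ?a) (\<Prod>y\<leftarrow>ys. [:- y, 1:])"
    using min_int_poly_factorization[OF x] ys prod.distinct_set_conv_list[OF ys(2), of "\<lambda>y. [:- y, 1:]"] by simp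
  then have "mahler_measure (min_int_poly x) = cmod (of_int ?a) * (\<Prod>y\<leftarrow>ys. max 1 (cmod y))"
    unfolding mahler_measure_def by (simp only: mahler_measure_poly_explicit)
  also have "(\<Prod>y\<leftarrow>ys. max 1 (cmod y)) = (\<Prod>y\<in>conjugates x. max 1 (cmod y))"
    using prod.distinct_set_conv_list[OF ys(2)] ys(1) by metis
  also have "cmod (of_int ?a) = real_of_int ?a" using pos by simp
  finally have mm: "mahler_measure (min_int_poly x)
      = real_of_int ?a * (\<Prod>y\<in>conjugates x. max 1 (cmod y))" .
  have "(\<Prod>y\<in>conjugates x. max 1 (cmod y)) > 0" by (intro prod_pos) simp
  with pos have "ln (mahler_measure (min_int_poly x))
      = ln (real_of_int ?a) + ln (\<Prod>y\<in>conjugates x. max 1 (cmod y))"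
    unfolding mm by (intro ln_mult_pos) simp_all
  also have "ln (\<Prod>y\<in>conjugates x. max 1 (cmod y)) = (\<Sum>y\<in>conjugates x. ln_plus y)"
    unfolding ln_plus_def using finite_conjugates[OF x] by (intro ln_prod) auto
  finally show ?thesis
    unfolding weil_height_def degree_min_int_poly[OF x] conj_avg_def by (simp add: add_divide_distrib)
qed

lemma weil_height_ge_conj_avg:
  assumes x: "algebraic x"
  shows "weil_height x \<ge> conj_avg ln_plus x"
proof -
  have "ln (real_of_int (lead_coeff (min_int_poly x))) \<ge> 0"
    using min_int_poly_lead[OF x] by (intro ln_ge_zero) simp
  then show ?thesis unfolding weil_height_eq[OF x] by simp
qed

lemma weil_height_nonneg: "algebraic x \<Longrightarrow> weil_height x \<ge> 0"
  using weil_height_ge_conj_avg[of x] conj_avg_nonneg[of ln_plus x] ln_plus_nonneg by force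

subsection \<open>Denominators\<close>

definition int_coeffs :: "complex poly \<Rightarrow> bool" where
  "int_coeffs p \<longleftrightarrow> (\<forall>i. algebraic_int (coeff p i))"

lemma int_coeffs_add: "int_coeffs p \<Longrightarrow> int_coeffs q \<Longrightarrow> int_coeffs (p + q)"
  by (simp add: int_coeffs_def algebraic_int_add)

lemma int_coeffs_diff: "int_coeffs p \<Longrightarrow> int_coeffs q \<Longrightarrow> int_coeffs (p - q)"
  by (simp add: int_coeffs_def algebraic_int_diff)

lemma int_coeffs_mult: "int_coeffs p \<Longrightarrow> int_coeffs q \<Longrightarrow> int_coeffs (p * q)"
  unfolding int_coeffs_def coeff_mult by (intro allI algebraic_int_sum algebraic_int_mult) simp_all

lemma int_coeffs_sum: "(\<And>i. i \<in> I \<Longrightarrow> int_coeffs (p i)) \<Longrightarrow> int_coeffs (sum p I)"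
  unfolding int_coeffs_def coeff_sum by (intro allI algebraic_int_sum) simp

lemma int_coeffs_const: "algebraic_int a \<Longrightarrow> int_coeffs [:a:]"
  by (simp add: int_coeffs_def coeff_pCons split: nat.split)

lemma int_coeffs_monom: "algebraic_int a \<Longrightarrow> int_coeffs (monom a n)"
  by (simp add: int_coeffs_def)

lemma int_coeffs_prod: "(\<And>i. i \<in> I \<Longrightarrow> int_coeffs (p i)) \<Longrightarrow> int_coeffs (prod p I)"
proof (induction I rule: infinite_finite_induct)
  case (insert i I)
  then show ?case by (simp add: int_coeffs_mult)
qed (use int_coeffs_const[of 1] in simp_all)

text \<open>A form of Gauss's lemma over all algebraic integers. The leading coefficient
  \<open>a\<close> of the product and \<open>a * x\<close> are integral, so the leading term of
  \<open>q\<close> can be subtracted without leaving the hypotheses.\<close>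

lemma int_coeffs_cancel_linear:
  "int_coeffs ([:- x, 1:] * q) \<Longrightarrow> int_coeffs q"
proof (induction "degree q" arbitrary: q rule: less_induct)
  case (less q)
  show ?case
  proof (cases "q = 0")
    case False
    define a where "a = lead_coeff q"
    define n where "n = degree q"
    let ?p = "[:- x, 1:] * q"
    have lead: "lead_coeff ?p = a" unfolding lead_coeff_mult by (simp add: a_def)
    have a: "algebraic_int a"
      using less.prems unfolding lead[symmetric] int_coeffs_def by blast
    have "algebraic_int (lead_coeff ?p * x)"
    proof (rule algebraic_int_lead_coeff_mult_root)
      show "?p \<noteq> 0" using False unfolding mult_eq_0_iff by simp
      show "poly ?p x = 0" by simp
      show "algebraic_int (coeff ?p i)" for i using less.prems unfolding int_coeffs_def by blast
    qed
    then have ax: "algebraic_int (a * x)" by (simp only: lead)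
    define q' where "q' = q - monom a n"
    have "[:- x, 1:] * monom a n = monom a (Suc n) - monom (a * x) n"
      by (rule poly_eqI) (simp add: coeff_pCons split: nat.split)
    then have eq: "[:- x, 1:] * q' = ?p - (monom a (Suc n) - monom (a * x) n)"
      by (simp only: q'_def right_diff_distrib)
    have ic: "int_coeffs ([:- x, 1:] * q')"
      unfolding eq using less.prems a ax by (intro int_coeffs_diff int_coeffs_monom)
    have "int_coeffs q'"
    proof (cases "q' = 0")
      case True
      then show ?thesis by (simp add: int_coeffs_def)
    next
      case False
      have "degree q' \<le> n" unfolding q'_def n_def
        by (intro degree_diff_le) (auto simp: degree_monom_le)
      moreover have "coeff q' n = 0" by (simp add: q'_def a_def n_def)
      ultimately have "degree q' < n" using False eq_zero_or_degree_less by blast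
      then show ?thesis using ic unfolding n_def by (rule less.hyps)
    qed
    then have "int_coeffs (q' + monom a n)" using a by (intro int_coeffs_add int_coeffs_monom)
    then show ?thesis by (simp add: q'_def)
  qed (simp add: int_coeffs_def)
qed

text \<open>The linear factors outside \<open>J\<close> are cancelled one by one; what remains has
  the desired product, up to sign, as constant coefficient. \<open>int_coeffs_prod_linear\<close> is
  the converse.\<close>

lemma algebraic_int_mult_prod_roots:
  assumes I: "finite I" and p: "int_coeffs (smult a (\<Prod>i\<in>I. [:- z i, 1:]))" and J: "J \<subseteq> I"
  shows "algebraic_int (a * (\<Prod>i\<in>J. z i))"
proof -
  have *: "int_coeffs (smult a (\<Prod>i\<in>K - T. [:- z i, 1:]))"
    if "finite T" "T \<subseteq> K" "finite K" "int_coeffs (smult a (\<Prod>i\<in>K. [:- z i, 1:]))" for K T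
    using that(1,2)
  proof (induction T rule: finite_induct)
    case (insert t T)
    then have eq: "K - T = insert t (K - insert t T)" by blast
    have "int_coeffs (smult a (\<Prod>i\<in>K - T. [:- z i, 1:]))" using insert by simp
    then have "int_coeffs (smult a (\<Prod>i\<in>insert t (K - insert t T). [:- z i, 1:]))"
      unfolding eq .
    moreover have "(\<Prod>i\<in>insert t (K - insert t T). [:- z i, 1:]) = [:- z t, 1:] * (\<Prod>i\<in>K - insert t T. [:- z i, 1:])"
      using that(3) by (intro prod.insert) auto
    ultimately have "int_coeffs ([:- z t, 1:] * smult a (\<Prod>i\<in>K - insert t T. [:- z i, 1:]))"
      by (simp only: mult_smult_right)
    then show ?case by (rule int_coeffs_cancel_linear)
  qed (use that in simp)
  have "int_coeffs (smult a (\<Prod>i\<in>I - (I - J). [:- z i, 1:]))"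
    using *[OF _ _ I p, of "I - J"] I by simp
  moreover have "I - (I - J) = J" using J by blast
  ultimately have "int_coeffs (smult a (\<Prod>i\<in>J. [:- z i, 1:]))" by simp
  then have "algebraic_int (coeff (smult a (\<Prod>i\<in>J. [:- z i, 1:])) 0)"
    unfolding int_coeffs_def by blast
  also have "coeff (smult a (\<Prod>i\<in>J. [:- z i, 1:])) 0 = a * (\<Prod>i\<in>J. - z i)"
    by (simp add: poly_0_coeff_0[symmetric] poly_prod)
  also have "(\<Prod>i\<in>J. - z i) = (- 1) ^ card J * (\<Prod>i\<in>J. z i)"
    by (rule prod_uminus)
  finally have "algebraic_int (a * ((- 1) ^ card J * (\<Prod>i\<in>J. z i)))" .
  then show ?thesis by (cases "even (card J)") simp_all
qed

text \<open>The reason for working with products over all subsets: integrality of the whole family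
  survives translation of the \<open>z i\<close> by algebraic integers.\<close>

lemma algebraic_int_mult_prod_add:
  assumes I: "finite I" and z: "\<And>J. J \<subseteq> I \<Longrightarrow> algebraic_int (a * (\<Prod>i\<in>J. z i))"
    and w: "\<And>i. i \<in> I \<Longrightarrow> algebraic_int (w i)" and J: "J \<subseteq> I"
  shows "algebraic_int (a * (\<Prod>i\<in>J. z i + w i :: complex))"
proof -
  have "a * (\<Prod>i\<in>J. z i + w i) = (\<Sum>U\<in>Pow J. (a * (\<Prod>i\<in>U. z i)) * (\<Prod>i\<in>J - U. w i))"
    using finite_subset[OF J I] by (subst prod_add) (simp_all add: sum_distrib_left mult.assoc)
  also have "algebraic_int \<dots>"
  proof (rule algebraic_int_sum, rule algebraic_int_mult)
    fix U assume "U \<in> Pow J"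
    then show "algebraic_int (a * (\<Prod>i\<in>U. z i))" using J by (intro z) blast
    show "algebraic_int (\<Prod>i\<in>J - U. w i)" using J by (intro algebraic_int_prod w) blast
  qed
  finally show ?thesis .
qed

lemma int_coeffs_prod_linear:
  assumes I: "finite I" and z: "\<And>J. J \<subseteq> I \<Longrightarrow> algebraic_int (a * (\<Prod>i\<in>J. z i))"
  shows "int_coeffs (smult a (\<Prod>i\<in>I. [:- z i, 1:]))"
proof -
  have const: "(\<Prod>i\<in>U. [:- z i:]) = [:(- 1) ^ card U * (\<Prod>i\<in>U. z i):]" for U
  proof -
    have "(\<Prod>i\<in>U. [:- z i:]) = [:\<Prod>i\<in>U. - z i:]"
      by (induction U rule: infinite_finite_induct) simp_all
    then show ?thesis by (simp only: prod_uminus)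
  qed
  have "(\<Prod>i\<in>I. [:- z i, 1:]) = (\<Prod>i\<in>I. [:- z i:] + [:0, 1:])" by simp
  also have "\<dots> = (\<Sum>U\<in>Pow I. (\<Prod>i\<in>U. [:- z i:]) * (\<Prod>i\<in>I - U. [:0, 1:]))"
    using I by (rule prod_add)
  finally have e: "(\<Prod>i\<in>I. [:- z i, 1:]) = (\<Sum>U\<in>Pow I. (\<Prod>i\<in>U. [:- z i:]) * (\<Prod>i\<in>I - U. [:0, 1:]))" .
  have "smult a (\<Prod>i\<in>I. [:- z i, 1:])
      = (\<Sum>U\<in>Pow I. [:(- 1) ^ card U:] * [:a * (\<Prod>i\<in>U. z i):] * (\<Prod>i\<in>I - U. [:0, 1:]))"
    unfolding e smult_sum2 by (intro sum.cong refl) (simp add: const mult_ac)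
  also have "int_coeffs \<dots>"
  proof (intro int_coeffs_sum int_coeffs_mult int_coeffs_prod int_coeffs_const)
    fix U assume "U \<in> Pow I"
    then show "algebraic_int (a * (\<Prod>i\<in>U. z i))" by (intro z) blast
    show "algebraic_int ((- 1) ^ card U :: complex)" by (intro algebraic_int_power) simp
    show "int_coeffs [:0, 1:]" by (simp add: int_coeffs_def coeff_pCons split: nat.split)
  qed
  finally show ?thesis .
qed

text \<open>Allowing \<open>b\<close> to be the square root of an integer is what
  \<open>den_quadratic\<close> requires. Squaring makes integrality a divisibility
  \<open>N ^ 2 dvd B * coeff P k ^ 2\<close>; after cancelling the gcd of \<open>N ^ 2\<close> and
  \<open>B\<close>, a prime left over from \<open>N ^ 2\<close> would divide the content of
  \<open>P\<close>.\<close>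

lemma primitive_scaling_ge:
  fixes P :: "int poly"
  assumes prim: "Polynomial.content P = 1" and N: "N > 0" and b: "b > 0" "b ^ 2 = of_int B"
    and ic: "int_coeffs (smult (of_real b / of_int N) (map_poly of_int P))"
  shows "b \<ge> of_int N"
proof -
  have "b ^ 2 > 0" using b(1) by simp
  then have B: "B > 0" unfolding b(2) by simp
  have dvd: "N ^ 2 dvd B * coeff P k ^ 2" for k
  proof -
    have "algebraic_int (of_real b / of_int N * of_int (coeff P k) :: complex)"
      using ic[unfolded int_coeffs_def, THEN spec, of k] by simp
    then have "algebraic_int ((of_real b / of_int N * of_int (coeff P k) :: complex) ^ 2)"
      by (rule algebraic_int_power)
    also have "(of_real b / of_int N * of_int (coeff P k) :: complex) ^ 2
        = of_real (b ^ 2) * of_int (coeff P k ^ 2) / of_int (N ^ 2)"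
      by (simp add: power_mult_distrib power_divide)
    also have "\<dots> = of_int (B * coeff P k ^ 2) / of_int (N ^ 2)"
      unfolding b(2) by simp
    finally show ?thesis using N by (intro algebraic_int_of_int_over_int) auto
  qed
  define g where "g = gcd (N ^ 2) B"
  have g0: "g \<noteq> 0" using N by (simp add: g_def)
  obtain n where n: "N ^ 2 = g * n" unfolding g_def using gcd_dvd1[of "N^2" B] by (elim dvdE)
  obtain m where m: "B = g * m" unfolding g_def using gcd_dvd2[of "N^2" B] by (elim dvdE)
  have "Rings.coprime n m"
  proof -
    have "g = gcd (g * n) (g * m)" unfolding n[symmetric] m[symmetric] by (rule g_def)
    also have "\<dots> = \<bar>g\<bar> * gcd n m" by (simp add: gcd_mult_distrib_int)
    finally have "g = \<bar>g\<bar> * gcd n m" .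
    moreover have "g > 0" using N by (simp add: g_def)
    ultimately have "gcd n m = 1" by simp
    then show ?thesis by (simp add: coprime_iff_gcd_eq_1)
  qed
  have nP: "n dvd coeff P k ^ 2" for k
  proof -
    have "g * n dvd g * (m * coeff P k ^ 2)" using dvd[of k] n m by (simp add: mult.assoc)
    then have "n dvd m * coeff P k ^ 2" using g0 by simp
    then show ?thesis using \<open>Rings.coprime n m\<close> by (simp add: coprime_dvd_mult_right_iff)
  qed
  have "is_unit n"
  proof (rule ccontr)
    assume "\<not> is_unit n"
    moreover have "n \<noteq> 0" using n N by (metis less_irrefl mult_zero_right power_eq_0_iff)
    ultimately obtain q where q: "prime q" "q dvd n" using prime_divisor_exists by blast
    have "q dvd coeff P k" for k
      by (rule prime_dvd_power[OF q(1) dvd_trans[OF q(2) nP]])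
    then have "[:q:] dvd P" by (simp add: const_poly_dvd_iff)
    then have "q dvd Polynomial.content P" by (simp add: const_poly_dvd_iff_dvd_content)
    with prim q show False by (simp add: not_prime_unit)
  qed
  then have "N ^ 2 dvd B" unfolding n m by (simp add: unit_imp_dvd)
  then have "N ^ 2 \<le> B" using B by (rule zdvd_imp_le)
  then have "real_of_int (N ^ 2) \<le> b ^ 2" unfolding b(2) by (rule of_int_le_iff[THEN iffD2])
  then have "(of_int N) ^ 2 \<le> b ^ 2" by simp
  then show ?thesis using b(1) by (rule power2_le_imp_le[OF _ less_imp_le])
qed

lemma content_min_int_poly:
  assumes x: "algebraic x"
  shows "Polynomial.content (min_int_poly x) = 1"
proof -
  let ?p = "min_int_poly x" and ?c = "Polynomial.content (min_int_poly x)"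
  obtain q where q: "?p = [:?c:] * q"
    using const_poly_dvd_iff_dvd_content[of ?c ?p, THEN iffD2, OF dvd_refl] by (rule dvdE)
  have "\<not> q dvd 1"
  proof
    assume "q dvd 1"
    then have "degree q = 0" using dvd_imp_degree_le[of q 1] by simp
    then have "degree ([:?c:] * q) = 0" using degree_mult_le[of "[:?c:]" q] by simp
    with q min_int_poly_degree[OF x] show False by simp
  qed
  then have "[:?c:] dvd 1" using irreducibleD[OF min_int_poly_irreducible[OF x] q] by blast
  then have "?c dvd 1" by (simp add: is_unit_const_poly_iff)
  then show ?thesis using normalize_content[of ?p] by simp
qed

section \<open>Denominators relative to a number field\<close>

context
  fixes S :: "complex set"
  assumes S: "\<And>s. s \<in> S \<Longrightarrow> algebraic s" and finS: "finite S"
begin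

lemma prod_embeddings:
  fixes H :: "complex \<Rightarrow> 'b :: comm_semiring_1"
  assumes x: "x \<in> field_adjoin S"
  shows "(\<Prod>\<phi>\<in>embeddings S. H (\<phi> x)) = (\<Prod>y\<in>conjugates x. H y) ^ card {\<phi>\<in>embeddings S. \<phi> x = x}"
proof -
  have ax: "algebraic x" using x S by (rule field_adjoin_algebraic)
  let ?E = "embeddings S"
  have img: "(\<lambda>\<phi>. \<phi> x) ` ?E \<subseteq> conjugates x"
  proof (rule image_subsetI)
    fix \<phi> assume "\<phi> \<in> ?E"
    then obtain g where "alg_hom g" "\<phi> = restrict g (field_adjoin S)" by (rule embeddingsE)
    with x show "\<phi> x \<in> conjugates x" using alg_hom_conjugates[OF _ ax] by simp
  qed
  have "(\<Prod>\<phi>\<in>?E. H (\<phi> x)) = (\<Prod>y\<in>conjugates x. \<Prod>\<phi>\<in>{\<phi>\<in>?E. \<phi> x = y}. H (\<phi> x))"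
    using prod.group[OF finite_embeddings[OF S finS] finite_conjugates[OF ax] img, of "\<lambda>\<phi>. H (\<phi> x)"] by simp
  also have "\<dots> = (\<Prod>y\<in>conjugates x. H y ^ card {\<phi>\<in>?E. \<phi> x = x})"
  proof (rule prod.cong)
    fix y assume y: "y \<in> conjugates x"
    have "(\<Prod>\<phi>\<in>{\<phi>\<in>?E. \<phi> x = y}. H (\<phi> x)) = (\<Prod>\<phi>\<in>{\<phi>\<in>?E. \<phi> x = y}. H y)"
      by (rule prod.cong) auto
    then show "(\<Prod>\<phi>\<in>{\<phi>\<in>?E. \<phi> x = y}. H (\<phi> x)) = H y ^ card {\<phi>\<in>?E. \<phi> x = x}"
      using sum_embeddings(3)[OF S finS x y] by simp
  qed simp
  finally show ?thesis by (simp only: prod_power_distrib)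
qed

text \<open>The leading coefficient of the primitive field polynomial of \<open>x\<close>, whose
  logarithm is the total non-archimedean contribution to the height, see
  \<open>weil_height_embeddings\<close>.\<close>

definition den :: "complex \<Rightarrow> int" where
  "den x = lead_coeff (min_int_poly x) ^ card {\<phi>\<in>embeddings S. \<phi> x = x}"

lemma den_pos: "algebraic x \<Longrightarrow> den x > 0"
  unfolding den_def using min_int_poly_lead by simp

lemma den_poly:
  assumes x: "x \<in> field_adjoin S"
  obtains P where "Polynomial.content P = 1"
    "map_poly of_int P = smult (of_int (den x)) (\<Prod>\<phi>\<in>embeddings S. [:- \<phi> x, 1:])"
proof
  have ax: "algebraic x" using x S by (rule field_adjoin_algebraic)
  let ?k = "card {\<phi>\<in>embeddings S. \<phi> x = x}"
  let ?p = "min_int_poly x"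
  have "Polynomial.content (?p ^ n) = 1" for n
    by (induction n) (simp_all add: content_mult content_min_int_poly[OF ax])
  then show "Polynomial.content (?p ^ ?k) = 1" .
  have "map_poly of_int (?p ^ ?k) = (map_poly of_int ?p :: complex poly) ^ ?k"
    by (rule of_int_poly_hom.hom_power)
  also have "\<dots> = (smult (of_int (lead_coeff ?p)) (\<Prod>y\<in>conjugates x. [:- y, 1:])) ^ ?k"
    by (subst min_int_poly_factorization[OF ax]) (rule refl)
  also have "\<dots> = smult (of_int (den x)) (\<Prod>\<phi>\<in>embeddings S. [:- \<phi> x, 1:])"
    unfolding prod_embeddings[OF x, of "\<lambda>y. [:- y, 1:]"] smult_power den_def by simp
  finally show "map_poly of_int (?p ^ ?k) = smult (of_int (den x)) (\<Prod>\<phi>\<in>embeddings S. [:- \<phi> x, 1:])" .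
qed

lemma weil_height_embeddings:
  assumes x: "x \<in> field_adjoin S"
  shows "real (card (embeddings S)) * weil_height x = ln (den x) + (\<Sum>\<phi>\<in>embeddings S. ln_plus (\<phi> x))"
proof -
  have ax: "algebraic x" using x S by (rule field_adjoin_algebraic)
  let ?k = "card {\<phi>\<in>embeddings S. \<phi> x = x}"
  have "ln (real_of_int (den x)) = ?k * ln (lead_coeff (min_int_poly x))"
    using min_int_poly_lead[OF ax] by (simp add: den_def ln_realpow)
  moreover have "real (card (embeddings S)) = ?k * card (conjugates x)"
    using sum_embeddings(2)[OF S finS x] by (metis of_nat_mult)
  moreover have "card (conjugates x) \<noteq> 0" using card_conjugates_pos[OF ax] by simp
  moreover have "(\<Sum>\<phi>\<in>embeddings S. ln_plus (\<phi> x)) = real (card (embeddings S)) * conj_avg ln_plus x"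
    by (rule sum_embeddings(1)[OF S finS x])
  ultimately show ?thesis
    unfolding weil_height_eq[OF ax] by (simp add: algebra_simps)
qed

lemma den_integrality:
  assumes x: "x \<in> field_adjoin S" and J: "J \<subseteq> embeddings S"
  shows "algebraic_int (of_int (den x) * (\<Prod>\<phi>\<in>J. \<phi> x))"
proof -
  obtain P where P: "map_poly of_int P = smult (of_int (den x)) (\<Prod>\<phi>\<in>embeddings S. [:- \<phi> x, 1:])"
    using den_poly[OF x] by metis
  have "int_coeffs (map_poly of_int P)" by (simp add: int_coeffs_def)
  then have "int_coeffs (smult (of_int (den x)) (\<Prod>\<phi>\<in>embeddings S. [:- \<phi> x, 1:]))" by (simp only: P)
  from algebraic_int_mult_prod_roots[OF finite_embeddings[OF S finS] this J] show ?thesis .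
qed

text \<open>With \<open>den_integrality\<close> this characterises \<open>den x\<close> as the least
  such \<open>b\<close>, so denominators can be compared without local absolute values.\<close>

lemma den_minimal:
  assumes x: "x \<in> field_adjoin S" and b: "b > 0" "b ^ 2 = of_int B"
    and int: "\<And>J. J \<subseteq> embeddings S \<Longrightarrow> algebraic_int (of_real b * (\<Prod>\<phi>\<in>J. \<phi> x))"
  shows "b \<ge> of_int (den x)"
proof -
  have ax: "algebraic x" using x S by (rule field_adjoin_algebraic)
  obtain P where P: "Polynomial.content P = 1"
    "map_poly of_int P = smult (of_int (den x)) (\<Prod>\<phi>\<in>embeddings S. [:- \<phi> x, 1:])"
    using den_poly[OF x] by metis
  have "int_coeffs (smult (of_real b) (\<Prod>\<phi>\<in>embeddings S. [:- \<phi> x, 1:]))"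
    using finite_embeddings[OF S finS] int by (rule int_coeffs_prod_linear)
  also have "smult (of_real b) (\<Prod>\<phi>\<in>embeddings S. [:- \<phi> x, 1:])
      = smult (of_real b / of_int (den x)) (map_poly of_int P)"
    unfolding P(2) using den_pos[OF ax] by simp
  finally show ?thesis using primitive_scaling_ge[OF P(1) den_pos[OF ax] b] by blast
qed

text \<open>At each finite place the maximum of 1 and the absolute value is squared, since
  \<open>c\<close> is integral. Globally this is two inequalities by minimality:
  \<open>den x ^ 2\<close> works for \<open>x ^ 2 + c\<close>, and, after subtracting
  \<open>c\<close> and taking square roots of algebraic integers,
  \<open>sqrt (den (x ^ 2 + c))\<close> works for \<open>x\<close>.\<close>

lemma den_quadratic:
  assumes x: "x \<in> field_adjoin S" and c: "c \<in> field_adjoin S" "algebraic_int c"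
  shows "den (x ^ 2 + c) = den x ^ 2"
proof -
  let ?y = "x ^ 2 + c" and ?E = "embeddings S"
  have y: "?y \<in> field_adjoin S" using x c by (intro field_adjoin_add field_adjoin_power)
  have ax: "algebraic x" using x S by (rule field_adjoin_algebraic)
  have ac: "algebraic c" using c by auto
  have ay: "algebraic ?y" using y S by (rule field_adjoin_algebraic)
  have phi: "\<phi> ?y = \<phi> x ^ 2 + \<phi> c" "algebraic_int (\<phi> c)" if "\<phi> \<in> ?E" for \<phi>
  proof -
    obtain g where g: "alg_hom g" "\<phi> = restrict g (field_adjoin S)" using \<open>\<phi> \<in> ?E\<close> by (rule embeddingsE)
    show "\<phi> ?y = \<phi> x ^ 2 + \<phi> c" using g(2) x c(1) y ax ac
      by (simp add: ah_add[OF g(1)] ah_power[OF g(1)] algebraic_power)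
    show "algebraic_int (\<phi> c)" using g(2) c(1) ah_algebraic_int[OF g(1) c(2)] by simp
  qed
  have sub: "\<phi> \<in> ?E" if "\<phi> \<in> J" "J \<subseteq> ?E" for \<phi> J using that by blast
  note fin = finite_embeddings[OF S finS]
  define A A' where "A = den x" and "A' = den ?y"
  have pos: "A > 0" "A' > 0" using den_pos ax ay by (simp_all add: A_def A'_def)
  have le1: "real_of_int A' \<le> (of_int A) ^ 2"
    unfolding A'_def
  proof (rule den_minimal[OF y])
    show "(0::real) < of_int A ^ 2" using pos by simp
    show "((of_int A)\<^sup>2 :: real)\<^sup>2 = of_int (A ^ 4)" by simp
    fix J assume J: "J \<subseteq> ?E"
    have sq: "algebraic_int (of_int A ^ 2 * (\<Prod>\<phi>\<in>K. \<phi> x ^ 2))" if "K \<subseteq> ?E" for K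
      using algebraic_int_power[OF den_integrality[OF x that], of 2]
      by (simp add: A_def power_mult_distrib prod_power_distrib)
    have eq: "(\<Prod>\<phi>\<in>J. \<phi> ?y) = (\<Prod>\<phi>\<in>J. \<phi> x ^ 2 + \<phi> c)"
      by (rule prod.cong[OF refl phi(1)[OF sub[OF _ J]]])
    show "algebraic_int (of_real (of_int A ^ 2) * (\<Prod>\<phi>\<in>J. \<phi> ?y))"
      unfolding eq using algebraic_int_mult_prod_add[OF fin sq phi(2) J] by simp
  qed
  have "real_of_int A \<le> sqrt (of_int A')"
    unfolding A_def
  proof (rule den_minimal[OF x])
    show "0 < sqrt (of_int A')" using pos by simp
    show "(sqrt (of_int A'))\<^sup>2 = of_int A'" using pos by simp
    fix J assume J: "J \<subseteq> ?E"
    have int: "algebraic_int (of_int A' * (\<Prod>\<phi>\<in>K. \<phi> ?y))" if "K \<subseteq> ?E" for K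
      unfolding A'_def by (rule den_integrality[OF y that])
    have "algebraic_int (- \<phi> c)" if "\<phi> \<in> ?E" for \<phi> using phi(2)[OF that] by simp
    from algebraic_int_mult_prod_add[OF fin int this J]
    have "algebraic_int (of_int A' * (\<Prod>\<phi>\<in>J. \<phi> ?y + - \<phi> c))" .
    moreover have "(\<Prod>\<phi>\<in>J. \<phi> ?y + - \<phi> c) = (\<Prod>\<phi>\<in>J. \<phi> x ^ 2)"
      by (rule prod.cong[OF refl]) (simp add: phi(1)[OF sub[OF _ J]])
    moreover have "of_int A' = (of_real (sqrt (of_int A')) :: complex) ^ 2"
      using pos by (simp flip: of_real_power)
    ultimately have "algebraic_int ((of_real (sqrt (of_int A')) * (\<Prod>\<phi>\<in>J. \<phi> x)) ^ 2)"
      by (simp only: power_mult_distrib prod_power_distrib)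
    then show "algebraic_int (of_real (sqrt (of_int A')) * (\<Prod>\<phi>\<in>J. \<phi> x))"
      by (rule algebraic_int_of_power) simp
  qed
  then have "(real_of_int A) ^ 2 \<le> (sqrt (of_int A')) ^ 2"
    using pos by (intro power_mono) simp_all
  also have "(sqrt (of_int A')) ^ 2 = real_of_int A'" using pos by simp
  finally have "real_of_int A' = (of_int A) ^ 2" using le1 by simp
  then have "real_of_int A' = of_int (A ^ 2)" by simp
  then show ?thesis unfolding A_def A'_def by (simp only: of_int_eq_iff)
qed

end

section \<open>The Weil height under a quadratic polynomial\<close>

lemma ln_plus_quadratic:
  assumes "cmod c \<le> K"
  shows "\<bar>ln_plus (x ^ 2 + c) - 2 * ln_plus x\<bar> \<le> ln (1 + K)"
proof -
  have K: "K \<ge> 0" using assms norm_ge_zero order_trans by blast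
  define m where "m = max 1 (cmod x)"
  define m' where "m' = max 1 (cmod (x ^ 2 + c))"
  have m: "m \<ge> 1" "m' \<ge> 1" "cmod x \<le> m" "cmod (x ^ 2 + c) \<le> m'" by (simp_all add: m_def m'_def)
  have sq: "cmod x ^ 2 \<le> m ^ 2" using m by (intro power_mono) auto
  have "cmod (x ^ 2 + c) \<le> cmod x ^ 2 + cmod c" using norm_triangle_ineq[of "x^2" c] by (simp add: norm_power)
  also have "\<dots> \<le> m ^ 2 + K * m ^ 2"
  proof (rule add_mono[OF sq])
    have "K * 1 \<le> K * m ^ 2" using K m by (intro mult_left_mono) auto
    then show "cmod c \<le> K * m ^ 2" using assms by simp
  qed
  finally have "cmod (x ^ 2 + c) \<le> (1 + K) * m ^ 2" by (simp add: algebra_simps)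
  moreover have "1 \<le> (1 + K) * m ^ 2" using K m mult_mono[of 1 "1 + K" 1 "m ^ 2"] by simp
  ultimately have up: "m' \<le> (1 + K) * m ^ 2" by (simp add: m'_def)
  have "cmod x ^ 2 = cmod ((x ^ 2 + c) - c)" by (simp add: norm_power)
  also have "\<dots> \<le> cmod (x ^ 2 + c) + cmod c" by (rule norm_triangle_ineq4)
  also have "\<dots> \<le> m' + K * m'"
  proof (rule add_mono[OF m(4)])
    have "K * 1 \<le> K * m'" using K m by (intro mult_left_mono) auto
    then show "cmod c \<le> K * m'" using assms by simp
  qed
  finally have "cmod x ^ 2 \<le> (1 + K) * m'" by (simp add: algebra_simps)
  moreover have "1 \<le> (1 + K) * m'" using K m mult_mono[of 1 "1 + K" 1 m'] by simp
  ultimately have lo: "m ^ 2 \<le> (1 + K) * m'" by (simp add: m_def max_def)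
  have "ln m' \<le> ln ((1 + K) * m ^ 2)" using up m by (intro ln_mono) auto
  also have "\<dots> = ln (1 + K) + 2 * ln m" using K m by (simp add: ln_mult_pos ln_realpow)
  finally have 1: "ln m' \<le> ln (1 + K) + 2 * ln m" .
  have "2 * ln m = ln (m ^ 2)" using m by (simp add: ln_realpow)
  also have "\<dots> \<le> ln ((1 + K) * m')" using lo m by (intro ln_mono) auto
  also have "\<dots> = ln (1 + K) + ln m'" using K m by (simp add: ln_mult_pos)
  finally have 2: "2 * ln m \<le> ln (1 + K) + ln m'" .
  show ?thesis using 1 2 unfolding ln_plus_def m_def[symmetric] m'_def[symmetric] by linarith
qed

text \<open>The finite part doubles exactly by \<open>den_quadratic\<close>; the archimedean part
  doubles up to a constant controlled by the largest conjugate of \<open>c\<close>.\<close>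

lemma weil_height_quadratic:
  assumes c: "algebraic_int c"
  shows "\<exists>B. \<forall>x. algebraic x \<longrightarrow> \<bar>weil_height (x ^ 2 + c) - 2 * weil_height x\<bar> \<le> B"
proof -
  have ac: "algebraic c" using c by auto
  define K where "K = Max (cmod ` conjugates c)"
  have K: "cmod c' \<le> K" if "c' \<in> conjugates c" for c'
    unfolding K_def using that finite_conjugates[OF ac] by (intro Max_ge) auto
  have "\<bar>weil_height (x ^ 2 + c) - 2 * weil_height x\<bar> \<le> ln (1 + K)" if x: "algebraic x" for x
  proof -
    let ?S = "{x, c}" and ?y = "x ^ 2 + c"
    let ?E = "embeddings ?S"
    have S: "\<And>s. s \<in> ?S \<Longrightarrow> algebraic s" "finite ?S" using x ac by auto
    have mem: "x \<in> field_adjoin ?S" "c \<in> field_adjoin ?S" by (auto intro: field_adjoin_incl)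
    have y: "?y \<in> field_adjoin ?S" using mem by (intro field_adjoin_add field_adjoin_power)
    have D: "real (card ?E) > 0" using card_embeddings_pos[OF S] by simp
    have "den ?S ?y = den ?S x ^ 2" by (rule den_quadratic[OF S mem c])
    moreover have "den ?S x > 0" by (rule den_pos[OF S x])
    ultimately have "ln (real_of_int (den ?S ?y)) = 2 * ln (den ?S x)" by (simp add: ln_realpow)
    then have "real (card ?E) * (weil_height ?y - 2 * weil_height x)
        = (\<Sum>\<phi>\<in>?E. ln_plus (\<phi> ?y) - 2 * ln_plus (\<phi> x))"
      using weil_height_embeddings[OF S y] weil_height_embeddings[OF S mem(1)]
      by (simp add: right_diff_distrib sum_subtractf flip: sum_distrib_left)
    also have "\<bar>\<dots>\<bar> \<le> (\<Sum>\<phi>\<in>?E. ln (1 + K))"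
    proof (rule order_trans[OF sum_abs sum_mono])
      fix \<phi> assume "\<phi> \<in> ?E"
      then obtain g where g: "alg_hom g" "\<phi> = restrict g (field_adjoin ?S)" by (rule embeddingsE)
      have "\<phi> ?y = \<phi> x ^ 2 + \<phi> c" using g(2) mem y x ac
        by (simp add: ah_add[OF g(1)] ah_power[OF g(1)] algebraic_power)
      moreover have "cmod (\<phi> c) \<le> K"
        using g(2) mem(2) K alg_hom_conjugates[OF g(1) ac] by simp
      ultimately show "\<bar>ln_plus (\<phi> ?y) - 2 * ln_plus (\<phi> x)\<bar> \<le> ln (1 + K)"
        using ln_plus_quadratic by simp
    qed
    also have "\<dots> = real (card ?E) * ln (1 + K)" by simp
    finally show ?thesis using D by (simp add: abs_mult)
  qed
  then show ?thesis by blast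
qed

section \<open>The canonical height\<close>

definition qmap :: "complex \<Rightarrow> complex \<Rightarrow> complex" where
  "qmap c z = z ^ 2 + c"

lemma poly_qmap: "poly [:c, 0, 1:] = qmap c"
  by (rule ext) (simp add: qmap_def power2_eq_square)

lemma qmap_algebraic: "algebraic c \<Longrightarrow> algebraic z \<Longrightarrow> algebraic (qmap c z)"
  unfolding qmap_def by (intro algebraic_add algebraic_power)

lemma qmap_iter_algebraic: "algebraic c \<Longrightarrow> algebraic z \<Longrightarrow> algebraic ((qmap c ^^ n) z)"
  by (induction n) (simp_all add: qmap_algebraic)

lemma qmap_iter_algebraic_int:
  assumes "algebraic_int c" "algebraic_int z"
  shows "algebraic_int ((qmap c ^^ n) z)"
proof (induction n)
  case (Suc n)
  then show ?case unfolding funpow.simps o_apply qmap_def using assms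
    by (intro algebraic_int_add algebraic_int_power)
qed (use assms in simp)

lemma qmap_iter_field_adjoin:
  assumes "c \<in> field_adjoin S" "z \<in> field_adjoin S"
  shows "(qmap c ^^ n) z \<in> field_adjoin S"
proof (induction n)
  case (Suc n)
  then show ?case unfolding funpow.simps o_apply qmap_def using assms
    by (intro field_adjoin_add field_adjoin_power)
qed (use assms in simp)

lemma ah_qmap:
  assumes g: "alg_hom g" and "algebraic c" "algebraic z"
  shows "g ((qmap c ^^ n) z) = (qmap (g c) ^^ n) (g z)"
proof (induction n)
  case (Suc n)
  have a: "algebraic ((qmap c ^^ n) z)" using assms by (intro qmap_iter_algebraic)
  have "g (qmap c ((qmap c ^^ n) z)) = qmap (g c) (g ((qmap c ^^ n) z))"
    unfolding qmap_def[of c "(qmap c ^^ n) z"]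
    using a assms(2) by (simp add: ah_add[OF g] ah_power[OF g] algebraic_power qmap_def)
  with Suc show ?case by simp
qed simp

text \<open>Tate's limit: \<open>h x\<close> is the limit of \<open>w ((T ^^ n) x) / 2 ^ n\<close>,
  written as a telescoping series dominated by a geometric one with sum \<open>B\<close>.\<close>

lemma geometric_conjugacy_limit:
  fixes w :: "'a \<Rightarrow> real" and T :: "'a \<Rightarrow> 'a"
  assumes T: "\<And>x. x \<in> A \<Longrightarrow> T x \<in> A" and B: "\<And>x. x \<in> A \<Longrightarrow> \<bar>w (T x) - 2 * w x\<bar> \<le> B"
    and pos: "\<And>x. x \<in> A \<Longrightarrow> w x \<ge> 0"
  obtains h where "\<And>x. x \<in> A \<Longrightarrow> h (T x) = 2 * h x" "\<And>x. x \<in> A \<Longrightarrow> h x \<ge> 0"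
    "\<And>x. x \<in> A \<Longrightarrow> \<bar>h x - w x\<bar> \<le> B"
proof -
  define a where "a x n = w ((T ^^ n) x) / 2 ^ n" for x n
  define d where "d x n = a x (Suc n) - a x n" for x n
  have iter: "(T ^^ n) x \<in> A" if "x \<in> A" for x n
    using that T by (induction n) auto
  have d: "\<bar>d x n\<bar> \<le> B * (1/2) ^ Suc n" if "x \<in> A" for x n
  proof -
    have "d x n = (w (T ((T ^^ n) x)) - 2 * w ((T ^^ n) x)) / 2 ^ Suc n"
      by (simp add: d_def a_def diff_divide_distrib)
    also have "\<bar>\<dots>\<bar> = \<bar>w (T ((T ^^ n) x)) - 2 * w ((T ^^ n) x)\<bar> / 2 ^ Suc n" by simp
    also have "\<dots> \<le> B / 2 ^ Suc n" using B[OF iter[OF that]] by (intro divide_right_mono) auto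
    finally show ?thesis by (simp add: power_divide)
  qed
  have geo: "(\<lambda>n. B * (1/2) ^ Suc n) sums B"
    using sums_mult[OF power_half_series, of B] by simp
  define h where "h x = w x + suminf (d x)" for x
  have sm: "summable (d x)" if "x \<in> A" for x
    by (rule summable_comparison_test'[OF sums_summable[OF geo], of 0]) (simp add: d[OF that, simplified])
  have lim: "a x \<longlonglongrightarrow> h x" if "x \<in> A" for x
  proof -
    have "(\<lambda>n. \<Sum>i<n. d x i) \<longlonglongrightarrow> suminf (d x)" using sm[OF that] by (rule summable_LIMSEQ)
    moreover have "(\<Sum>i<n. d x i) = a x n - w x" for n
      unfolding d_def by (subst sum_lessThan_telescope) (simp add: a_def)
    ultimately have "(\<lambda>n. a x n - w x) \<longlonglongrightarrow> suminf (d x)" by simp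
    from tendsto_add[OF this tendsto_const[of "w x"]] show ?thesis by (simp add: h_def add.commute)
  qed
  show ?thesis
  proof
    fix x assume x: "x \<in> A"
    have "(\<lambda>n. a x (Suc n)) \<longlonglongrightarrow> h x" using lim[OF x] by (rule LIMSEQ_Suc)
    then have "(\<lambda>n. 2 * a x (Suc n)) \<longlonglongrightarrow> 2 * h x" by (intro tendsto_intros)
    moreover have "2 * a x (Suc n) = a (T x) n" for n by (simp add: a_def funpow_swap1)
    ultimately have "a (T x) \<longlonglongrightarrow> 2 * h x" by simp
    with lim[OF T[OF x]] show "h (T x) = 2 * h x" by (rule LIMSEQ_unique)
    have "a x n \<ge> 0" for n unfolding a_def using pos[OF iter[OF x]] by simp
    then show "h x \<ge> 0" by (intro LIMSEQ_le_const[OF lim[OF x]] exI allI impI)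
    have abs: "summable (\<lambda>n. \<bar>d x n\<bar>)"
      by (rule summable_comparison_test'[OF sums_summable[OF geo], of 0]) (simp add: d[OF x, simplified])
    then have "\<bar>suminf (d x)\<bar> \<le> (\<Sum>n. \<bar>d x n\<bar>)" by (rule summable_rabs)
    also have "\<dots> \<le> (\<Sum>n. B * (1/2) ^ Suc n)"
      by (rule suminf_le[OF d[OF x] abs sums_summable[OF geo]])
    also have "\<dots> = B" using geo by (rule sums_unique[symmetric])
    finally show "\<bar>h x - w x\<bar> \<le> B" by (simp add: h_def)
  qed
qed

text \<open>The definite description has to be justified. Existence is Tate's limit; for uniqueness,
  the difference of two candidates is bounded along the orbit but doubles at every step.\<close>

lemma canonical_height_spec:
  assumes c: "algebraic_int c"
  shows "algebraic x \<Longrightarrow> canonical_height [:c, 0, 1:] (qmap c x) = 2 * canonical_height [:c, 0, 1:] x"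
    and "\<exists>B. \<forall>x. algebraic x \<longrightarrow> \<bar>canonical_height [:c, 0, 1:] x - weil_height x\<bar> \<le> B"
proof -
  have ac: "algebraic c" using c by auto
  define A :: "complex set" where "A = {x. algebraic x}"
  define E where "E h \<longleftrightarrow> (\<forall>x. algebraic x \<longrightarrow> h (qmap c x) = 2 * h x)" for h :: "complex \<Rightarrow> real"
  define W where "W h \<longleftrightarrow> (\<exists>B. \<forall>x. algebraic x \<longrightarrow> \<bar>h x - weil_height x\<bar> \<le> B)" for h
  have deg: "real (degree [:c, 0, 1:]) = 2" by simp
  have canon: "canonical_height [:c, 0, 1:] = (THE h. h \<in> A \<rightarrow>\<^sub>E {0..} \<and> E h \<and> W h)"
    unfolding canonical_height_def deg poly_qmap A_def E_def W_def by (rule refl)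
  have qA: "qmap c x \<in> A" if "x \<in> A" for x
    using that qmap_algebraic[OF ac] by (simp add: A_def)
  obtain B where B: "\<And>x. algebraic x \<Longrightarrow> \<bar>weil_height (x ^ 2 + c) - 2 * weil_height x\<bar> \<le> B"
    using weil_height_quadratic[OF c] by blast
  have B': "\<bar>weil_height (qmap c x) - 2 * weil_height x\<bar> \<le> B" if "x \<in> A" for x
    using B that by (simp add: qmap_def A_def)
  have pos: "weil_height x \<ge> 0" if "x \<in> A" for x
    using that weil_height_nonneg by (simp add: A_def)
  obtain h0 where h0: "\<And>x. x \<in> A \<Longrightarrow> h0 (qmap c x) = 2 * h0 x"
    "\<And>x. x \<in> A \<Longrightarrow> h0 x \<ge> 0" "\<And>x. x \<in> A \<Longrightarrow> \<bar>h0 x - weil_height x\<bar> \<le> B"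
    by (rule geometric_conjugacy_limit[of A "qmap c" weil_height B]) (use qA B' pos in blast)+
  have "restrict h0 A \<in> A \<rightarrow>\<^sub>E {0..}" using h0(2) by auto
  moreover have "E (restrict h0 A)"
    unfolding E_def using h0(1) qA by (simp add: A_def)
  moreover have "W (restrict h0 A)"
    unfolding W_def using h0(3) by (intro exI[of _ B]) (simp add: A_def)
  ultimately have ex: "restrict h0 A \<in> A \<rightarrow>\<^sub>E {0..} \<and> E (restrict h0 A) \<and> W (restrict h0 A)" by blast
  have eq: "h1 x = h2 x" if "E h1" "W h1" "E h2" "W h2" "x \<in> A" for h1 h2 x
  proof -
    have x: "algebraic x" using \<open>x \<in> A\<close> by (simp add: A_def)
    obtain B1 where B1: "\<And>x. algebraic x \<Longrightarrow> \<bar>h1 x - weil_height x\<bar> \<le> B1"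
      using \<open>W h1\<close> unfolding W_def by blast
    obtain B2 where B2: "\<And>x. algebraic x \<Longrightarrow> \<bar>h2 x - weil_height x\<bar> \<le> B2"
      using \<open>W h2\<close> unfolding W_def by blast
    have a: "algebraic ((qmap c ^^ n) x)" for n using ac x by (rule qmap_iter_algebraic)
    have it: "h ((qmap c ^^ n) x) = 2 ^ n * h x" if "E h" for h n
    proof (induction n)
      case (Suc n)
      have "h (qmap c ((qmap c ^^ n) x)) = 2 * h ((qmap c ^^ n) x)"
        using \<open>E h\<close> a unfolding E_def by blast
      with Suc show ?case by simp
    qed simp
    have bound: "2 ^ n * \<bar>h1 x - h2 x\<bar> \<le> B1 + B2" for n
    proof -
      have "2 ^ n * \<bar>h1 x - h2 x\<bar> = \<bar>2 ^ n * h1 x - 2 ^ n * h2 x\<bar>"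
        by (simp add: abs_mult flip: right_diff_distrib)
      also have "\<dots> \<le> B1 + B2"
        using B1[OF a, of n] B2[OF a, of n] it[OF \<open>E h1\<close>, of n] it[OF \<open>E h2\<close>, of n] by linarith
      finally show ?thesis .
    qed
    show "h1 x = h2 x"
    proof (rule ccontr)
      assume "h1 x \<noteq> h2 x"
      then have p: "\<bar>h1 x - h2 x\<bar> > 0" by simp
      obtain n where "(B1 + B2) / \<bar>h1 x - h2 x\<bar> < 2 ^ n"
        using real_arch_pow[of 2 "(B1 + B2) / \<bar>h1 x - h2 x\<bar>"] by auto
      with p bound[of n] show False by (simp add: field_simps)
    qed
  qed
  have "h = restrict h0 A" if "h \<in> A \<rightarrow>\<^sub>E {0..} \<and> E h \<and> W h" for h
  proof (rule PiE_ext)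
    show "h \<in> A \<rightarrow>\<^sub>E {0..}" "restrict h0 A \<in> A \<rightarrow>\<^sub>E {0..}" using that ex by blast+
    show "h x = restrict h0 A x" if "x \<in> A" for x
      using eq[of h "restrict h0 A" x] \<open>h \<in> A \<rightarrow>\<^sub>E {0..} \<and> E h \<and> W h\<close> ex that by blast
  qed
  then have "canonical_height [:c, 0, 1:] = restrict h0 A"
    unfolding canon using ex by (intro the_equality)
  with ex show "algebraic x \<Longrightarrow> canonical_height [:c, 0, 1:] (qmap c x) = 2 * canonical_height [:c, 0, 1:] x"
    "\<exists>B. \<forall>x. algebraic x \<longrightarrow> \<bar>canonical_height [:c, 0, 1:] x - weil_height x\<bar> \<le> B"
    unfolding E_def W_def by simp_all
qed

section \<open>A lower approximation to the canonical height\<close>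

text \<open>If \<open>\<bar>c\<bar> \<le> r\<^sup>2 - r\<close>, the filled Julia set of \<open>z\<^sup>2 + c\<close> lies in the disc of radius \<open>r\<close>, and
  \<open>ln_excess r\<close> is a lower bound for the Green function.\<close>

definition ln_excess :: "real \<Rightarrow> complex \<Rightarrow> real" where
  "ln_excess r y = ln (max 1 (cmod y / r))"

lemma ln_excess_nonneg: "ln_excess r y \<ge> 0"
  by (simp add: ln_excess_def)

lemma ln_excess_le_ln_plus: "r \<ge> 1 \<Longrightarrow> ln_excess r y \<le> ln_plus y"
proof -
  assume "r \<ge> 1"
  then have "cmod y / r \<le> cmod y / 1" by (intro divide_left_mono) auto
  then show ?thesis unfolding ln_excess_def ln_plus_def by (intro ln_mono) auto
qed

lemma ln_excess_qmap:
  assumes r: "r \<ge> 1" and c: "cmod c \<le> r ^ 2 - r"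
  shows "2 * ln_excess r y \<le> ln_excess r (qmap c y)"
proof -
  define t where "t = max 1 (cmod y / r)"
  have t: "t \<ge> 1" by (simp add: t_def)
  have "t ^ 2 \<le> max 1 (cmod (qmap c y) / r)"
  proof (cases "cmod y \<le> r")
    case True
    then have "t = 1" using r by (simp add: t_def)
    then show ?thesis by simp
  next
    case False
    then have y: "cmod y = t * r" using r by (simp add: t_def field_simps max_def)
    \<comment> \<open>For a point of absolute value \<open>t * r\<close> the image has at least
      \<open>(t * r) ^ 2 - (r ^ 2 - r)\<close>, and this product is exactly its excess over the
      required \<open>t ^ 2 * r\<close>.\<close>
    have "0 \<le> r * ((r - 1) * (t ^ 2 - 1))" using r t by (intro mult_nonneg_nonneg) auto
    also have "\<dots> = (t * r) ^ 2 - (r ^ 2 - r) - t ^ 2 * r" by (simp add: power2_eq_square algebra_simps)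
    finally have "t ^ 2 * r \<le> (t * r) ^ 2 - (r ^ 2 - r)" by simp
    also have "\<dots> \<le> cmod y ^ 2 - cmod c" using c by (simp add: y)
    also have "\<dots> \<le> cmod (qmap c y)"
      unfolding qmap_def using norm_diff_ineq[of "y ^ 2" c] by (simp add: norm_power)
    finally have "t ^ 2 \<le> cmod (qmap c y) / r" using r by (simp add: field_simps)
    then show ?thesis by simp
  qed
  then have "ln (t ^ 2) \<le> ln_excess r (qmap c y)"
    unfolding ln_excess_def using t by (intro ln_mono) auto
  then show ?thesis using t by (simp add: ln_realpow ln_excess_def t_def)
qed

lemma cmod_diff_le_ln_excess:
  assumes r: "r \<ge> 1" and "u \<noteq> v"
  shows "ln (cmod (u - v)) \<le> ln (2 * r) + ln_excess r u + ln_excess r v"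
proof -
  define s t where "s = max 1 (cmod u / r)" and "t = max 1 (cmod v / r)"
  have st: "s \<ge> 1" "t \<ge> 1" by (simp_all add: s_def t_def)
  have "cmod u \<le> r * s" "cmod v \<le> r * t" using r by (simp_all add: s_def t_def field_simps max_def)
  moreover have "s \<le> s * t" "t \<le> s * t" using st by simp_all
  then have "r * s \<le> r * (s * t)" "r * t \<le> r * (s * t)" using r by (auto intro: mult_left_mono)
  ultimately have "cmod (u - v) \<le> 2 * r * (s * t)" using norm_triangle_ineq4[of u v] by simp
  then have "ln (cmod (u - v)) \<le> ln (2 * r * (s * t))"
    using assms(2) by (intro ln_mono) auto
  also have "\<dots> = ln (2 * r) + (ln s + ln t)" using r st by (simp add: ln_mult_pos)
  finally show ?thesis by (simp add: ln_excess_def s_def t_def)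
qed

text \<open>A conjugate of \<open>qmap c x\<close> involves a conjugate of \<open>x\<close> together
  with one of \<open>c\<close>; the pairing is kept by summing over the embeddings of the field of
  both.\<close>

lemma sum_ln_excess_qmap:
  assumes r: "r \<ge> 1" and c: "algebraic c" "\<And>c'. c' \<in> conjugates c \<Longrightarrow> cmod c' \<le> r ^ 2 - r" and x: "algebraic x"
  shows "2 * conj_avg (ln_excess r) x \<le> conj_avg (ln_excess r) (qmap c x)"
proof -
  let ?S = "{x, c}"
  let ?E = "embeddings ?S"
  have S: "\<And>s. s \<in> ?S \<Longrightarrow> algebraic s" "finite ?S" using x c by auto
  have mem: "x \<in> field_adjoin ?S" "c \<in> field_adjoin ?S" by (auto intro: field_adjoin_incl)
  have y: "qmap c x \<in> field_adjoin ?S" using qmap_iter_field_adjoin[OF mem(2,1), of 1] by simp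
  have "2 * (\<Sum>\<phi>\<in>?E. ln_excess r (\<phi> x)) = (\<Sum>\<phi>\<in>?E. 2 * ln_excess r (\<phi> x))"
    by (rule sum_distrib_left)
  also have "\<dots> \<le> (\<Sum>\<phi>\<in>?E. ln_excess r (\<phi> (qmap c x)))"
  proof (rule sum_mono)
    fix \<phi> assume "\<phi> \<in> ?E"
    then obtain g where g: "alg_hom g" "\<phi> = restrict g (field_adjoin ?S)" by (rule embeddingsE)
    have "\<phi> (qmap c x) = qmap (\<phi> c) (\<phi> x)"
      using g(2) mem y ah_qmap[OF g(1) c(1) x, of 1] by simp
    moreover have "cmod (\<phi> c) \<le> r ^ 2 - r"
      using g(2) mem(2) c(2) alg_hom_conjugates[OF g(1) c(1)] by simp
    ultimately show "2 * ln_excess r (\<phi> x) \<le> ln_excess r (\<phi> (qmap c x))"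
      using ln_excess_qmap[OF r] by simp
  qed
  finally have "2 * (card ?E * conj_avg (ln_excess r) x) \<le> card ?E * conj_avg (ln_excess r) (qmap c x)"
    by (simp only: sum_embeddings(1)[OF S mem(1), of "ln_excess r", simplified]
        sum_embeddings(1)[OF S y, of "ln_excess r", simplified])
  moreover have "real (card ?E) > 0" using card_embeddings_pos[OF S] by simp
  ultimately show ?thesis by simp
qed

text \<open>Along the orbit the average at least doubles while staying below the Weil height, which
  equals the exactly doubling canonical height up to a constant; the constant disappears in the
  limit.\<close>

lemma canonical_height_ge:
  assumes r: "r \<ge> 1" and c: "algebraic_int c" "\<And>c'. c' \<in> conjugates c \<Longrightarrow> cmod c' \<le> r ^ 2 - r"
    and x: "algebraic x"
  shows "conj_avg (ln_excess r) ((qmap c ^^ N) x) / 2 ^ N \<le> canonical_height [:c, 0, 1:] x"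
proof -
  have ac: "algebraic c" using c by auto
  let ?h = "canonical_height [:c, 0, 1:]" and ?M = "conj_avg (ln_excess r)"
  define y where "y = (qmap c ^^ N) x"
  have it: "algebraic ((qmap c ^^ n) z)" if "algebraic z" for n z using ac that by (rule qmap_iter_algebraic)
  have y: "algebraic y" unfolding y_def using it[OF x] .
  obtain B where B: "\<And>x. algebraic x \<Longrightarrow> \<bar>?h x - weil_height x\<bar> \<le> B"
    using canonical_height_spec(2)[OF c(1)] by blast
  have h: "?h ((qmap c ^^ n) z) = 2 ^ n * ?h z" if "algebraic z" for n z
  proof (induction n)
    case (Suc n)
    then show ?case
      unfolding funpow.simps o_apply canonical_height_spec(1)[OF c(1) it[OF that]] by simp
  qed simp
  have M: "2 ^ n * ?M y \<le> ?M ((qmap c ^^ n) y)" for n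
  proof (induction n)
    case (Suc n)
    have "2 * ?M ((qmap c ^^ n) y) \<le> ?M ((qmap c ^^ Suc n) y)"
      using sum_ln_excess_qmap[OF r ac c(2) it[OF y]] by simp
    with Suc show ?case by simp
  qed simp
  have "2 ^ n * (?M y - ?h y) \<le> B" for n
  proof -
    have "2 ^ n * ?M y \<le> ?M ((qmap c ^^ n) y)" by (rule M)
    also have "\<dots> \<le> conj_avg ln_plus ((qmap c ^^ n) y)"
      using ln_excess_le_ln_plus[OF r] by (rule conj_avg_mono)
    also have "\<dots> \<le> weil_height ((qmap c ^^ n) y)" by (rule weil_height_ge_conj_avg[OF it[OF y]])
    also have "\<dots> \<le> 2 ^ n * ?h y + B" using B[OF it[OF y], of n] h[OF y, of n] by linarith
    finally show ?thesis by (simp add: right_diff_distrib)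
  qed
  have "?M y \<le> ?h y"
  proof (rule ccontr)
    assume "\<not> ?M y \<le> ?h y"
    then have p: "?M y - ?h y > 0" by simp
    obtain n where "B / (?M y - ?h y) < 2 ^ n"
      using real_arch_pow[of 2 "B / (?M y - ?h y)"] by auto
    with p \<open>2 ^ n * (?M y - ?h y) \<le> B\<close> show False by (simp add: field_simps)
  qed
  then show ?thesis using h[OF x, of N] by (simp add: y_def field_simps)
qed

section \<open>Congruences at the prime 2\<close>

definition ring_cong :: "complex set \<Rightarrow> complex \<Rightarrow> complex \<Rightarrow> complex \<Rightarrow> bool" where
  "ring_cong S p x y \<longleftrightarrow> (\<exists>z\<in>int_adjoin S. x - y = p * z)"

lemma ring_congI: "z \<in> int_adjoin S \<Longrightarrow> x - y = p * z \<Longrightarrow> ring_cong S p x y"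
  unfolding ring_cong_def by blast

lemma ring_cong_refl: "ring_cong S p x x"
  by (rule ring_congI[of 0]) simp_all

lemma ring_cong_sym:
  assumes "ring_cong S p x y"
  shows "ring_cong S p y x"
proof -
  obtain z where "z \<in> int_adjoin S" "x - y = p * z" using assms unfolding ring_cong_def by blast
  then show ?thesis by (intro ring_congI[of "- z"]) (auto simp: algebra_simps intro: int_adjoin.uminus)
qed

lemma ring_cong_trans:
  assumes "ring_cong S p x y" "ring_cong S p y z"
  shows "ring_cong S p x z"
proof -
  obtain u v where "u \<in> int_adjoin S" "x - y = p * u" "v \<in> int_adjoin S" "y - z = p * v"
    using assms unfolding ring_cong_def by blast
  then show ?thesis by (intro ring_congI[of "u + v"]) (auto simp: algebra_simps intro: int_adjoin.add)
qed

lemma ring_cong_add: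
  assumes "ring_cong S p x y" "ring_cong S p x' y'"
  shows "ring_cong S p (x + x') (y + y')"
proof -
  obtain u v where "u \<in> int_adjoin S" "x - y = p * u" "v \<in> int_adjoin S" "x' - y' = p * v"
    using assms unfolding ring_cong_def by blast
  then show ?thesis by (intro ring_congI[of "u + v"]) (auto simp: algebra_simps intro: int_adjoin.add)
qed

lemma ring_cong_mult:
  assumes "ring_cong S p x y" "ring_cong S p x' y'" "x' \<in> int_adjoin S" "y \<in> int_adjoin S"
  shows "ring_cong S p (x * x') (y * y')"
proof -
  obtain u v where uv: "u \<in> int_adjoin S" "x - y = p * u" "v \<in> int_adjoin S" "x' - y' = p * v"
    using assms(1,2) unfolding ring_cong_def by blast
  have "x * x' - y * y' = (x - y) * x' + y * (x' - y')" by (simp add: algebra_simps)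
  also have "\<dots> = p * (u * x' + y * v)" by (simp add: uv algebra_simps)
  finally show ?thesis using uv assms(3,4)
    by (intro ring_congI[of "u * x' + y * v"] int_adjoin.add int_adjoin.mult)
qed

lemma ring_cong_power:
  assumes "ring_cong S p x y" "x \<in> int_adjoin S" "y \<in> int_adjoin S"
  shows "ring_cong S p (x ^ k) (y ^ k)"
proof (induction k)
  case (Suc k)
  then show ?case
    unfolding power_Suc using assms by (intro ring_cong_mult int_adjoin_power)
qed (simp add: ring_cong_refl)

lemma ring_cong_weaken:
  assumes "ring_cong S p x y" "p = q * w" "w \<in> int_adjoin S"
  shows "ring_cong S q x y"
proof -
  obtain z where z: "z \<in> int_adjoin S" "x - y = p * z" using assms(1) unfolding ring_cong_def by blast
  show ?thesis
    by (rule ring_congI[of "w * z"]) (use z assms in \<open>auto intro: int_adjoin.mult\<close>)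
qed

lemma ring_cong_2_add_power:
  assumes "x \<in> int_adjoin S" "y \<in> int_adjoin S"
  shows "ring_cong S 2 ((x + y) ^ (2 ^ k)) (x ^ (2 ^ k) + y ^ (2 ^ k))"
proof (induction k)
  case (Suc k)
  have pow: "a ^ (2 ^ Suc k) = (a ^ (2 ^ k)) ^ 2" for a :: complex
    by (simp add: power_mult[symmetric] mult.commute)
  have "ring_cong S 2 (((x + y) ^ (2 ^ k)) ^ 2) ((x ^ (2 ^ k) + y ^ (2 ^ k)) ^ 2)"
    using Suc assms by (intro ring_cong_power int_adjoin_power int_adjoin.add)
  moreover have "ring_cong S 2 ((x ^ (2 ^ k) + y ^ (2 ^ k)) ^ 2) ((x ^ (2 ^ k)) ^ 2 + (y ^ (2 ^ k)) ^ 2)"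
  proof (rule ring_congI)
    show "x ^ (2 ^ k) * y ^ (2 ^ k) \<in> int_adjoin S" using assms by (intro int_adjoin.mult int_adjoin_power)
    show "(x ^ (2 ^ k) + y ^ (2 ^ k)) ^ 2 - ((x ^ (2 ^ k)) ^ 2 + (y ^ (2 ^ k)) ^ 2)
        = 2 * (x ^ (2 ^ k) * y ^ (2 ^ k))"
      by (simp add: power2_sum)
  qed
  ultimately show ?case unfolding pow by (rule ring_cong_trans)
qed (simp add: ring_cong_refl)

lemma ring_cong_add_power:
  assumes "x \<in> int_adjoin S" "y \<in> int_adjoin S" and p: "2 = p * w" "w \<in> int_adjoin S"
  shows "ring_cong S p ((x + y) ^ (2 ^ k)) (x ^ (2 ^ k) + y ^ (2 ^ k))"
  using ring_cong_weaken[OF ring_cong_2_add_power[OF assms(1,2)] p] .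

lemma ring_cong_uminus:
  assumes "x \<in> int_adjoin S" and p: "2 = p * w" "w \<in> int_adjoin S"
  shows "ring_cong S p (- x) x"
proof (rule ring_congI)
  have "- x - x = - (2 * x)" by simp
  also have "\<dots> = p * (- (w * x))" unfolding p(1) by (simp add: mult.assoc)
  finally show "- x - x = p * (- (w * x))" .
  show "- (w * x) \<in> int_adjoin S" using assms by (intro int_adjoin.uminus int_adjoin.mult)
qed

text \<open>As \<open>p\<close> divides 2, raising to the power \<open>2 ^ k\<close> is additive
  modulo \<open>p\<close>, so its fixed elements form a ring and only generators have to be
  checked.\<close>

lemma ring_cong_frobenius:
  assumes p: "2 = p * w" "w \<in> int_adjoin S" and k: "k \<ge> 1"
    and gen: "\<And>s. s \<in> T \<Longrightarrow> ring_cong S p (s ^ (2 ^ k)) s" and T: "int_adjoin T \<subseteq> int_adjoin S"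
    and x: "x \<in> int_adjoin T"
  shows "ring_cong S p (x ^ (2 ^ k)) x"
  using x
proof induction
  case one
  then show ?case by (simp add: ring_cong_refl)
next
  case (incl x)
  then show ?case by (rule gen)
next
  case (uminus x)
  have "even ((2::nat) ^ k)" using k by simp
  then have "(- x) ^ (2 ^ k) = x ^ (2 ^ k)" by (rule power_minus_even)
  moreover have "ring_cong S p x (- x)"
    using uminus.hyps T p by (intro ring_cong_sym[OF ring_cong_uminus]) auto
  ultimately show ?case using uminus.IH ring_cong_trans by metis
next
  case (add x y)
  have "ring_cong S p ((x + y) ^ (2 ^ k)) (x ^ (2 ^ k) + y ^ (2 ^ k))"
    using add.hyps T p by (intro ring_cong_add_power) auto
  then show ?case using ring_cong_add[OF add.IH] ring_cong_trans by blast
next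
  case (mult x y)
  have "ring_cong S p (x ^ (2 ^ k) * y ^ (2 ^ k)) (x * y)"
    using mult.hyps T by (intro ring_cong_mult mult.IH int_adjoin_power) auto
  then show ?case by (simp only: power_mult_distrib)
qed

lemma ring_cong_frobenius_iterate:
  assumes "ring_cong S p (x ^ q) x" "x \<in> int_adjoin S"
  shows "ring_cong S p (x ^ (q ^ j)) x"
proof (induction j)
  case (Suc j)
  have "ring_cong S p ((x ^ (q ^ j)) ^ q) (x ^ q)"
    using Suc assms(2) by (intro ring_cong_power int_adjoin_power)
  then have "ring_cong S p (x ^ (q ^ Suc j)) (x ^ q)" by (simp add: power_mult[symmetric] mult.commute)
  then show ?case using assms(1) by (rule ring_cong_trans)
qed (simp add: ring_cong_refl)

lemma ring_cong_poly_frobenius: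
  assumes p: "2 = p * w" "w \<in> int_adjoin S" and y: "y \<in> int_adjoin S"
    and u: "\<And>i. coeff u i \<in> int_adjoin S \<and> ring_cong S p (coeff u i ^ (2 ^ k)) (coeff u i)"
  shows "ring_cong S p (poly u y ^ (2 ^ k)) (poly u (y ^ (2 ^ k)))"
  using u
proof (induction u)
  case 0
  show ?case by (simp add: ring_cong_refl power_0_left)
next
  case (pCons a u)
  have a: "a \<in> int_adjoin S" "ring_cong S p (a ^ (2 ^ k)) a" using pCons.prems[of 0] by simp_all
  have u: "coeff u i \<in> int_adjoin S \<and> ring_cong S p (coeff u i ^ (2 ^ k)) (coeff u i)" for i
    using pCons.prems[of "Suc i"] by simp
  have pu: "poly u y \<in> int_adjoin S" "poly u (y ^ (2 ^ k)) \<in> int_adjoin S"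
    using u y by (auto intro!: int_adjoin_poly int_adjoin_power)
  have "ring_cong S p ((a + y * poly u y) ^ (2 ^ k)) (a ^ (2 ^ k) + (y * poly u y) ^ (2 ^ k))"
    using a y pu by (intro ring_cong_add_power[OF _ _ p] int_adjoin.mult)
  moreover have "ring_cong S p (y ^ (2 ^ k) * poly u y ^ (2 ^ k)) (y ^ (2 ^ k) * poly u (y ^ (2 ^ k)))"
    using y pu by (intro ring_cong_mult[OF ring_cong_refl pCons.IH[OF u]] int_adjoin_power)
  then have "ring_cong S p (a ^ (2 ^ k) + (y * poly u y) ^ (2 ^ k)) (a + y ^ (2 ^ k) * poly u (y ^ (2 ^ k)))"
    unfolding power_mult_distrib by (rule ring_cong_add[OF a(2)])
  ultimately show ?case unfolding poly_pCons by (rule ring_cong_trans)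
qed

text \<open>An integral \<open>\<beta>\<close> of degree \<open>N\<close> with \<open>p \<beta> = x\<close> in \<open>R = int_adjoin S\<close> satisfies \<open>x ^ N \<in> p R\<close>;
  if some iterate of the Frobenius is the identity on \<open>R / p R\<close>, then \<open>x \<in> p R\<close> and \<open>\<beta> \<in> R\<close>.\<close>

lemma int_adjoin_divide:
  assumes p: "p \<in> int_adjoin S" "p \<noteq> 0" and k: "k \<ge> 1"
    and frob: "\<And>x. x \<in> int_adjoin S \<Longrightarrow> ring_cong S p (x ^ (2 ^ k)) x"
    and b: "algebraic_int b" "p * b \<in> int_adjoin S"
  shows "b \<in> int_adjoin S"
proof -
  define x where "x = p * b"
  have x: "x \<in> int_adjoin S" using b by (simp add: x_def)
  obtain P where P: "ipoly P b = 0" "lead_coeff P = 1" using b(1) algebraic_int_altdef_ipoly by blast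
  define N where "N = degree P"
  have "0 = (\<Sum>i\<le>N. of_int (coeff P i) * b ^ i)" using P(1) by (simp add: poly_altdef N_def)
  also have "\<dots> = (\<Sum>i<N. of_int (coeff P i) * b ^ i) + b ^ N"
    using P(2) by (simp add: N_def lessThan_Suc_atMost[symmetric])
  finally have bN: "b ^ N = - (\<Sum>i<N. of_int (coeff P i) * b ^ i)"
    by (simp add: eq_neg_iff_add_eq_0 add.commute)
  have "x ^ N = p ^ N * b ^ N" by (simp add: x_def power_mult_distrib)
  also have "\<dots> = - (\<Sum>i<N. p ^ N * (of_int (coeff P i) * b ^ i))"
    by (simp add: bN sum_distrib_left)
  also have "(\<Sum>i<N. p ^ N * (of_int (coeff P i) * b ^ i))
      = (\<Sum>i<N. p * (of_int (coeff P i) * (p ^ (N - 1 - i) * x ^ i)))"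
  proof (rule sum.cong)
    fix i assume i: "i \<in> {..<N}"
    then have "p ^ N = p ^ Suc (N - 1 - i + i)" by simp
    also have "\<dots> = p * p ^ (N - 1 - i) * p ^ i" by (simp only: power_Suc power_add mult.assoc)
    finally show "p ^ N * (of_int (coeff P i) * b ^ i) = p * (of_int (coeff P i) * (p ^ (N - 1 - i) * x ^ i))"
      by (simp add: x_def power_mult_distrib)
  qed simp
  finally have xN: "x ^ N = p * (- (\<Sum>i<N. of_int (coeff P i) * (p ^ (N - 1 - i) * x ^ i)))"
    by (simp add: sum_distrib_left)
  have "(\<Sum>i<N. of_int (coeff P i) * (p ^ (N - 1 - i) * x ^ i)) \<in> int_adjoin S"
    using p x by (intro int_adjoin_sum int_adjoin.mult[OF int_adjoin_of_int] int_adjoin.mult[OF int_adjoin_power int_adjoin_power])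
  then obtain v where v: "x ^ N = p * v" "v \<in> int_adjoin S" using xN int_adjoin.uminus by blast
  have "N \<le> 2 ^ N" by (rule less_imp_le[OF less_exp])
  also have "(2::nat) \<le> 2 ^ k" using k self_le_power[of 2 k] by simp
  then have "(2::nat) ^ N \<le> (2 ^ k) ^ N" by (rule power_mono) simp
  finally have "x ^ ((2 ^ k) ^ N) = x ^ N * x ^ ((2 ^ k) ^ N - N)"
    by (simp only: power_add[symmetric] le_add_diff_inverse)
  then have "x ^ ((2 ^ k) ^ N) - 0 = p * (v * x ^ ((2 ^ k) ^ N - N))" by (simp add: v)
  then have "ring_cong S p (x ^ ((2 ^ k) ^ N)) 0"
    by (rule ring_congI[rotated]) (intro int_adjoin.mult v int_adjoin_power x)
  moreover have "ring_cong S p (x ^ ((2 ^ k) ^ N)) x" by (rule ring_cong_frobenius_iterate[OF frob[OF x] x])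
  ultimately have "ring_cong S p x 0" using ring_cong_sym ring_cong_trans by blast
  then obtain z where "z \<in> int_adjoin S" "x = p * z" unfolding ring_cong_def by auto
  with p(2) show ?thesis by (simp add: x_def)
qed

text \<open>The substitute for integral closedness at 2: a factor 2 in the denominator of an
  algebraic integer of the field can be removed through \<open>int_adjoin_divide\<close>, and this
  repeats until the denominator is odd.\<close>

lemma integral_odd_multiple:
  assumes p: "p \<in> int_adjoin S" "p \<noteq> 0" "p ^ e = 2 * w" "w \<in> int_adjoin S" and k: "k \<ge> 1"
    and frob: "\<And>x. x \<in> int_adjoin S \<Longrightarrow> ring_cong S p (x ^ (2 ^ k)) x"
    and S: "\<And>s. s \<in> S \<Longrightarrow> algebraic_int s"
    and a: "algebraic_int a" "a \<in> field_adjoin S"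
  obtains s :: int where "odd s" "of_int s * a \<in> int_adjoin S"
proof -
  have halve: "b \<in> int_adjoin S" if b: "algebraic_int b" "2 * b \<in> int_adjoin S" for b
  proof -
    have pa: "algebraic_int p" using p(1) S by (rule int_adjoin_algebraic_int)
    \<comment> \<open>Descends from \<open>p ^ e * b\<close>, a multiple of \<open>2 * b\<close>, to
      \<open>b\<close>, removing one factor \<open>p\<close> at a time.\<close>
    have "p ^ j * b \<in> int_adjoin S" if "j \<le> e" for j
      using that
    proof (induction "e - j" arbitrary: j)
      case 0
      then have "p ^ j * b = w * (2 * b)" using p(3) by simp
      then show ?case using p(4) b(2) by (simp only: int_adjoin.mult)
    next
      case (Suc i)
      then have "i = e - Suc j" "Suc j \<le> e" by simp_all
      then have "p ^ Suc j * b \<in> int_adjoin S" by (rule Suc.hyps(1))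
      then have "p * (p ^ j * b) \<in> int_adjoin S" by (simp add: mult.assoc)
      moreover have "algebraic_int (p ^ j * b)" by (rule algebraic_int_mult[OF algebraic_int_power[OF pa] b(1)])
      ultimately show ?case using int_adjoin_divide[OF p(1,2) k frob] by blast
    qed
    from this[of 0] show ?thesis by simp
  qed
  have red: "\<exists>s::int. odd s \<and> of_int s * a \<in> int_adjoin S"
    if "k \<noteq> 0" "of_int k * a \<in> int_adjoin S" for k :: int
    using that
  proof (induction "nat \<bar>k\<bar>" arbitrary: k rule: less_induct)
    case (less k)
    show ?case
    proof (cases "odd k")
      case False
      then have "even k" by simp
      then obtain l where l: "k = 2 * l" by (rule evenE)
      have "2 * (of_int l * a) \<in> int_adjoin S" using less.prems by (simp add: l mult.assoc)
      then have "of_int l * a \<in> int_adjoin S"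
        by (rule halve[OF algebraic_int_mult[OF algebraic_int_of_int a(1)]])
      moreover have "nat \<bar>l\<bar> < nat \<bar>k\<bar>" "l \<noteq> 0" using less.prems l by auto
      ultimately show ?thesis using less.hyps by blast
    qed (use less.prems in blast)
  qed
  obtain k :: int where "k \<noteq> 0" "of_int k * a \<in> int_adjoin S" using a(2) by (rule field_adjoinE)
  with red that show ?thesis by blast
qed

text \<open>An odd \<open>s\<close> is 1 modulo 2 and hence modulo \<open>p\<close>, so it can be
  cancelled from a congruence modulo \<open>p\<close>.\<close>

lemma algebraic_int_odd_divide:
  fixes d p :: complex
  assumes d: "algebraic_int d" and p: "2 = p * w" "algebraic_int w" and s: "odd (s :: int)"
    and z: "of_int s * d = p * z" "algebraic_int z"
  shows "algebraic_int (d / p)"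
proof -
  have p0: "p \<noteq> 0" using p(1) by auto
  obtain l where l: "s = 2 * l + 1" using s by (elim oddE)
  have "d = of_int s * d - of_int l * (2 * d)" by (simp add: l algebra_simps)
  also have "\<dots> = p * (z - of_int l * (w * d))" unfolding z(1) p(1) by (simp add: algebra_simps)
  finally have "d / p = z - of_int l * (w * d)" using p0 by (simp add: field_simps)
  then show ?thesis using z p d by (auto intro!: algebraic_int_diff algebraic_int_mult)
qed

text \<open>A power of \<open>p\<close> is a multiple of 2, so otherwise the rational number
  \<open>s ^ e / 2\<close> would be an algebraic integer.\<close>

lemma odd_not_multiple:
  fixes p :: complex
  assumes "odd (s :: int)" "of_int s = p * z" "algebraic_int z" "p ^ e = 2 * w" "algebraic_int w"
  shows False
proof -
  have "of_int (s ^ e) = (p * z) ^ e" using assms(2) by simp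
  also have "\<dots> = 2 * (w * z ^ e)" by (simp add: power_mult_distrib assms(4))
  finally have "of_int (s ^ e) / of_int 2 = w * z ^ e" by simp
  moreover have "algebraic_int (w * z ^ e)" using assms by (intro algebraic_int_mult algebraic_int_power)
  ultimately have "2 dvd s ^ e" using algebraic_int_of_int_over_int[of "s ^ e" 2] by simp
  with assms(1) show False by simp
qed

section \<open>The rings \<open>\<int>[c, \<zeta>]\<close>\<close>

definition xi :: "nat \<Rightarrow> complex" where
  "xi r = cis (2 * pi / 2 ^ r)"

definition eta :: "nat \<Rightarrow> complex" where
  "eta m = cis (2 * pi / real m)"

lemma xi_Suc_square: "xi (Suc r) ^ 2 = xi r"
  unfolding xi_def Complex.DeMoivre by simp

lemma xi_add_power: "xi (r + k) ^ (2 ^ k) = xi r"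
proof (induction k)
  case (Suc k)
  have "xi (r + Suc k) ^ (2 ^ Suc k) = (xi (Suc (r + k)) ^ 2) ^ (2 ^ k)"
    by (simp only: power_mult[symmetric] power_Suc add_Suc_right)
  then show ?case by (simp only: xi_Suc_square Suc)
qed simp

lemma xi_0: "xi 0 = 1" and xi_1: "xi 1 = - 1" and xi_2: "xi 2 = \<i>"
  by (simp_all add: xi_def complex_eq_iff)

lemma xi_power_half: "xi (Suc r) ^ (2 ^ r) = - 1"
  using xi_add_power[of 1 r] xi_1 by simp

lemma xi_power_full: "xi r ^ (2 ^ r) = 1"
  using xi_add_power[of 0 r] xi_0 by simp

lemma xi_nonzero: "xi r \<noteq> 0"
  by (simp add: xi_def)

lemma xi_neq_1: "xi (Suc r) \<noteq> 1"
proof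
  assume "xi (Suc r) = 1"
  with xi_power_half[of r] have "(1::complex) = - 1" by simp
  then show False by simp
qed

lemma eta_power: "m > 0 \<Longrightarrow> eta m ^ m = 1"
  by (simp add: eta_def Complex.DeMoivre)

lemma eta_1: "eta 1 = 1"
  by (simp add: eta_def)

text \<open>The field \<open>L\<^sub>k\<close> of the overview is
  \<open>field_adjoin (gens c k m)\<close> for odd \<open>m\<close>; \<open>m = 1\<close> gives the
  subfield without the odd root of unity.\<close>

definition gens :: "complex \<Rightarrow> nat \<Rightarrow> nat \<Rightarrow> complex set" where
  "gens c r m = {c, xi r, eta m}"

lemma gens_incl: "c \<in> int_adjoin (gens c r m)" "xi r \<in> int_adjoin (gens c r m)" "eta m \<in> int_adjoin (gens c r m)"
  by (auto simp: gens_def intro: int_adjoin.incl)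

lemma finite_gens: "finite (gens c r m)"
  by (simp add: gens_def)

lemma gens_mono:
  assumes "r \<le> r'"
  shows "int_adjoin (gens c r m) \<subseteq> int_adjoin (gens c r' m)"
proof (rule int_adjoin_least)
  have eq: "xi r = xi r' ^ (2 ^ (r' - r))" using xi_add_power[of r "r' - r"] assms by simp
  have "xi r \<in> int_adjoin (gens c r' m)" unfolding eq by (intro int_adjoin_power gens_incl)
  then show "gens c r m \<subseteq> int_adjoin (gens c r' m)"
    unfolding gens_def[of c r m] by (simp add: gens_incl)
qed

lemma gens_1_subset: "int_adjoin (gens c r 1) \<subseteq> int_adjoin (gens c r m)"
proof (rule int_adjoin_least)
  show "gens c r 1 \<subseteq> int_adjoin (gens c r m)"
    unfolding gens_def[of c r 1] eta_1 by (simp add: gens_incl)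
qed

lemma root_of_unity_in_gens:
  assumes m: "odd m" and n: "n dvd 2 ^ r * m"
  shows "cis (2 * pi / real n) \<in> int_adjoin (gens c r m)"
proof -
  let ?N = "2 ^ r * m"
  have m0: "m > 0" using m by (rule odd_pos)
  have "gcd (2 ^ r) m = 1" using m by (simp add: coprime_iff_gcd_eq_1[symmetric])
  then obtain u v where uv: "2 ^ r * u = m * v + 1"
    using bezout_nat[of "2 ^ r" m] by auto
  have "cis (2 * pi / real ?N) * xi r ^ v = cis (2 * pi / real ?N + real v * (2 * pi / 2 ^ r))"
    by (simp add: xi_def Complex.DeMoivre cis_mult)
  also have "2 * pi / real ?N + real v * (2 * pi / 2 ^ r) = 2 * pi * (1 + real (m * v)) / real ?N"
    using m0 by (simp add: field_simps)
  also have "1 + real (m * v) = real (2 ^ r * u)" by (simp only: uv)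
  also have "2 * pi * real (2 ^ r * u) / real ?N = real u * (2 * pi / real m)"
    using m0 by simp
  also have "cis \<dots> = eta m ^ u" by (simp add: eta_def Complex.DeMoivre)
  finally have eq: "cis (2 * pi / real ?N) * xi r ^ v = eta m ^ u" .
  obtain l where l: "2 ^ r = Suc l" by (cases "(2::nat) ^ r") auto
  have "xi r ^ v * xi r ^ (l * v) = (xi r ^ (2 ^ r)) ^ v"
    unfolding l power_mult[symmetric] by (simp add: power_add)
  then have "xi r ^ v * xi r ^ (l * v) = 1" by (simp only: xi_power_full power_one)
  then have "cis (2 * pi / real ?N) = eta m ^ u * xi r ^ (l * v)"
    unfolding eq[symmetric] by (simp only: mult.assoc mult_1_right)
  then have N: "cis (2 * pi / real ?N) \<in> int_adjoin (gens c r m)"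
    using int_adjoin.mult[OF int_adjoin_power[OF gens_incl(3)] int_adjoin_power[OF gens_incl(2)]] by (simp only:)
  obtain k where k: "?N = n * k" using n by (rule dvdE)
  have "cis (2 * pi / real n) = cis (2 * pi / real ?N) ^ k"
  proof -
    have "2 ^ r * m \<noteq> 0" using m0 by simp
    then have "n * k \<noteq> 0" unfolding k .
    then show ?thesis unfolding k Complex.DeMoivre by simp
  qed
  then show ?thesis using N by (simp add: int_adjoin_power)
qed

text \<open>Modulo 2 squaring is additive, so the critical orbit splits off as a translation. When 0
  has period \<open>n\<close>, the \<open>n\<close>-th iterate of the map becomes a pure Frobenius
  power.\<close>

lemma ring_cong_qmap:
  assumes "c \<in> int_adjoin S" "x \<in> int_adjoin S"
  shows "ring_cong S 2 ((qmap c ^^ j) x) (x ^ (2 ^ j) + (qmap c ^^ j) 0)"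
proof (induction j)
  case (Suc j)
  have it: "(qmap c ^^ i) y \<in> int_adjoin S" if "y \<in> int_adjoin S" for i y
  proof (induction i)
    case (Suc i)
    then show ?case unfolding funpow.simps o_apply qmap_def[of c "(qmap c ^^ i) y"]
      using assms(1) by (intro int_adjoin.add int_adjoin_power)
  qed (use that in simp)
  let ?a = "x ^ (2 ^ j)" and ?b = "(qmap c ^^ j) 0"
  have ab: "?a \<in> int_adjoin S" "?b \<in> int_adjoin S" using it assms by (auto intro: int_adjoin_power)
  have "ring_cong S 2 (((qmap c ^^ j) x) ^ 2) ((?a + ?b) ^ 2)"
    using Suc ab it assms by (intro ring_cong_power int_adjoin.add)
  moreover have "ring_cong S 2 ((?a + ?b) ^ 2) (?a ^ 2 + ?b ^ 2)"
    using ring_cong_2_add_power[OF ab, of 1] by simp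
  ultimately have "ring_cong S 2 (((qmap c ^^ j) x) ^ 2) (?a ^ 2 + ?b ^ 2)" by (rule ring_cong_trans)
  from ring_cong_add[OF this ring_cong_refl[of S 2 c]]
  have "ring_cong S 2 (((qmap c ^^ j) x) ^ 2 + c) (?a ^ 2 + (?b ^ 2 + c))" by (simp only: add.assoc)
  moreover have "x ^ (2 ^ Suc j) = ?a ^ 2" by (simp add: power_mult[symmetric] mult.commute)
  ultimately show ?case unfolding funpow.simps o_apply
    by (simp only: qmap_def[of c "(qmap c ^^ j) x"] qmap_def[of c "(qmap c ^^ j) 0"])
qed (simp add: ring_cong_refl)

section \<open>Arithmetic of a parameter with periodic critical point\<close>

locale periodic_quadratic =
  fixes c :: complex and n :: nat
  assumes n: "n \<ge> 1" and per: "(qmap c ^^ n) 0 = 0"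
begin

text \<open>Each iterate of 0 is a monic integer polynomial in the parameter: squaring doubles the
  degree and adding \<open>c\<close> does not affect the leading term.\<close>

lemma c_algebraic_int: "algebraic_int c"
proof -
  have "\<exists>p. ipoly p c = (qmap c ^^ Suc k) 0 \<and> lead_coeff p = 1 \<and> degree p > 0" for k
  proof (induction k)
    case 0
    show ?case by (intro exI[of _ "[:0, 1:]"]) (simp add: qmap_def of_int_hom.map_poly_pCons_hom)
  next
    case (Suc k)
    then obtain p where p: "ipoly p c = (qmap c ^^ Suc k) 0" "lead_coeff p = 1" "degree p > 0" by blast
    define q where "q = p ^ 2 + [:0, 1:]"
    have p0: "p \<noteq> 0" using p(3) by auto
    have d: "degree [:0, 1::int:] < degree (p ^ 2)" using p(3) p0 by (simp add: degree_power_eq)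
    have "ipoly q c = (qmap c ^^ Suc (Suc k)) 0"
      by (simp add: q_def ipoly_add power2_eq_square ipoly_mult p(1) qmap_def of_int_hom.map_poly_pCons_hom)
    moreover have "degree q = degree (p ^ 2)" unfolding q_def using d by (rule degree_add_eq_left)
    moreover have "lead_coeff q = lead_coeff (p ^ 2)"
      unfolding \<open>degree q = degree (p ^ 2)\<close> using coeff_eq_0[OF d] by (simp add: q_def)
    ultimately show ?case using p d by (intro exI[of _ q]) (simp add: lead_coeff_power)
  qed
  moreover have "Suc (n - 1) = n" using n by simp
  ultimately obtain p where "ipoly p c = (qmap c ^^ n) 0" "lead_coeff p = 1" by metis
  then show ?thesis unfolding algebraic_int_altdef_ipoly per by blast
qed

lemma c_algebraic: "algebraic c"
  using c_algebraic_int by auto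

text \<open>Every positive iterate of 0 has the form \<open>c * (1 + c * t)\<close> with
  \<open>t\<close> in the ring generated by \<open>c\<close>; cancelling \<open>c\<close> from the
  periodicity equation exhibits its inverse.\<close>

lemma c_unit:
  assumes "c \<noteq> 0"
  obtains d where "algebraic_int d" "c * d = 1"
proof -
  have "\<exists>t\<in>int_adjoin {c}. (qmap c ^^ Suc k) 0 = c * (1 + c * t)" for k
  proof (induction k)
    case 0
    show ?case by (intro bexI[of _ 0]) (simp_all add: qmap_def)
  next
    case (Suc k)
    then obtain t where t: "t \<in> int_adjoin {c}" "(qmap c ^^ Suc k) 0 = c * (1 + c * t)" by blast
    have "(qmap c ^^ Suc (Suc k)) 0 = c * (1 + c * (1 + c * t) ^ 2)"
      unfolding funpow.simps(2)[of "Suc k"] o_apply t(2) by (simp add: qmap_def power2_eq_square algebra_simps)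
    moreover have "(1 + c * t) ^ 2 \<in> int_adjoin {c}"
      using t(1) by (intro int_adjoin_power int_adjoin.add int_adjoin.one int_adjoin.mult int_adjoin.incl[of c]) simp_all
    ultimately show ?case by blast
  qed
  moreover have "Suc (n - 1) = n" using n by simp
  ultimately obtain t where t: "t \<in> int_adjoin {c}" "c * (1 + c * t) = 0" using per by metis
  have "algebraic_int t" using t(1) by (rule int_adjoin_algebraic_int) (use c_algebraic_int in simp)
  moreover have "c * t = - 1" using t(2) assms by (simp add: eq_neg_iff_add_eq_0 add.commute)
  ultimately show ?thesis by (intro that[of "- t"]) simp_all
qed

text \<open>\<open>c\<close> is the image of 0 and so lies on the same cycle; the
  \<open>n\<close>-th iterate fixes it and is congruent to its power. That the congruence holds
  modulo 2 itself reflects that 2 is unramified in the field of \<open>c\<close>.\<close>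

lemma c_frobenius:
  assumes "c \<in> int_adjoin S"
  shows "ring_cong S 2 (c ^ (2 ^ n)) c"
proof -
  have "(qmap c ^^ n) c = (qmap c ^^ n) (qmap c 0)" by (simp add: qmap_def)
  also have "\<dots> = qmap c ((qmap c ^^ n) 0)" by (simp only: funpow_swap1)
  also have "\<dots> = c" by (simp add: per qmap_def)
  finally show ?thesis using ring_cong_sym[OF ring_cong_qmap[OF assms assms, of n]] per by simp
qed

lemma gens_algebraic_int: "m > 0 \<Longrightarrow> s \<in> gens c r m \<Longrightarrow> algebraic_int s"
  using algebraic_int_root_of_unity[OF xi_power_full[of r]] algebraic_int_root_of_unity[OF eta_power[of m]]
    c_algebraic_int by (auto simp: gens_def)

lemma gens_algebraic: "m > 0 \<Longrightarrow> s \<in> gens c r m \<Longrightarrow> algebraic s"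
  using gens_algebraic_int by blast

lemma two_multiple:
  assumes "r \<ge> 1"
  obtains w where "2 = (1 - xi r) * w" "w \<in> int_adjoin (gens c r m)"
proof -
  obtain k where k: "r = Suc k" using assms by (cases r) auto
  have "1 - xi r ^ (2 ^ k) = (1 - xi r) * (\<Sum>i<2 ^ k. xi r ^ i)" by (rule one_diff_power_eq)
  then have "2 = (1 - xi r) * (\<Sum>i<2 ^ k. xi r ^ i)" using xi_power_half[of k] k by simp
  moreover have "(\<Sum>i<2 ^ k. xi r ^ i) \<in> int_adjoin (gens c r m)"
    by (intro int_adjoin_sum int_adjoin_power gens_incl)
  ultimately show ?thesis by (rule that)
qed

text \<open>Modulo 2 only \<open>1 + xi r ^ (2 ^ (r - 1)) = 0\<close> survives in the binomial
  expansion. Together with \<open>two_multiple\<close>, the elements \<open>1 - xi r\<close> and 2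
  have the same prime divisors.\<close>

lemma power_multiple_two:
  assumes "r \<ge> 2"
  obtains w where "(1 - xi r) ^ (2 ^ (r - 1)) = 2 * w" "w \<in> int_adjoin (gens c r m)"
proof -
  obtain k where k: "r = Suc k" "k \<ge> 1" using assms by (cases r) auto
  have x: "- xi r \<in> int_adjoin (gens c r m)" by (intro int_adjoin.uminus gens_incl)
  have "even ((2::nat) ^ k)" using k by simp
  then have e: "(- xi r) ^ (2 ^ k) = - 1" using xi_power_half[of k] k by (simp add: power_minus_even)
  have "ring_cong (gens c r m) 2 ((1 + - xi r) ^ (2 ^ k)) (1 ^ (2 ^ k) + (- xi r) ^ (2 ^ k))"
    by (rule ring_cong_2_add_power[OF int_adjoin.one x])
  then have "ring_cong (gens c r m) 2 ((1 - xi r) ^ (2 ^ k)) 0" by (simp add: e)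
  then show ?thesis using that k unfolding ring_cong_def by auto
qed

lemma xi_frobenius: "ring_cong (gens c r m) (1 - xi r) (xi r ^ k) (xi r)"
proof -
  have one: "ring_cong (gens c r m) (1 - xi r) (xi r ^ i) 1" for i
  proof (rule ring_congI)
    have "1 - xi r ^ i = (1 - xi r) * (\<Sum>j<i. xi r ^ j)" by (rule one_diff_power_eq)
    then show "xi r ^ i - 1 = (1 - xi r) * (- (\<Sum>j<i. xi r ^ j))" by (simp add: algebra_simps)
    show "- (\<Sum>j<i. xi r ^ j) \<in> int_adjoin (gens c r m)"
      by (intro int_adjoin.uminus int_adjoin_sum int_adjoin_power gens_incl)
  qed
  from one[of 1] have "ring_cong (gens c r m) (1 - xi r) (xi r) 1" by simp
  then show ?thesis by (rule ring_cong_trans[OF one ring_cong_sym])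
qed

lemma c_frobenius_xi:
  assumes r: "r \<ge> 1"
  shows "ring_cong (gens c r m) (1 - xi r) (c ^ (2 ^ n)) c"
proof -
  obtain w where w: "2 = (1 - xi r) * w" "w \<in> int_adjoin (gens c r m)" using two_multiple[OF r] by blast
  show ?thesis by (rule ring_cong_weaken[OF c_frobenius[OF gens_incl(1)] w])
qed

lemma eta_frobenius_full:
  assumes m: "odd m"
  shows "eta m ^ (2 ^ (n * totient m)) = eta m"
proof -
  have m0: "m > 0" using m by (rule odd_pos)
  have "Rings.coprime 2 m" using m by simp
  then have "[2 ^ totient m = 1] (mod m)" by (rule euler_theorem)
  then have "[(2 ^ totient m) ^ n = 1 ^ n] (mod m)" by (rule cong_pow)
  then have "[2 ^ (n * totient m) = 1] (mod m)" by (simp add: power_mult[symmetric] mult.commute)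
  moreover have "(1::nat) \<le> 2 ^ (n * totient m)" by simp
  ultimately have "m dvd 2 ^ (n * totient m) - 1" by (simp add: cong_altdef_nat)
  then obtain k where k: "2 ^ (n * totient m) - 1 = m * k" by (rule dvdE)
  then have "2 ^ (n * totient m) = Suc (m * k)" using \<open>1 \<le> 2 ^ (n * totient m)\<close> by linarith
  then show ?thesis using eta_power[OF m0] by (simp add: power_mult)
qed

text \<open>The exponent is a multiple of \<open>n\<close>, as \<open>c\<close> demands, and of
  \<open>totient m\<close>, as \<open>eta m\<close> demands; \<open>xi r\<close> is 1 modulo
  \<open>1 - xi r\<close>.\<close>

lemma full_frobenius:
  assumes r: "r \<ge> 1" and m: "odd m" and x: "x \<in> int_adjoin (gens c r m)"
  shows "ring_cong (gens c r m) (1 - xi r) (x ^ (2 ^ (n * totient m))) x"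
proof -
  obtain w where w: "2 = (1 - xi r) * w" "w \<in> int_adjoin (gens c r m)" using two_multiple[OF r] by blast
  have m0: "m > 0" using m by (rule odd_pos)
  have t0: "n * totient m \<ge> 1" using n m0 by (simp add: Suc_leI)
  have eta: "eta m ^ (2 ^ (n * totient m)) = eta m" by (rule eta_frobenius_full[OF m])
  have c: "ring_cong (gens c r m) (1 - xi r) (c ^ (2 ^ (n * totient m))) c"
    using ring_cong_frobenius_iterate[OF c_frobenius_xi[OF r] gens_incl(1), of m "totient m"]
    by (simp add: power_mult)
  show ?thesis
  proof (rule ring_cong_frobenius[OF w t0 _ subset_refl x])
    fix s assume "s \<in> gens c r m"
    then consider "s = c" | "s = xi r" | "s = eta m" unfolding gens_def by blast
    then show "ring_cong (gens c r m) (1 - xi r) (s ^ (2 ^ (n * totient m))) s"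
    proof cases
      case 1
      then show ?thesis using c by simp
    next
      case 2
      then show ?thesis using xi_frobenius by simp
    next
      case 3
      then show ?thesis by (simp add: eta ring_cong_refl)
    qed
  qed
qed

lemma integral_odd_multiple_gens:
  assumes r: "r \<ge> 2" and m: "odd m" and a: "algebraic_int a" "a \<in> field_adjoin (gens c r m)"
  obtains s :: int where "odd s" "of_int s * a \<in> int_adjoin (gens c r m)"
proof -
  have r1: "r \<ge> 1" using r by simp
  have m0: "m > 0" using m by (rule odd_pos)
  obtain w where w: "(1 - xi r) ^ (2 ^ (r - 1)) = 2 * w" "w \<in> int_adjoin (gens c r m)"
    using power_multiple_two[OF r] by blast
  have p: "1 - xi r \<in> int_adjoin (gens c r m)" by (intro int_adjoin_diff int_adjoin.one gens_incl)
  have pn: "1 - xi r \<noteq> 0" using xi_neq_1[of "r - 1"] r by simp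
  have k: "n * totient m \<ge> 1" using n m0 by (simp add: Suc_leI)
  have fr: "ring_cong (gens c r m) (1 - xi r) (x ^ (2 ^ (n * totient m))) x"
    if "x \<in> int_adjoin (gens c r m)" for x using r1 m that by (rule full_frobenius)
  have al: "algebraic_int s" if "s \<in> gens c r m" for s using m0 that by (rule gens_algebraic_int)
  show ?thesis
    by (rule integral_odd_multiple[OF p pn w k fr al a]) (assumption | erule (1) that)+
qed

text \<open>In \<open>\<int>[c, \<zeta>]\<close> with \<open>\<zeta>\<close> of 2-power level \<open>r - 1\<close>, the element \<open>1 - \<xi>\<^sub>r\<close> would be a square root
  of a prime element above 2 up to a unit, which the reducedness modulo that element forbids.\<close>

lemma xi_not_in_smaller_field:
  assumes r: "r \<ge> 3" and m: "odd m"
  shows "xi r \<notin> field_adjoin (gens c (r - 1) m)"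
proof
  assume "xi r \<in> field_adjoin (gens c (r - 1) m)"
  define l where "l = r - 1"
  have l: "l \<ge> 2" "r = Suc l" using r by (auto simp: l_def)
  have m0: "m > 0" using m by (rule odd_pos)
  let ?S = "gens c l m"
  let ?R = "int_adjoin ?S"
  define z where "z = xi r"
  have z2: "z ^ 2 = xi l" using xi_Suc_square[of l] by (simp add: z_def l)
  have za: "algebraic_int z" unfolding z_def by (rule algebraic_int_root_of_unity[OF xi_power_full]) simp
  have zf: "z \<in> field_adjoin ?S" unfolding z_def l_def by fact
  obtain s where s: "odd s" "of_int s * z \<in> ?R"
    by (rule integral_odd_multiple_gens[OF l(1) m za zf])
  have l1: "l \<ge> 1" using l by simp
  obtain w where w: "2 = (1 - xi l) * w" "w \<in> ?R" using two_multiple[OF l1] by blast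
  define y where "y = of_int s * (1 - z)"
  have y: "y \<in> ?R" unfolding y_def right_diff_distrib using s by (intro int_adjoin_diff) simp_all
  \<comment> \<open>Modulo 2 the square of \<open>1 - z\<close> is
    \<open>1 - z ^ 2 = 1 - xi l\<close>. The remainder is arranged around \<open>q * z\<close>
    because only \<open>of_int s * z\<close> is known to lie in the ring.\<close>
  have sq_eq: "(q * (1 - z)) ^ 2 = q ^ 2 * (1 - z ^ 2) + 2 * (q ^ 2 * z ^ 2 - q * (q * z))" for q :: complex
    by (simp add: power2_eq_square algebra_simps)
  have two: "2 * E = (1 - xi l) * (w * E)" for E
    using arg_cong[OF w(1), of "\<lambda>t. t * E"] by (simp only: mult.assoc)
  have "y ^ 2 = of_int s ^ 2 * (1 - xi l) + (1 - xi l) * (w * (of_int s ^ 2 * xi l - of_int s * (of_int s * z)))"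
    unfolding y_def sq_eq two z2 by (rule refl)
  also have "\<dots> = (1 - xi l) * (of_int s ^ 2 + w * (of_int s ^ 2 * xi l - of_int s * (of_int s * z)))"
    by (simp only: distrib_left mult.commute[of "of_int s ^ 2"])
  finally have y2_eq: "y ^ 2 = (1 - xi l) * (of_int s ^ 2 + w * (of_int s ^ 2 * xi l - of_int s * (of_int s * z)))" .
  have sq: "of_int s ^ 2 \<in> ?R" by (rule int_adjoin_power[OF int_adjoin_of_int])
  have ss: "of_int s * (of_int s * z) \<in> ?R" by (rule int_adjoin.mult[OF int_adjoin_of_int s(2)])
  have "of_int s ^ 2 + w * (of_int s ^ 2 * xi l - of_int s * (of_int s * z)) \<in> ?R"
    by (rule int_adjoin.add[OF sq int_adjoin.mult[OF w(2) int_adjoin_diff[OF int_adjoin.mult[OF sq gens_incl(2)] ss]]])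
  then have y2: "ring_cong ?S (1 - xi l) (y ^ 2) 0"
    by (rule ring_congI) (simp only: y2_eq diff_zero)
  let ?k = "n * totient m"
  have k: "?k \<ge> 1" using n m0 by (simp add: Suc_leI)
  then obtain j where j: "?k = Suc j" by (cases ?k) auto
  \<comment> \<open>The Frobenius exponent is even, so \<open>y ^ 2\<close> being zero modulo
    \<open>1 - xi l\<close> makes this power of \<open>y\<close> zero; but the power is congruent to
    \<open>y\<close>.\<close>
  have e: "(2::nat) ^ ?k = 2 * 2 ^ (?k - 1)" by (simp only: j power_Suc diff_Suc_1)
  have "ring_cong ?S (1 - xi l) ((y ^ 2) ^ (2 ^ (?k - 1))) (0 ^ (2 ^ (?k - 1)))"
    using y2 y by (intro ring_cong_power int_adjoin_power) simp_all
  then have "ring_cong ?S (1 - xi l) (y ^ (2 ^ ?k)) 0" unfolding e power_mult[of y 2] by (simp add: power_0_left)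
  then have "ring_cong ?S (1 - xi l) y 0"
    by (rule ring_cong_trans[OF ring_cong_sym[OF full_frobenius[OF l1 m y]]])
  then obtain v where v: "v \<in> ?R" "y - 0 = (1 - xi l) * v"
    unfolding ring_cong_def by blast
  \<comment> \<open>Cancelling \<open>1 - z\<close> shows that \<open>1 + z\<close> divides the odd
    number \<open>s\<close>, although a power of \<open>1 + z\<close> is a multiple of 2.\<close>
  have "1 - xi l = (1 - z) * (1 + z)" unfolding z2[symmetric] by (simp add: power2_eq_square algebra_simps)
  with v(2) have "(1 - z) * of_int s = (1 - z) * ((1 + z) * v)" by (simp only: y_def diff_zero mult.assoc mult.commute[of "of_int s"])
  moreover have "1 - z \<noteq> 0" using xi_neq_1[of l] by (simp add: z_def l)
  ultimately have sv: "of_int s = (1 + z) * v" by (simp only: mult_left_cancel[of "1 - z"] simp_thms)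
  obtain u where u: "u \<in> int_adjoin {z}" "(1 + z) ^ (2 ^ r) = 2 * u"
  proof -
    have "ring_cong {z} 2 ((1 + z) ^ (2 ^ r)) (1 ^ (2 ^ r) + z ^ (2 ^ r))"
      by (intro ring_cong_2_add_power int_adjoin.one int_adjoin.incl) simp
    moreover have "z ^ (2 ^ r) = 1" unfolding z_def by (rule xi_power_full)
    ultimately have "ring_cong {z} 2 ((1 + z) ^ (2 ^ r)) 2" by simp
    then obtain t where t: "t \<in> int_adjoin {z}" "(1 + z) ^ (2 ^ r) - 2 = 2 * t"
      unfolding ring_cong_def by blast
    show ?thesis
    proof (rule that)
      show "1 + t \<in> int_adjoin {z}" using t(1) by (intro int_adjoin.add int_adjoin.one)
      show "(1 + z) ^ (2 ^ r) = 2 * (1 + t)" using t(2) by (simp add: algebra_simps)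
    qed
  qed
  show False
  proof (rule odd_not_multiple[OF s(1) sv _ u(2)])
    show "algebraic_int v" using v(1) gens_algebraic_int[OF m0] by (rule int_adjoin_algebraic_int)
    show "algebraic_int u" using u(1) by (rule int_adjoin_algebraic_int) (use za in simp)
  qed
qed

end

section \<open>A Frobenius automorphism\<close>

lemma int_coeffs_of_roots:
  assumes p: "lead_coeff p = 1" and roots: "\<And>z. poly p z = 0 \<Longrightarrow> algebraic_int z"
  shows "int_coeffs p"
proof -
  obtain root where r: "smult (lead_coeff p) (\<Prod>i<degree p. [:- root i, 1:]) = p"
    by (rule complex_poly_decompose')
  then have eq: "p = (\<Prod>i<degree p. [:- root i, 1:])" using p by simp
  have "algebraic_int (root i)" if "i < degree p" for i
  proof (rule roots)
    have "poly (\<Prod>i<degree p. [:- root i, 1:]) (root i) = 0"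
      unfolding poly_prod using that by (intro prod_zero) auto
    then show "poly p (root i) = 0" using eq by simp
  qed
  then have "int_coeffs (\<Prod>i<degree p. [:- root i, 1:])"
    by (intro int_coeffs_prod) (simp add: int_coeffs_def coeff_pCons split: nat.split)
  then show ?thesis using eq by simp
qed

lemma common_odd_multiple:
  fixes a :: "nat \<Rightarrow> complex"
  assumes "\<And>i. \<exists>s::int. odd s \<and> of_int s * a i \<in> int_adjoin S"
  shows "\<exists>s::int. odd s \<and> (\<forall>i<N. of_int s * a i \<in> int_adjoin S)"
proof (induction N)
  case 0
  show ?case by (intro exI[of _ 1]) simp
next
  case (Suc N)
  then obtain s :: int where s: "odd s" "\<And>i. i < N \<Longrightarrow> of_int s * a i \<in> int_adjoin S" by blast
  obtain t :: int where t: "odd t" "of_int t * a N \<in> int_adjoin S" using assms by blast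
  have "of_int (s * t) * a i \<in> int_adjoin S" if "i < Suc N" for i
  proof (cases "i = N")
    case True
    have "of_int s * (of_int t * a N) \<in> int_adjoin S" by (rule int_adjoin.mult[OF int_adjoin_of_int t(2)])
    then show ?thesis by (simp only: True of_int_mult mult.assoc)
  next
    case False
    then have "i < N" using that by simp
    have "of_int t * (of_int s * a i) \<in> int_adjoin S" by (rule int_adjoin.mult[OF int_adjoin_of_int s(2)[OF \<open>i < N\<close>]])
    then show ?thesis by (simp only: of_int_mult mult.assoc mult.left_commute)
  qed
  moreover have "odd (s * t)" using s(1) t(1) by simp
  ultimately show ?case by blast
qed

lemma partial_hom_Id_field_adjoin:
  assumes "\<And>s. s \<in> S \<Longrightarrow> algebraic s"
  shows "partial_hom (Id_on (field_adjoin S))"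
  unfolding partial_hom_def Id_on_iff
  using field_adjoin_algebraic[OF _ assms]
  by (simp add: field_adjoin_uminus field_adjoin_add field_adjoin_mult)

lemma int_coeffs_poly: "int_coeffs p \<Longrightarrow> algebraic_int y \<Longrightarrow> algebraic_int (poly p y)"
  unfolding poly_altdef int_coeffs_def
  by (intro algebraic_int_sum algebraic_int_mult algebraic_int_power) simp_all

lemma int_coeffs_pderiv: "int_coeffs p \<Longrightarrow> int_coeffs (pderiv p)"
  unfolding int_coeffs_def coeff_pderiv
  by (intro allI algebraic_int_mult) (simp_all del: of_nat_Suc)

context periodic_quadratic
begin

text \<open>Without the odd root of unity the exponent \<open>2 ^ n\<close> already acts trivially,
  so Frobenius fixes the coefficients of the minimal polynomial in \<open>frobenius_root\<close>
  modulo \<open>1 - xi 3\<close>.\<close>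

lemma gens_1_frobenius:
  assumes "a \<in> int_adjoin (gens c 3 1)"
  shows "ring_cong (gens c 3 m) (1 - xi 3) (a ^ (2 ^ n)) a"
proof -
  have r: "(3::nat) \<ge> 1" by simp
  obtain w where w: "2 = (1 - xi 3) * w" "w \<in> int_adjoin (gens c 3 m)" by (rule two_multiple[OF r])
  show ?thesis
  proof (rule ring_cong_frobenius[OF w n _ gens_1_subset assms])
    fix s assume "s \<in> gens c 3 1"
    then consider "s = c" | "s = xi 3" | "s = 1" unfolding gens_def eta_1 by blast
    then show "ring_cong (gens c 3 m) (1 - xi 3) (s ^ (2 ^ n)) s"
    proof cases
      case 1
      then show ?thesis using c_frobenius_xi[OF r] by simp
    next
      case 2
      then show ?thesis using xi_frobenius by simp
    next
      case 3
      then show ?thesis by (simp add: ring_cong_refl)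
    qed
  qed
qed

text \<open>Dedekind's argument. Let \<open>p\<close> be the minimal polynomial of
  \<open>eta m\<close> over the field without odd roots of unity, and
  \<open>X ^ m - 1 = p * s\<close>. At \<open>y = eta m ^ (2 ^ n)\<close> the value of
  \<open>p\<close> is, up to odd factors, a multiple of \<open>1 - xi 3\<close>. If it were nonzero,
  \<open>y\<close> would be a root of \<open>s\<close>, and differentiating would make
  \<open>m\<close> times a unit a multiple of that value, contrary to \<open>m\<close> being
  odd.\<close>

lemma frobenius_root:
  assumes m: "odd m" and u: "\<And>i. coeff u i \<in> int_adjoin (gens c 3 1)" "poly u (eta m) = 0"
  shows "poly u (eta m ^ (2 ^ n)) = 0"
proof -
  have m0: "m > 0" using m by (rule odd_pos)
  define y where "y = eta m ^ (2 ^ n)"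
  have ym: "y ^ m = 1" unfolding y_def by (metis eta_power[OF m0] mult.commute power_mult power_one)
  have ya: "algebraic_int y" by (rule algebraic_int_root_of_unity[OF ym m0])
  let ?S = "gens c 3 1" and ?T = "gens c 3 m"
  let ?K = "field_adjoin ?S"
  have Sa: "algebraic s" if "s \<in> ?S" for s using gens_algebraic[OF _ that] by simp
  have eta_alg: "algebraic (eta m)"
    using algebraic_int_root_of_unity[OF eta_power[OF m0] m0] by blast
  have ph: "partial_hom (Id_on ?K)" by (rule partial_hom_Id_field_adjoin) (rule Sa)
  have rel: "rel_poly (Id_on ?K) a b \<longleftrightarrow> a = b \<and> (\<forall>i. coeff a i \<in> ?K)" for a b
    by (auto simp: rel_poly_def Id_on_iff poly_eq_iff)
  have inv: "(1 / a, 1 / b) \<in> Id_on ?K" if "(a, b) \<in> Id_on ?K" "a \<noteq> 0" for a b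
  proof -
    from that have a: "a \<in> ?K" "b = a" by (auto simp: Id_on_iff)
    have "1 / a \<in> ?K" by (rule field_adjoin_divide[OF field_adjoin_one a(1) Sa])
    then show ?thesis by (simp only: a(2) Id_on_iff simp_thms)
  qed
  obtain p q where pq: "rel_poly (Id_on ?K) p q" "lead_coeff p = 1" "poly p (eta m) = 0"
    and min: "\<And>u v. rel_poly (Id_on ?K) u v \<Longrightarrow> poly u (eta m) = 0 \<Longrightarrow>
      \<exists>s s'. rel_poly (Id_on ?K) s s' \<and> u = p * s \<and> v = q * s'"
    using rel_poly_minimal[OF ph eta_alg inv] by blast
  have pK: "coeff p i \<in> ?K" for i using pq(1) rel by blast
  define M :: "complex poly" where "M = monom 1 m - 1"
  have Mc: "coeff M m = 1" using m0 by (simp add: M_def)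
  have "degree M \<le> m" unfolding M_def by (intro degree_diff_le) (simp_all add: degree_monom_le)
  moreover have "m \<le> degree M" using Mc by (intro le_degree) simp
  ultimately have Ml: "lead_coeff M = 1" using Mc by simp
  have Mp: "poly M z = z ^ m - 1" for z by (simp add: M_def poly_monom)
  have "- 1 \<in> ?K" by (rule field_adjoin_uminus[OF field_adjoin_one])
  then have "coeff M i \<in> ?K" for i by (simp add: M_def)
  then have "rel_poly (Id_on ?K) M M" using rel by blast
  moreover have "poly M (eta m) = 0" by (simp add: Mp eta_power[OF m0])
  ultimately obtain s where s: "M = p * s" using min by blast
  have sl: "lead_coeff s = 1" using Ml pq(2) unfolding s lead_coeff_mult by simp
  have root: "algebraic_int z" if "poly M z = 0" for z
    using that algebraic_int_root_of_unity[OF _ m0] by (simp add: Mp)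
  have ip: "int_coeffs p" by (rule int_coeffs_of_roots[OF pq(2)]) (rule root, simp add: s)
  have isc: "int_coeffs s" by (rule int_coeffs_of_roots[OF sl]) (rule root, simp add: s)
  have "\<exists>s::int. odd s \<and> of_int s * coeff p i \<in> int_adjoin ?S" for i
  proof -
    have a: "algebraic_int (coeff p i)" using ip by (simp add: int_coeffs_def)
    have r2: "(2::nat) \<le> 3" and o1: "odd (1::nat)" by simp_all
    obtain s :: int where "odd s" "of_int s * coeff p i \<in> int_adjoin ?S"
      by (rule integral_odd_multiple_gens[OF r2 o1 a pK])
    then show ?thesis by blast
  qed
  then obtain t :: int where t: "odd t" "\<And>i. i < Suc (degree p) \<Longrightarrow> of_int t * coeff p i \<in> int_adjoin ?S"
    using common_odd_multiple by metis
  \<comment> \<open>The coefficients of \<open>p\<close> are integral but possibly outside the ring;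
    an odd multiple moves them into it, where the Frobenius congruence is available.\<close>
  define w where "w = smult (of_int t) p"
  have wc: "coeff w i \<in> int_adjoin ?S" for i
  proof (cases "i \<le> degree p")
    case True
    then show ?thesis using t(2)[of i] by (simp add: w_def)
  next
    case False
    then have "coeff w i = 0" by (simp add: w_def coeff_eq_0)
    then show ?thesis by simp
  qed
  have r1: "(3::nat) \<ge> 1" and r2: "(3::nat) \<ge> 2" by simp_all
  obtain v where v: "2 = (1 - xi 3) * v" "v \<in> int_adjoin ?T" by (rule two_multiple[OF r1])
  obtain v' where v': "(1 - xi 3) ^ (2 ^ (3 - 1)) = 2 * v'" "v' \<in> int_adjoin ?T" by (rule power_multiple_two[OF r2])
  have Ta: "algebraic_int z" if "z \<in> int_adjoin ?T" for z
    using that by (rule int_adjoin_algebraic_int) (rule gens_algebraic_int[OF m0])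
  have "ring_cong ?T (1 - xi 3) (poly w (eta m) ^ (2 ^ n)) (poly w (eta m ^ (2 ^ n)))"
  proof (rule ring_cong_poly_frobenius[OF v gens_incl(3)])
    show "coeff w i \<in> int_adjoin ?T \<and> ring_cong ?T (1 - xi 3) (coeff w i ^ (2 ^ n)) (coeff w i)" for i
      using wc[of i] gens_1_subset gens_1_frobenius[OF wc[of i]] by blast
  qed
  moreover have "poly w (eta m) = 0" using pq(3) by (simp add: w_def)
  ultimately have "ring_cong ?T (1 - xi 3) 0 (poly w y)" by (simp add: y_def power_0_left)
  then have "ring_cong ?T (1 - xi 3) (poly w y) 0" by (rule ring_cong_sym)
  then obtain z where z: "z \<in> int_adjoin ?T" "poly w y = (1 - xi 3) * z"
    unfolding ring_cong_def by auto
  have "poly p y = 0"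
  proof (rule ccontr)
    assume nz: "poly p y \<noteq> 0"
    have "poly p y * poly s y = 0" using Mp[of y] ym by (simp add: s)
    with nz have sy: "poly s y = 0" by simp
    have "poly (pderiv M) y = poly p y * poly (pderiv s) y"
      unfolding s pderiv_mult by (simp add: sy)
    moreover have "poly (pderiv M) y = of_nat m * y ^ (m - 1)"
      by (simp add: M_def pderiv_diff pderiv_monom poly_monom)
    ultimately have d: "of_nat m * y ^ (m - 1) = poly p y * poly (pderiv s) y" by simp
    have yy: "y ^ (m - 1) * y = 1" using ym m0 by (cases m) (simp_all add: mult.commute)
    have "of_int (t * int m) = of_int t * (of_nat m * (y ^ (m - 1) * y))" by (simp only: yy) simp
    also have "\<dots> = of_int t * (of_nat m * y ^ (m - 1)) * y" by (simp only: mult.assoc)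
    also have "\<dots> = poly w y * (poly (pderiv s) y * y)" unfolding d by (simp add: w_def)
    finally have e: "of_int (t * int m) = (1 - xi 3) * (z * (poly (pderiv s) y * y))"
      by (simp only: z(2) mult.assoc)
    show False
    proof (rule odd_not_multiple[OF _ e _ v'(1) Ta[OF v'(2)]])
      show "odd (t * int m)" using t(1) m by simp
      show "algebraic_int (z * (poly (pderiv s) y * y))"
        by (intro algebraic_int_mult[OF Ta[OF z(1)]] algebraic_int_mult[OF int_coeffs_poly ya] int_coeffs_pderiv isc ya)
    qed
  qed
  have "coeff u i \<in> ?K" for i using u(1) int_adjoin_subset_field_adjoin by blast
  then have "rel_poly (Id_on ?K) u u" using rel by blast
  then obtain s' where "u = p * s'" using min u(2) by blast
  with \<open>poly p y = 0\<close> show ?thesis by (simp add: y_def)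
qed

lemma frobenius_automorphism:
  assumes m: "odd m"
  obtains g where "alg_hom g" "g c = c" "g (xi 3) = xi 3" "g (eta m) = eta m ^ (2 ^ n)"
proof -
  have m0: "m > 0" using m by (rule odd_pos)
  have eta_alg: "algebraic (eta m)"
    using algebraic_int_root_of_unity[OF eta_power[OF m0] m0] by blast
  have Sa: "algebraic s" if "s \<in> gens c 3 1" for s using gens_algebraic[OF _ that] by simp
  show ?thesis
  proof (rule automorphism_exists[OF eta_alg Sa frobenius_root[OF m]])
    fix g assume g: "alg_hom g" "\<And>a. a \<in> int_adjoin (gens c 3 1) \<Longrightarrow> g a = a" "g (eta m) = eta m ^ (2 ^ n)"
    show ?thesis by (rule that[OF g(1) g(2)[OF gens_incl(1)] g(2)[OF gens_incl(2)] g(3)])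
  qed
qed

end

section \<open>Congruences modulo 4 between conjugates\<close>

lemma qmap_congruence:
  assumes d: "d \<noteq> 0" "algebraic_int (2 / d)" and y: "algebraic_int y" and xy: "algebraic_int ((x - y) / d)"
  shows "algebraic_int ((qmap c x - qmap c y) / d ^ 2)"
proof -
  have "(qmap c x - qmap c y) / d ^ 2 = ((x - y) / d) * ((x - y) / d + y * (2 / d))"
    using d(1) by (simp add: qmap_def power2_eq_square field_simps)
  also have "algebraic_int \<dots>" using d(2) y xy by (intro algebraic_int_mult algebraic_int_add)
  finally show ?thesis .
qed

lemma conj_avg_alg_hom:
  assumes "alg_hom g" "algebraic x"
  shows "conj_avg G (g x) = conj_avg G x"
  unfolding conj_avg_def conjugates_eq[OF assms(2) alg_hom_conjugates[OF assms]] ..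

text \<open>The product formula for \<open>(u - v) / 4\<close>.\<close>

lemma conj_avg_lower_bound:
  assumes S: "\<And>s. s \<in> S \<Longrightarrow> algebraic s" "finite S" and r: "r \<ge> 1"
    and u: "u \<in> field_adjoin S" and v: "v \<in> field_adjoin S" and uv: "u \<noteq> v"
    and int: "algebraic_int ((u - v) / 4)"
  shows "ln (2 / r) \<le> conj_avg (ln_excess r) u + conj_avg (ln_excess r) v"
proof -
  let ?E = "embeddings S"
  have au: "algebraic u" and av: "algebraic v" using u v S(1) by (auto intro: field_adjoin_algebraic)
  have a4: "algebraic (4 :: complex)" using algebraic_of_int[of 4] by simp
  have four: "4 \<in> field_adjoin S" using field_adjoin_of_int[of 4] by simp
  have mem: "(u - v) / 4 \<in> field_adjoin S"
    by (rule field_adjoin_divide[OF field_adjoin_diff[OF u v] four S(1)])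
  have "0 \<le> (\<Sum>\<phi>\<in>?E. ln (cmod (\<phi> ((u - v) / 4))))"
    by (rule sum_ln_embeddings_nonneg[OF S mem int]) (use uv in simp_all)
  also have "\<dots> \<le> (\<Sum>\<phi>\<in>?E. ln_excess r (\<phi> u) + ln_excess r (\<phi> v) - ln (2 / r))"
  proof (rule sum_mono)
    fix \<phi> assume "\<phi> \<in> ?E"
    then obtain g where g: "alg_hom g" "\<phi> = restrict g (field_adjoin S)" by (rule embeddingsE)
    have "\<phi> ((u - v) / 4) = (g u - g v) / g 4"
      using g(2) mem ah_divide[OF g(1) algebraic_diff[OF au av] a4] ah_diff[OF g(1) au av] by simp
    also have "g 4 = 4" using ah_of_int[OF g(1), of 4] by simp
    finally have eq: "\<phi> ((u - v) / 4) = (g u - g v) / 4" .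
    have ne: "g u \<noteq> g v" using ah_inj[OF g(1) au av] uv by blast
    have "ln (cmod ((g u - g v) / 4)) = ln (cmod (g u - g v)) - ln 4"
      using ne by (simp add: norm_divide ln_div)
    also have "\<dots> \<le> ln (2 * r) + ln_excess r (g u) + ln_excess r (g v) - ln 4"
      using cmod_diff_le_ln_excess[OF r ne] by simp
    also have "ln (2 * r) = ln 4 - ln (2 / r)"
    proof -
      have "ln (4::real) = ln ((2 * r) * (2 / r))" using r by simp
      also have "\<dots> = ln (2 * r) + ln (2 / r)" using r by (intro ln_mult_pos) simp_all
      finally show ?thesis by simp
    qed
    finally have "ln (cmod ((g u - g v) / 4)) \<le> ln_excess r (g u) + ln_excess r (g v) - ln (2 / r)" by simp
    moreover have "\<phi> u = g u" "\<phi> v = g v" using g(2) u v by simp_all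
    ultimately show "ln (cmod (\<phi> ((u - v) / 4))) \<le> ln_excess r (\<phi> u) + ln_excess r (\<phi> v) - ln (2 / r)"
      unfolding eq by simp
  qed
  also have "\<dots> = (\<Sum>\<phi>\<in>?E. ln_excess r (\<phi> u)) + (\<Sum>\<phi>\<in>?E. ln_excess r (\<phi> v)) - card ?E * ln (2 / r)"
    by (simp add: sum.distrib sum_subtractf)
  also have "(\<Sum>\<phi>\<in>?E. ln_excess r (\<phi> u)) = card ?E * conj_avg (ln_excess r) u"
    by (rule sum_embeddings(1)[OF S u])
  also have "(\<Sum>\<phi>\<in>?E. ln_excess r (\<phi> v)) = card ?E * conj_avg (ln_excess r) v"
    by (rule sum_embeddings(1)[OF S v])
  finally have "0 \<le> real (card ?E) * (conj_avg (ln_excess r) u + conj_avg (ln_excess r) v - ln (2 / r))"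
    by (simp add: algebra_simps)
  moreover have "real (card ?E) > 0" using card_embeddings_pos[OF S] by simp
  ultimately show ?thesis by (simp add: zero_le_mult_iff)
qed

lemma finite_orbit_if_periodic_point:
  fixes T :: "'a \<Rightarrow> 'a"
  assumes "(T ^^ (a + k)) x = (T ^^ a) x" "k > 0"
  shows "finite (range (\<lambda>i. (T ^^ i) x))"
proof -
  have "\<exists>j<a + k. (T ^^ i) x = (T ^^ j) x" for i
  proof (induction i)
    case 0
    show ?case using assms(2) by (intro exI[of _ 0]) simp
  next
    case (Suc i)
    then obtain j where j: "j < a + k" "(T ^^ i) x = (T ^^ j) x" by blast
    have e: "(T ^^ Suc i) x = (T ^^ Suc j) x" using j(2) by simp
    show ?case
    proof (cases "Suc j < a + k")
      case True
      then show ?thesis using e by blast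
    next
      case False
      then have "Suc j = a + k" using j(1) by simp
      then have "(T ^^ Suc i) x = (T ^^ a) x" unfolding e using assms(1) by (simp only:)
      then show ?thesis using assms(2) by (intro exI[of _ a]) simp
    qed
  qed
  then have "range (\<lambda>i. (T ^^ i) x) \<subseteq> (\<lambda>j. (T ^^ j) x) ` {..<a + k}" by force
  then show ?thesis by (rule finite_subset) simp
qed

context periodic_quadratic
begin

lemma frobenius_ring_cong:
  assumes m: "odd m" and g: "alg_hom g" "g c = c" "g (xi 3) = xi 3" "g (eta m) = eta m ^ (2 ^ n)"
    and x: "x \<in> int_adjoin (gens c 3 m)"
  shows "g x \<in> int_adjoin (gens c 3 m) \<and> ring_cong (gens c 3 m) (1 - xi 3) (g x) (x ^ (2 ^ n))"
  using x
proof induction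
  let ?S = "gens c 3 m"
  have r1: "(3::nat) \<ge> 1" by simp
  have m0: "m > 0" using m by (rule odd_pos)
  obtain w where w: "2 = (1 - xi 3) * w" "w \<in> int_adjoin ?S" by (rule two_multiple[OF r1])
  have alg: "algebraic y" if "y \<in> int_adjoin ?S" for y
    using that by (rule int_adjoin_algebraic) (rule gens_algebraic[OF m0])
  {
    case one
    show ?case by (simp add: ah_one[OF g(1)] ring_cong_refl)
  next
    case (incl y)
    then consider "y = c" | "y = xi 3" | "y = eta m" unfolding gens_def by blast
    then show ?case
    proof cases
      case 1
      then show ?thesis using ring_cong_sym[OF c_frobenius_xi[OF r1]] gens_incl g(2) by simp
    next
      case 2
      then show ?thesis using ring_cong_sym[OF xi_frobenius] gens_incl g(3) by simp
    next
      case 3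
      then show ?thesis using int_adjoin_power[OF gens_incl(3)] g(4) by (simp add: ring_cong_refl)
    qed
  next
    case (uminus y)
    have "even ((2::nat) ^ n)" using n by simp
    then have e: "(- y) ^ (2 ^ n) = y ^ (2 ^ n)" by (rule power_minus_even)
    have ge: "g (- y) = - g y" by (rule ah_uminus[OF g(1) alg[OF uminus.hyps]])
    have "ring_cong ?S (1 - xi 3) (- g y) (g y)"
      by (rule ring_cong_uminus[OF _ w]) (use uminus.IH in blast)
    then show ?case unfolding e ge using uminus.IH ring_cong_trans int_adjoin.uminus by blast
  next
    case (add y z)
    have ge: "g (y + z) = g y + g z" by (rule ah_add[OF g(1) alg[OF add.hyps(1)] alg[OF add.hyps(2)]])
    have "ring_cong ?S (1 - xi 3) (g y + g z) (y ^ (2 ^ n) + z ^ (2 ^ n))"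
      using add.IH by (intro ring_cong_add) blast+
    moreover have "ring_cong ?S (1 - xi 3) (y ^ (2 ^ n) + z ^ (2 ^ n)) ((y + z) ^ (2 ^ n))"
      by (rule ring_cong_sym[OF ring_cong_add_power[OF add.hyps w]])
    ultimately show ?case unfolding ge using add.IH ring_cong_trans int_adjoin.add by blast
  next
    case (mult y z)
    have ge: "g (y * z) = g y * g z" by (rule ah_mult[OF g(1) alg[OF mult.hyps(1)] alg[OF mult.hyps(2)]])
    have "ring_cong ?S (1 - xi 3) (g y * g z) (y ^ (2 ^ n) * z ^ (2 ^ n))"
      using mult.IH int_adjoin_power[OF mult.hyps(1)] by (intro ring_cong_mult) blast+
    then show ?case unfolding ge power_mult_distrib using mult.IH int_adjoin.mult by blast
  }
qed

lemma alg_hom_field_adjoin_mono: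
  assumes g: "alg_hom g" and S: "\<And>s. s \<in> S \<Longrightarrow> algebraic s"
    and gS: "\<And>x. x \<in> int_adjoin S \<Longrightarrow> g x \<in> int_adjoin S" and x: "x \<in> field_adjoin S"
  shows "g x \<in> field_adjoin S"
proof -
  obtain k where k: "k \<noteq> 0" "of_int k * x \<in> int_adjoin S" using x by (rule field_adjoinE)
  have ax: "algebraic x" using x S by (rule field_adjoin_algebraic)
  have "of_int k * g x = g (of_int k * x)"
    using ax by (simp add: ah_mult[OF g] ah_of_int[OF g])
  also have "\<dots> \<in> int_adjoin S" by (rule gS[OF k(2)])
  finally show ?thesis by (rule field_adjoinI[OF k(1)])
qed

text \<open>Modulo \<open>1 - xi 3\<close>, \<open>g a\<close> is congruent to \<open>a ^ q\<close>,
  and this to the \<open>n\<close>-th iterate of \<open>a\<close>. As \<open>(1 - xi 3) ^ 4\<close>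
  is a multiple of 2, two applications of the map give a congruence modulo 2 and a third one modulo
  4; hence the 3 in \<open>n + 3\<close>.\<close>

lemma frobenius_congruence:
  assumes m: "odd m" and g: "alg_hom g" "g c = c" "g (xi 3) = xi 3" "g (eta m) = eta m ^ (2 ^ n)"
    and a: "algebraic_int a" "a \<in> field_adjoin (gens c 3 m)"
  shows "algebraic_int (((qmap c ^^ 3) (g a) - (qmap c ^^ (n + 3)) a) / 4)"
proof -
  let ?S = "gens c 3 m" and ?p = "1 - xi 3"
  have r1: "(3::nat) \<ge> 1" and r2: "(2::nat) \<le> 3" by simp_all
  have m0: "m > 0" using m by (rule odd_pos)
  obtain w where w: "2 = ?p * w" "w \<in> int_adjoin ?S" by (rule two_multiple[OF r1])
  have Sint: "algebraic_int z" if "z \<in> int_adjoin ?S" for z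
    using that by (rule int_adjoin_algebraic_int) (rule gens_algebraic_int[OF m0])
  have aa: "algebraic a" using a(1) by blast
  obtain s :: int where s: "odd s" "of_int s * a \<in> int_adjoin ?S"
    by (rule integral_odd_multiple_gens[OF r2 m a])
  define q :: nat where "q = 2 ^ n"
  define x where "x = of_int s * a"
  obtain z where z: "z \<in> int_adjoin ?S" "g x - x ^ q = ?p * z"
    using frobenius_ring_cong[OF m g s(2)] unfolding ring_cong_def x_def q_def by blast
  have gx: "g x = of_int s * g a" unfolding x_def ah_mult[OF g(1) algebraic_of_int aa] ah_of_int[OF g(1)] ..
  \<comment> \<open>Frobenius is known for \<open>x = s * a\<close> only. Since \<open>s ^ q\<close>
    and \<open>s\<close> agree modulo 2, the factor \<open>s\<close> can be taken out and then
    cancelled.\<close>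
  have "even (s ^ q - s)" using s(1) by simp
  then obtain k where k: "s ^ q - s = 2 * k" by (rule evenE)
  have sq: "(of_int s :: complex) ^ q = of_int s + 2 * of_int k"
  proof -
    have "(of_int (s ^ q) :: complex) = of_int (s + 2 * k)" using k by (simp add: algebra_simps)
    then show ?thesis by simp
  qed
  have wint: "algebraic_int w" by (rule Sint[OF w(2)])
  have 1: "algebraic_int ((g a - a ^ q) / ?p)"
  proof (rule algebraic_int_odd_divide[OF _ w(1) wint s(1)])
    show "algebraic_int (g a - a ^ q)"
      by (intro algebraic_int_diff ah_algebraic_int[OF g(1)] algebraic_int_power a(1))
    have two: "2 * E = ?p * (w * E)" for E
      using arg_cong[OF w(1), of "\<lambda>t. t * E"] by (simp only: mult.assoc)
    have "of_int s * (g a - a ^ q) = (g x - x ^ q) + 2 * (of_int k * a ^ q)"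
      unfolding gx unfolding x_def power_mult_distrib sq by (simp add: algebra_simps)
    also have "\<dots> = ?p * (z + w * (of_int k * a ^ q))" unfolding z(2) two by (simp only: distrib_left)
    finally show "of_int s * (g a - a ^ q) = ?p * (z + w * (of_int k * a ^ q))" .
    show "algebraic_int (z + w * (of_int k * a ^ q))"
      using Sint[OF z(1)] wint a(1)
      by (intro algebraic_int_add algebraic_int_mult algebraic_int_power algebraic_int_of_int)
  qed
  have cC: "c \<in> int_adjoin {c, a}" and aC: "a \<in> int_adjoin {c, a}" by (auto intro: int_adjoin.incl)
  obtain v where v: "v \<in> int_adjoin {c, a}" "(qmap c ^^ n) a - a ^ q = 2 * v"
    using ring_cong_qmap[OF cC aC, of n] per unfolding ring_cong_def q_def by auto
  have vint: "algebraic_int v" using v(1) by (rule int_adjoin_algebraic_int) (use c_algebraic_int a(1) in auto)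
  define b where "b = (qmap c ^^ n) a"
  have bint: "algebraic_int b" unfolding b_def by (rule qmap_iter_algebraic_int[OF c_algebraic_int a(1)])
  have it_int: "algebraic_int ((qmap c ^^ j) b)" for j by (rule qmap_iter_algebraic_int[OF c_algebraic_int bint])
  have p0: "?p \<noteq> 0" using w(1) by auto
  have e: "g a - b = (g a - a ^ q) - ?p * (w * v)"
    using v(2) arg_cong[OF w(1), of "\<lambda>t. t * v"] by (simp add: b_def algebra_simps)
  have "(g a - b) / ?p = (g a - a ^ q) / ?p - ?p * (w * v) / ?p"
    unfolding e by (rule diff_divide_distrib)
  also have "?p * (w * v) / ?p = w * v" using p0 by simp
  finally have "(g a - b) / ?p = (g a - a ^ q) / ?p - w * v" .
  then have c1: "algebraic_int ((g a - b) / ?p)"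
    using 1 wint vint by (simp add: algebraic_int_diff algebraic_int_mult)
  define y where "y = xi 3"
  have y2: "y ^ 2 = \<i>" using xi_Suc_square[of 2] xi_2 by (simp add: y_def numeral_3_eq_3)
  have y4: "y ^ 4 = - 1"
  proof -
    have "y ^ 4 = (y ^ 2) ^ 2" by (simp flip: power_mult)
    then show ?thesis by (simp add: y2)
  qed
  have yint: "algebraic_int y" unfolding y_def by (rule algebraic_int_root_of_unity[OF xi_power_full]) simp
  \<comment> \<open>\<open>(1 - y) * U = 1 - y ^ 5 = 1 + y\<close> because
    \<open>y ^ 4 = - 1\<close>. So \<open>1 + y\<close> is a multiple of \<open>1 - y\<close>, and
    \<open>(1 - y) ^ 2\<close> divides 2, as the second application of
    \<open>qmap_congruence\<close> requires.\<close>
  define U where "U = 1 + y + y ^ 2 + y ^ 3 + y ^ 4"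
  have "(1 - y) * U = 1 - y ^ 4 * y" by (simp add: U_def power_numeral_reduce algebra_simps)
  then have u: "(1 - y) * U = 1 + y" by (simp add: y4)
  have "(1 - y) * (1 + y) * (1 + y ^ 2) = 1 - y ^ 4" by (simp add: power_numeral_reduce algebra_simps)
  then have two1: "2 = (1 - y) * ((1 + y) * (1 + y ^ 2))" by (simp add: y4 mult.assoc)
  have "(1 - y) ^ 2 * (U * (1 + y ^ 2)) = (1 - y) * (((1 - y) * U) * (1 + y ^ 2))"
    unfolding power2_eq_square[of "1 - y"] by (simp only: mult.assoc)
  then have two2: "2 = (1 - y) ^ 2 * (U * (1 + y ^ 2))" unfolding u two1[symmetric] by simp
  have p0': "1 - y \<noteq> 0" using p0 by (simp add: y_def)
  have d1: "algebraic_int (2 / (1 - y))"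
  proof -
    have "2 / (1 - y) = (1 + y) * (1 + y ^ 2)" using two1 p0' by (simp add: field_simps)
    then show ?thesis using yint by (simp add: algebraic_int_mult algebraic_int_add algebraic_int_power)
  qed
  have d2: "algebraic_int (2 / (1 - y) ^ 2)"
  proof -
    have "2 / (1 - y) ^ 2 = U * (1 + y ^ 2)"
      using two2 p0' by (simp add: nonzero_divide_eq_eq mult.commute)
    then show ?thesis using yint by (simp add: U_def algebraic_int_mult algebraic_int_add algebraic_int_power)
  qed
  have c2: "algebraic_int ((qmap c (g a) - qmap c b) / (1 - y) ^ 2)"
    by (rule qmap_congruence[OF p0' d1 bint]) (use c1 in \<open>simp add: y_def\<close>)
  have c3: "algebraic_int ((qmap c (qmap c (g a)) - qmap c (qmap c b)) / ((1 - y) ^ 2) ^ 2)"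
    by (rule qmap_congruence[OF _ d2 _ c2]) (use p0' it_int[of 1] in simp_all)
  obtain w' where w': "?p ^ (2 ^ (3 - 1)) = 2 * w'" "w' \<in> int_adjoin ?S" by (rule power_multiple_two[OF r2])
  have "((1 - y) ^ 2) ^ 2 = 2 * w'" using w'(1) by (simp add: y_def flip: power_mult)
  moreover have "(2::complex) * w' \<noteq> 0" unfolding calculation[symmetric] using p0' by simp
  ultimately have "(qmap c (qmap c (g a)) - qmap c (qmap c b)) / 2
      = (qmap c (qmap c (g a)) - qmap c (qmap c b)) / ((1 - y) ^ 2) ^ 2 * w'"
    by simp
  then have c4: "algebraic_int ((qmap c (qmap c (g a)) - qmap c (qmap c b)) / 2)"
    using c3 Sint[OF w'(2)] by (simp only: algebraic_int_mult)
  have "algebraic_int ((qmap c (qmap c (qmap c (g a))) - qmap c (qmap c (qmap c b))) / 2 ^ 2)"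
    by (rule qmap_congruence[OF _ _ _ c4]) (use it_int[of 2] in \<open>simp_all add: numeral_2_eq_2\<close>)
  moreover have "(qmap c ^^ (n + 3)) a = (qmap c ^^ 3) b"
    unfolding b_def by (simp add: add.commute[of n] funpow_add)
  ultimately show ?thesis by (simp add: numeral_3_eq_3)
qed

text \<open>As \<open>g\<close> has finite order on the field, \<open>g b = f\<^sup>n b\<close> for \<open>b = f\<^sup>3 a\<close> would make \<open>b\<close> periodic.\<close>

lemma frobenius_distinct:
  assumes m: "odd m" and g: "alg_hom g" "g c = c" "g (xi 3) = xi 3" "g (eta m) = eta m ^ (2 ^ n)"
    and a: "a \<in> field_adjoin (gens c 3 m)" and wand: "infinite (range (\<lambda>i. (qmap c ^^ i) a))"
  shows "(qmap c ^^ 3) (g a) \<noteq> (qmap c ^^ (n + 3)) a"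
proof
  assume eq: "(qmap c ^^ 3) (g a) = (qmap c ^^ (n + 3)) a"
  let ?S = "gens c 3 m"
  have m0: "m > 0" using m by (rule odd_pos)
  have Sa: "algebraic s" if "s \<in> ?S" for s using m0 that by (rule gens_algebraic)
  have aa: "algebraic a" using a Sa by (rule field_adjoin_algebraic)
  define b where "b = (qmap c ^^ 3) a"
  have ba: "algebraic b" unfolding b_def by (rule qmap_iter_algebraic[OF c_algebraic aa])
  have c_mem: "c \<in> field_adjoin ?S" using gens_incl(1) int_adjoin_subset_field_adjoin by blast
  have bL: "b \<in> field_adjoin ?S" unfolding b_def by (rule qmap_iter_field_adjoin[OF c_mem a])
  have "g b = (qmap c ^^ 3) (g a)" unfolding b_def using ah_qmap[OF g(1) c_algebraic aa] g(2) by simp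
  also have "\<dots> = (qmap c ^^ n) b" unfolding eq b_def by (simp only: funpow_add o_apply)
  finally have gb: "g b = (qmap c ^^ n) b" .
  have it: "(g ^^ k) b = (qmap c ^^ (n * k)) b" for k
  proof (induction k)
    case (Suc k)
    have "(g ^^ Suc k) b = g ((qmap c ^^ (n * k)) b)" by (simp add: Suc)
    also have "\<dots> = (qmap c ^^ (n * k)) ((qmap c ^^ n) b)"
      using ah_qmap[OF g(1) c_algebraic ba] g(2) gb by simp
    also have "\<dots> = (qmap c ^^ (n * k + n)) b" by (simp only: funpow_add o_apply)
    finally show ?case by (simp add: add.commute)
  qed simp
  have gk: "alg_hom (g ^^ k)" for k
  proof (induction k)
    case 0
    show ?case using alg_hom_id by (simp add: id_def)
  next
    case (Suc k)
    then show ?case using alg_hom_comp[OF g(1) Suc] by (simp add: o_def)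
  qed
  have eta_alg: "algebraic (eta m)"
    using algebraic_int_root_of_unity[OF eta_power[OF m0] m0] by blast
  have geta: "(g ^^ k) (eta m) = eta m ^ (2 ^ (n * k))" for k
  proof (induction k)
    case (Suc k)
    have "(g ^^ Suc k) (eta m) = g (eta m) ^ (2 ^ (n * k))"
      by (simp add: Suc ah_power[OF g(1) eta_alg])
    also have "\<dots> = eta m ^ (2 ^ n * 2 ^ (n * k))" by (simp add: g(4) power_mult)
    also have "2 ^ n * 2 ^ (n * k) = (2::nat) ^ (n * Suc k)" by (simp add: power_add)
    finally show ?case .
  qed simp
  have gc: "(g ^^ k) c = c" and gxi: "(g ^^ k) (xi 3) = xi 3" for k
    by (induction k) (simp_all add: g)
  let ?t = "totient m"
  have "(g ^^ ?t) b = id b"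
  proof (rule alg_hom_eq_on_field_adjoin[OF gk alg_hom_id Sa _ bL])
    fix s assume "s \<in> ?S"
    then consider "s = c" | "s = xi 3" | "s = eta m" unfolding gens_def by blast
    then show "(g ^^ ?t) s = id s"
    proof cases
      case 3
      then show ?thesis using geta[of ?t] eta_frobenius_full[OF m] by simp
    qed (simp_all add: gc gxi)
  qed
  then have "(qmap c ^^ (n * ?t)) b = b" using it[of ?t] by simp
  then have "(qmap c ^^ (n * ?t + 3)) a = (qmap c ^^ 3) a" unfolding b_def by (simp only: funpow_add o_apply)
  then have "(qmap c ^^ (3 + n * ?t)) a = (qmap c ^^ 3) a" by (simp only: add.commute)
  moreover have "n * ?t > 0" using n m0 by simp
  ultimately show False using finite_orbit_if_periodic_point[where T = "qmap c" and a = 3 and k = "n * ?t" and x = a] wand by blast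
qed

end

section \<open>The wildly ramified tower\<close>

text \<open>Reduction modulo \<open>Y ^ 4 - w\<close>. The coefficients are chosen before
  \<open>y\<close>, so that one reduction applies to all fourth roots of \<open>w\<close>.\<close>

lemma poly_mod_quartic:
  assumes "\<And>i. coeff u i \<in> int_adjoin S" "w \<in> int_adjoin S"
  shows "\<exists>b0\<in>int_adjoin S. \<exists>b1\<in>int_adjoin S. \<exists>b2\<in>int_adjoin S. \<exists>b3\<in>int_adjoin S.
    \<forall>y. y ^ 4 = w \<longrightarrow> poly u y = b0 + b1 * y + b2 * y ^ 2 + b3 * y ^ 3"
  using assms(1)
proof (induction u)
  case 0
  show ?case by (intro bexI[of _ 0]) simp_all
next
  case (pCons a u)
  have "coeff u i \<in> int_adjoin S" for i using pCons.prems[of "Suc i"] by simp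
  from pCons.IH[OF this] obtain b0 b1 b2 b3 where b:
    "b0 \<in> int_adjoin S" "b1 \<in> int_adjoin S" "b2 \<in> int_adjoin S" "b3 \<in> int_adjoin S"
    "\<And>y. y ^ 4 = w \<Longrightarrow> poly u y = b0 + b1 * y + b2 * y ^ 2 + b3 * y ^ 3" by blast
  have a: "a \<in> int_adjoin S" using pCons.prems[of 0] by simp
  have mem: "a + w * b3 \<in> int_adjoin S" using a b(4) assms(2) by (intro int_adjoin.add int_adjoin.mult)
  have "poly (pCons a u) y = (a + w * b3) + b0 * y + b1 * y ^ 2 + b2 * y ^ 3" if "y ^ 4 = w" for y
  proof -
    have "poly (pCons a u) y = a + y * (b0 + b1 * y + b2 * y ^ 2 + b3 * y ^ 3)"
      using b(5)[OF that] by simp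
    also have "\<dots> = a + b3 * y ^ 4 + b0 * y + b1 * y ^ 2 + b2 * y ^ 3"
      by (simp add: power_numeral_reduce algebra_simps)
    finally show ?thesis by (simp add: that mult.commute)
  qed
  then show ?case using mem b(1-3) by blast
qed

lemma int_adjoin_insert_poly:
  assumes x: "x \<in> int_adjoin S" and S: "S \<subseteq> insert y (int_adjoin T)"
  shows "\<exists>u. (\<forall>i. coeff u i \<in> int_adjoin T) \<and> x = poly u y"
  using x
proof induction
  case one
  show ?case by (intro exI[of _ "[:1:]"]) (simp add: coeff_pCons split: nat.split)
next
  case (incl x)
  then have "x = y \<or> x \<in> int_adjoin T" using S by blast
  then show ?case
  proof
    assume "x = y"
    then show ?thesis by (intro exI[of _ "[:0, 1:]"]) (simp add: coeff_pCons split: nat.split)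
  next
    assume "x \<in> int_adjoin T"
    then show ?thesis by (intro exI[of _ "[:x:]"]) (simp add: coeff_pCons split: nat.split)
  qed
next
  case (uminus x)
  then obtain u where "\<forall>i. coeff u i \<in> int_adjoin T" "x = poly u y" by blast
  then show ?case by (intro exI[of _ "- u"]) (simp add: int_adjoin.uminus)
next
  case (add x z)
  then obtain u v where "\<forall>i. coeff u i \<in> int_adjoin T" "x = poly u y"
    "\<forall>i. coeff v i \<in> int_adjoin T" "z = poly v y" by blast
  then show ?case by (intro exI[of _ "u + v"]) (simp add: int_adjoin.add)
next
  case (mult x z)
  then obtain u v where uv: "\<forall>i. coeff u i \<in> int_adjoin T" "x = poly u y"
    "\<forall>i. coeff v i \<in> int_adjoin T" "z = poly v y" by blast
  have "coeff (u * v) i \<in> int_adjoin T" for i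
    unfolding coeff_mult using uv(1,3) by (intro int_adjoin_sum int_adjoin.mult) blast+
  then show ?case using uv by (intro exI[of _ "u * v"]) simp
qed

lemma xi_add_2_quartic: "xi (l + 2) ^ 4 = xi l"
  using xi_add_power[of l 2] by simp

context periodic_quadratic
begin

text \<open>The degree 4 is split into two quadratic steps, each nontrivial by
  \<open>xi_not_in_smaller_field\<close>: first over the field containing \<open>xi (l + 1)\<close>,
  then over the one containing \<open>xi l\<close>.\<close>

lemma xi_independent:
  assumes l: "l \<ge> 2" and m: "odd m"
    and b: "b0 \<in> field_adjoin (gens c l m)" "b1 \<in> field_adjoin (gens c l m)"
      "b2 \<in> field_adjoin (gens c l m)" "b3 \<in> field_adjoin (gens c l m)"
    and zero: "b0 + b1 * xi (l + 2) + b2 * xi (l + 2) ^ 2 + b3 * xi (l + 2) ^ 3 = 0"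
  shows "b0 = 0 \<and> b1 = 0 \<and> b2 = 0 \<and> b3 = 0"
proof -
  have m0: "m > 0" using m by (rule odd_pos)
  have alg: "algebraic s" if "s \<in> gens c r m" for s r using m0 that by (rule gens_algebraic)
  let ?z = "xi (l + 2)" and ?y = "xi (l + 1)"
  have zy: "?z ^ 2 = ?y" using xi_Suc_square[of "l + 1"] by simp
  have z3: "?z ^ 3 = ?y * ?z" using zy by (simp add: power3_eq_cube power2_eq_square)
  have sub: "field_adjoin (gens c l m) \<subseteq> field_adjoin (gens c (l + 1) m)"
    by (rule field_adjoin_mono[OF gens_mono]) simp
  have yL: "?y \<in> field_adjoin (gens c (l + 1) m)"
    using gens_incl(2) int_adjoin_subset_field_adjoin by blast
  have no_y: "?y \<notin> field_adjoin (gens c l m)" using xi_not_in_smaller_field[of "l + 1" m] l m by simp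
  have no_z: "?z \<notin> field_adjoin (gens c (l + 1) m)" using xi_not_in_smaller_field[of "l + 2" m] l m by simp
  have lin: "p = 0 \<and> q = 0" if "p + q * ?y = 0" "p \<in> field_adjoin (gens c l m)" "q \<in> field_adjoin (gens c l m)" for p q
  proof (cases "q = 0")
    case False
    have "?y = - p / q" using that(1) False by (simp add: field_simps eq_neg_iff_add_eq_0)
    also have "\<dots> \<in> field_adjoin (gens c l m)"
      by (rule field_adjoin_divide[OF field_adjoin_uminus[OF that(2)] that(3) alg])
    finally show ?thesis using no_y by blast
  qed (use that in simp)
  have P: "b0 + b2 * ?y \<in> field_adjoin (gens c (l + 1) m)" and Q: "b1 + b3 * ?y \<in> field_adjoin (gens c (l + 1) m)"
    using b sub yL by (auto intro!: field_adjoin_add field_adjoin_mult)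
  have eq: "(b0 + b2 * ?y) + (b1 + b3 * ?y) * ?z = 0"
    using zero unfolding z3 zy by (simp add: algebra_simps)
  have "b1 + b3 * ?y = 0"
  proof (rule ccontr)
    assume ne: "b1 + b3 * ?y \<noteq> 0"
    have "?z * (b1 + b3 * ?y) = - (b0 + b2 * ?y)" using add_eq_0_iff[THEN iffD1, OF eq] by (simp only: mult.commute)
    then have "?z = - (b0 + b2 * ?y) / (b1 + b3 * ?y)" using ne by (simp add: nonzero_eq_divide_eq)
    also have "\<dots> \<in> field_adjoin (gens c (l + 1) m)"
      by (rule field_adjoin_divide[OF field_adjoin_uminus[OF P] Q alg])
    finally show False using no_z by blast
  qed
  moreover from this have "b0 + b2 * ?y = 0" using eq by simp
  ultimately show ?thesis using lin[of b0 b2] lin[of b1 b3] b by blast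
qed

lemma ii_in_gens: "l \<ge> 2 \<Longrightarrow> \<i> \<in> int_adjoin (gens c l m)"
  using gens_mono[of 2 l c m] gens_incl(2)[of 2 c m] xi_2 by auto

lemma wild_automorphism:
  assumes l: "l \<ge> 2" and m: "odd m"
  obtains g where "alg_hom g" "\<And>a. a \<in> int_adjoin (gens c l m) \<Longrightarrow> g a = a" "g (xi (l + 2)) = \<i> * xi (l + 2)"
proof -
  have m0: "m > 0" using m by (rule odd_pos)
  have alg: "algebraic s" if "s \<in> gens c l m" for s using m0 that by (rule gens_algebraic)
  let ?z = "xi (l + 2)"
  have za: "algebraic ?z" using algebraic_int_root_of_unity[OF xi_power_full[of "l + 2"]] by auto
  have z4: "?z ^ 4 = xi l" by (rule xi_add_2_quartic)
  have iz4: "(\<i> * ?z) ^ 4 = xi l" unfolding power_mult_distrib z4 by simp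
  \<comment> \<open>Both \<open>z\<close> and \<open>\<i> * z\<close> are fourth roots of
    \<open>xi l\<close>, so they share the reduced form of \<open>u\<close>, whose coefficients
    vanish by independence.\<close>
  have van: "poly u (\<i> * ?z) = 0" if u: "\<And>i. coeff u i \<in> int_adjoin (gens c l m)" "poly u ?z = 0" for u
  proof -
    obtain b0 b1 b2 b3 where b: "b0 \<in> int_adjoin (gens c l m)" "b1 \<in> int_adjoin (gens c l m)"
      "b2 \<in> int_adjoin (gens c l m)" "b3 \<in> int_adjoin (gens c l m)"
      "\<forall>y. y ^ 4 = xi l \<longrightarrow> poly u y = b0 + b1 * y + b2 * y ^ 2 + b3 * y ^ 3"
      using poly_mod_quartic[OF u(1) gens_incl(2)] by blast
    have "b0 = 0 \<and> b1 = 0 \<and> b2 = 0 \<and> b3 = 0"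
    proof (rule xi_independent[OF l m])
      show "b0 + b1 * ?z + b2 * ?z ^ 2 + b3 * ?z ^ 3 = 0" using b(5) z4 u(2) by simp
    qed (use b(1-4) int_adjoin_subset_field_adjoin in blast)+
    then show ?thesis using b(5) iz4 by simp
  qed
  show ?thesis
  proof (rule automorphism_exists[OF za alg van])
    fix g assume g: "alg_hom g" "\<And>a. a \<in> int_adjoin (gens c l m) \<Longrightarrow> g a = a" "g ?z = \<i> * ?z"
    show ?thesis using g by (rule that)
  qed
qed

text \<open>An algebraic integer \<open>a\<close> not in the next smaller field has four conjugates over the field two
  steps below. If the second iterates of \<open>a\<close> and \<open>g a\<close> agree, then \<open>a\<^sup>2 + (g a)\<^sup>2 = - 2 c\<close>, where the
  left-hand side is divisible by 4; as \<open>c\<close> is zero or a unit, this leaves \<open>c = 0\<close>.\<close>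

lemma wild_conjugate_congruence:
  assumes l: "l \<ge> 2" and m: "odd m" and a: "algebraic_int a" "a \<in> field_adjoin (gens c (l + 2) m)"
    and not: "a \<notin> field_adjoin (gens c (l + 1) m)"
  shows "(c = 0 \<and> (\<exists>j. a / xi (l + 2) ^ j \<in> field_adjoin (gens c (l + 1) m))) \<or>
    (\<exists>g. alg_hom g \<and> g c = c \<and> g a \<in> field_adjoin (gens c (l + 2) m) \<and> (qmap c ^^ 2) (g a) \<noteq> (qmap c ^^ 2) a \<and>
      algebraic_int (((qmap c ^^ 2) (g a) - (qmap c ^^ 2) a) / 4))"
proof -
  have m0: "m > 0" using m by (rule odd_pos)
  have aint: "algebraic_int s" if "s \<in> int_adjoin (gens c r m)" for s r
    using that by (rule int_adjoin_algebraic_int) (rule gens_algebraic_int[OF m0])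
  have aa: "algebraic a" using a(1) by blast
  let ?R = "int_adjoin (gens c l m)" and ?z = "xi (l + 2)" and ?K = "field_adjoin (gens c l m)"
  have RK: "?R \<subseteq> ?K" by (rule int_adjoin_subset_field_adjoin)
  have za: "algebraic_int ?z" using algebraic_int_root_of_unity[OF xi_power_full[of "l + 2"]] by simp
  have z0: "?z \<noteq> 0" by (rule xi_nonzero)
  have z4: "?z ^ 4 = xi l" by (rule xi_add_2_quartic)
  have z2: "?z ^ 2 = xi (l + 1)" using xi_Suc_square[of "l + 1"] by simp
  have l2: "l + 2 \<ge> 2" by simp
  obtain s :: int where s: "odd s" "of_int s * a \<in> int_adjoin (gens c (l + 2) m)"
    by (rule integral_odd_multiple_gens[OF l2 m a])
  have "gens c (l + 2) m \<subseteq> insert ?z ?R"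
    unfolding gens_def[of c "l + 2" m] by (simp add: gens_incl)
  from int_adjoin_insert_poly[OF s(2) this]
  obtain u where u: "\<And>i. coeff u i \<in> ?R" "of_int s * a = poly u ?z" by blast
  obtain b0 b1 b2 b3 where b: "b0 \<in> ?R" "b1 \<in> ?R" "b2 \<in> ?R" "b3 \<in> ?R"
    "\<forall>y. y ^ 4 = xi l \<longrightarrow> poly u y = b0 + b1 * y + b2 * y ^ 2 + b3 * y ^ 3"
    using poly_mod_quartic[OF u(1) gens_incl(2)] by blast
  have sa: "of_int s * a = b0 + b1 * ?z + b2 * ?z ^ 2 + b3 * ?z ^ 3" using u(2) b(5) z4 by simp
  obtain g where g: "alg_hom g" "\<And>a. a \<in> ?R \<Longrightarrow> g a = a" "g ?z = \<i> * ?z"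
    by (rule wild_automorphism[OF l m]) blast
  have gc: "g c = c" by (rule g(2)[OF gens_incl(1)])
  have gi: "g \<i> = \<i>" by (rule g(2)[OF ii_in_gens[OF l]])
  have zalg: "algebraic ?z" using za by blast
  have balg: "algebraic b" if "b \<in> ?R" for b using aint[OF that] by blast
  have g_add: "\<And>x y. algebraic x \<Longrightarrow> algebraic y \<Longrightarrow> g (x + y) = g x + g y"
    and g_mult: "\<And>x y. algebraic x \<Longrightarrow> algebraic y \<Longrightarrow> g (x * y) = g x * g y"
    and g_pow: "\<And>x k. algebraic x \<Longrightarrow> g (x ^ k) = g x ^ k"
    by (rule ah_add[OF g(1)] ah_mult[OF g(1)] ah_power[OF g(1)]; assumption)+
  have g_comb: "g (p0 + p1 * y + p2 * y ^ 2 + p3 * y ^ 3) = p0 + p1 * g y + p2 * g y ^ 2 + p3 * g y ^ 3"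
    if "p0 \<in> ?R" "p1 \<in> ?R" "p2 \<in> ?R" "p3 \<in> ?R" "algebraic y" for p0 p1 p2 p3 y
    using that(5) balg[OF that(1)] balg[OF that(2)] balg[OF that(3)] balg[OF that(4)]
      g(2)[OF that(1)] g(2)[OF that(2)] g(2)[OF that(3)] g(2)[OF that(4)]
    by (simp add: g_add g_mult g_pow algebraic_add algebraic_mult algebraic_power)
  have g_s: "of_int s * g x = g (of_int s * x)" if "algebraic x" for x
    using g_mult[OF algebraic_of_int that] ah_of_int[OF g(1)] by simp
  have gaa: "algebraic (g a)" by (rule ah_algebraic[OF g(1) aa])
  have iza: "algebraic (\<i> * ?z)" using zalg by (intro algebraic_mult) simp_all
  have i3: "\<i> ^ 3 = - \<i>" by (simp add: power3_eq_cube)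
  have sga: "of_int s * g a = b0 + \<i> * b1 * ?z - b2 * ?z ^ 2 - \<i> * b3 * ?z ^ 3"
  proof -
    have "of_int s * g a = b0 + b1 * (\<i> * ?z) + b2 * (\<i> * ?z) ^ 2 + b3 * (\<i> * ?z) ^ 3"
      unfolding g_s[OF aa] sa g_comb[OF b(1-4) zalg] g(3) ..
    then show ?thesis by (simp add: power_mult_distrib i3)
  qed
  have sgga: "of_int s * g (g a) = b0 - b1 * ?z + b2 * ?z ^ 2 - b3 * ?z ^ 3"
  proof -
    have giz: "g (\<i> * ?z) = - ?z" using g_mult[of \<i> ?z] zalg gi g(3) by simp
    have "of_int s * g a = b0 + b1 * (\<i> * ?z) + b2 * (\<i> * ?z) ^ 2 + b3 * (\<i> * ?z) ^ 3"
      using sga by (simp add: power_mult_distrib i3)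
    then have "of_int s * g (g a) = b0 + b1 * (- ?z) + b2 * (- ?z) ^ 2 + b3 * (- ?z) ^ 3"
      unfolding g_s[OF gaa] by (simp only: g_comb[OF b(1-4) iza] giz)
    then show ?thesis by simp
  qed
  have indep: "p0 = 0 \<and> p1 = 0 \<and> p2 = 0 \<and> p3 = 0"
    if "p0 \<in> ?R" "p1 \<in> ?R" "p2 \<in> ?R" "p3 \<in> ?R" "p0 + p1 * ?z + p2 * ?z ^ 2 + p3 * ?z ^ 3 = 0" for p0 p1 p2 p3
    using xi_independent[OF l m _ _ _ _ that(5)] that(1-4) RK by blast
  \<comment> \<open>Applying \<open>g\<close> twice negates \<open>z\<close>. If that fixed
    \<open>a\<close>, its odd part \<open>b1 * z + b3 * z ^ 3\<close> would vanish and
    \<open>a\<close> would already lie one level lower.\<close>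
  have not_fixed: "g (g a) \<noteq> a"
  proof
    assume "g (g a) = a"
    then have "of_int s * a - of_int s * g (g a) = 0" by simp
    moreover have "of_int s * a - of_int s * g (g a) = 2 * (b1 * ?z + b3 * ?z ^ 3)"
      unfolding sa sgga by (simp add: algebra_simps)
    ultimately have "2 * (b1 * ?z + b3 * ?z ^ 3) = 0" by (simp only:)
    then have "b1 * ?z + b3 * ?z ^ 3 = 0" by (simp only: mult_eq_0_iff zero_neq_numeral[symmetric] simp_thms)
    then have "0 + b1 * ?z + 0 * ?z ^ 2 + b3 * ?z ^ 3 = 0" by simp
    then have "b1 = 0 \<and> b3 = 0" using indep[of 0 b1 0 b3] b by simp
    then have "of_int s * a = b0 + b2 * xi (l + 1)" using sa z2 by simp
    moreover have "b0 + b2 * xi (l + 1) \<in> int_adjoin (gens c (l + 1) m)"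
    proof -
      have "?R \<subseteq> int_adjoin (gens c (l + 1) m)" by (rule gens_mono) simp
      then show ?thesis using b(1,3) by (intro int_adjoin.add int_adjoin.mult gens_incl) blast+
    qed
    ultimately have "a \<in> field_adjoin (gens c (l + 1) m)"
      using s(1) by (intro field_adjoinI[of s]) auto
    with not show False ..
  qed
  have gaL: "g a \<in> field_adjoin (gens c (l + 2) m)"
  proof -
    have sub: "?R \<subseteq> int_adjoin (gens c (l + 2) m)" by (rule gens_mono) simp
    have "\<i> \<in> int_adjoin (gens c (l + 2) m)" by (rule ii_in_gens) simp
    then have "b0 + \<i> * b1 * ?z - b2 * ?z ^ 2 - \<i> * b3 * ?z ^ 3 \<in> int_adjoin (gens c (l + 2) m)"
      using b(1-4) sub by (intro int_adjoin.add int_adjoin_diff int_adjoin.mult int_adjoin_power gens_incl) blast+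
    then show ?thesis using sga s(1) by (intro field_adjoinI[of s]) auto
  qed
  have c1: "algebraic_int ((g a - a) / (1 - \<i>))"
  proof (rule algebraic_int_odd_divide[of _ _ "1 + \<i>" s])
    show "algebraic_int (g a - a)" by (intro algebraic_int_diff ah_algebraic_int[OF g(1)] a(1))
    show "2 = (1 - \<i>) * (1 + \<i>)" by (simp add: algebra_simps)
    show "algebraic_int (1 + \<i>)" by (intro algebraic_int_add) simp_all
    show "odd s" by fact
    \<comment> \<open>The automorphism is trivial modulo \<open>1 - \<i>\<close>: it multiplies the
      powers of \<open>z\<close> by powers of \<open>\<i>\<close>, so \<open>\<i> - 1\<close>, 2 and
      \<open>\<i> + 1\<close> appear, all multiples of \<open>1 - \<i>\<close>.\<close>
    have "of_int s * (g a - a) = (\<i> - 1) * (b1 * ?z) - 2 * (b2 * ?z ^ 2) - (\<i> + 1) * (b3 * ?z ^ 3)"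
      unfolding right_diff_distrib sa sga by (simp add: algebra_simps)
    also have "\<dots> = (1 - \<i>) * (- (b1 * ?z) - (1 + \<i>) * (b2 * ?z ^ 2) - \<i> * (b3 * ?z ^ 3))"
      by (simp add: algebra_simps)
    finally show "of_int s * (g a - a) = (1 - \<i>) * (- (b1 * ?z) - (1 + \<i>) * (b2 * ?z ^ 2) - \<i> * (b3 * ?z ^ 3))" .
    show "algebraic_int (- (b1 * ?z) - (1 + \<i>) * (b2 * ?z ^ 2) - \<i> * (b3 * ?z ^ 3))"
      using aint[OF b(2)] aint[OF b(3)] aint[OF b(4)] za
      by (simp add: algebraic_int_diff algebraic_int_add algebraic_int_mult algebraic_int_power)
  qed
  have d1: "1 - \<i> \<noteq> 0" "algebraic_int (2 / (1 - \<i>))"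
  proof -
    show ne: "1 - \<i> \<noteq> 0" by (simp add: complex_eq_iff)
    have "2 / (1 - \<i>) = 1 + \<i>" using ne by (simp add: nonzero_divide_eq_eq algebra_simps)
    then show "algebraic_int (2 / (1 - \<i>))" by (simp add: algebraic_int_add)
  qed
  have "algebraic_int ((qmap c (g a) - qmap c a) / (1 - \<i>) ^ 2)"
    by (rule qmap_congruence[OF d1 a(1) c1])
  then have "algebraic_int (- \<i> * ((qmap c (g a) - qmap c a) / (1 - \<i>) ^ 2))"
    by (intro algebraic_int_mult) simp_all
  also have "- \<i> * ((qmap c (g a) - qmap c a) / (1 - \<i>) ^ 2) = (qmap c (g a) - qmap c a) / 2"
  proof -
    have "(1 - \<i>) ^ 2 = - 2 * \<i>" by (simp add: power2_eq_square algebra_simps)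
    then show ?thesis by simp
  qed
  finally have c2: "algebraic_int ((qmap c (g a) - qmap c a) / 2)" .
  have "algebraic_int ((qmap c (qmap c (g a)) - qmap c (qmap c a)) / 2 ^ 2)"
    using qmap_iter_algebraic_int[OF c_algebraic_int a(1), of 1] by (intro qmap_congruence[OF _ _ _ c2]) simp_all
  then have c4: "algebraic_int (((qmap c ^^ 2) (g a) - (qmap c ^^ 2) a) / 4)" by (simp add: numeral_2_eq_2)
  show ?thesis
  proof (cases "(qmap c ^^ 2) (g a) = (qmap c ^^ 2) a")
    case False
    then show ?thesis using g(1) gc gaL c4 by blast
  next
    case True
    have "(g a ^ 2 + c) ^ 2 = (a ^ 2 + c) ^ 2" using True by (simp add: numeral_2_eq_2 qmap_def)
    then have "g a ^ 2 + c = a ^ 2 + c \<or> g a ^ 2 + c = - (a ^ 2 + c)" by (simp only: power2_eq_iff)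
    \<comment> \<open>Here order 4 is used: even \<open>g a = - a\<close> would give
      \<open>g (g a) = a\<close>.\<close>
    moreover have "g a ^ 2 \<noteq> a ^ 2"
    proof
      assume "g a ^ 2 = a ^ 2"
      then have "g a = a \<or> g a = - a" by (simp only: power2_eq_iff)
      then have "g (g a) = a" using ah_uminus[OF g(1) aa] by auto
      with not_fixed show False ..
    qed
    ultimately have "g a ^ 2 + c = - (a ^ 2 + c)" by simp
    then have "g a ^ 2 = - (a ^ 2 + c) - c" by (simp only: eq_diff_eq)
    then have sum: "g a ^ 2 + a ^ 2 = - 2 * c" by simp
    \<comment> \<open>Applying \<open>g\<close> to the relation and comparing yields
      \<open>g (g a) = - a\<close>, which now eliminates the even part
      \<open>b0 + b2 * z ^ 2\<close>.\<close>
    have "g (g a) ^ 2 + g a ^ 2 = - 2 * c"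
    proof -
      have "g (g a ^ 2 + a ^ 2) = g (g a) ^ 2 + g a ^ 2"
        using gaa aa by (simp add: g_add g_pow algebraic_power)
      moreover have "g (- 2 * c) = - 2 * c"
        by (rule g(2)) (simp add: int_adjoin.mult int_adjoin.uminus gens_incl)
      ultimately show ?thesis unfolding sum by simp
    qed
    with sum have "g (g a) ^ 2 + g a ^ 2 = a ^ 2 + g a ^ 2" by (simp only: add.commute)
    then have "g (g a) ^ 2 = a ^ 2" by (rule add_right_imp_eq)
    then have "g (g a) = - a" using not_fixed by (simp only: power2_eq_iff) simp
    then have "of_int s * a + of_int s * g (g a) = 0" by simp
    moreover have "of_int s * a + of_int s * g (g a) = 2 * (b0 + b2 * ?z ^ 2)"
      unfolding sa sgga by (simp add: algebra_simps)
    ultimately have "2 * (b0 + b2 * ?z ^ 2) = 0" by (simp only:)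
    then have "b0 + b2 * ?z ^ 2 = 0" by (simp only: mult_eq_0_iff zero_neq_numeral[symmetric] simp_thms)
    then have "b0 + 0 * ?z + b2 * ?z ^ 2 + 0 * ?z ^ 3 = 0" by simp
    then have b02: "b0 = 0" "b2 = 0" using indep[of b0 0 b2 0] b by simp_all
    have sa': "of_int s * a = b1 * ?z + b3 * ?z ^ 3" using sa b02 by simp
    have sga': "of_int s * g a = \<i> * (b1 * ?z - b3 * ?z ^ 3)" using sga b02 by (simp add: algebra_simps)
    \<comment> \<open>With \<open>x = b1 * z\<close> and \<open>y = b3 * z ^ 3\<close>,
      \<open>(\<i> * (x - y)) ^ 2 + (x + y) ^ 2 = 4 * (x * y)\<close>. So 2 divides
      \<open>s ^ 2 * c\<close>, which is impossible for a unit \<open>c\<close>.\<close>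
    have key: "of_int (s ^ 2) * c = 2 * (- (b1 * b3 * ?z ^ 4))"
    proof -
      have "of_int s ^ 2 * (- 2 * c) = (of_int s * g a) ^ 2 + (of_int s * a) ^ 2"
        unfolding sum[symmetric] by (simp add: power_mult_distrib algebra_simps)
      also have "\<dots> = 4 * (b1 * b3 * ?z ^ 4)"
      proof -
        have "(\<i> * (x - y)) ^ 2 + (x + y) ^ 2 = 4 * (x * y)" for x y :: complex
          by (simp add: power2_eq_square algebra_simps)
        moreover have "(b1 * ?z) * (b3 * ?z ^ 3) = b1 * b3 * ?z ^ 4"
          by (simp add: power_numeral_reduce)
        ultimately show ?thesis unfolding sa' sga' by (simp only:)
      qed
      finally have "of_int s ^ 2 * (- 2 * c) = 4 * (b1 * b3 * ?z ^ 4)" .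
      moreover have "t * c = 2 * (- w)" if "t * (- 2 * c) = 4 * w" for t w :: complex
      proof -
        have "(- 2) * (t * c) = (- 2) * (2 * (- w))" using that by simp
        then show ?thesis by (simp only: mult_cancel_left) simp
      qed
      ultimately show ?thesis unfolding of_int_power by blast
    qed
    have "c = 0"
    proof (rule ccontr)
      assume "c \<noteq> 0"
      then obtain d where d: "algebraic_int d" "c * d = 1" by (rule c_unit)
      have "of_int (s ^ 2) = (of_int (s ^ 2) * c) * d" using d(2) by (simp add: mult.assoc)
      also have "\<dots> = 2 * (- (b1 * b3 * ?z ^ 4) * d)" unfolding key by (rule mult.assoc)
      finally have e: "of_int (s ^ 2) = (2 :: complex) * (- (b1 * b3 * ?z ^ 4) * d)" .
      show False
      proof (rule odd_not_multiple[OF _ e])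
        show "odd (s ^ 2)" using s(1) by simp
        show "algebraic_int (- (b1 * b3 * ?z ^ 4) * d)"
          using aint[OF b(2)] aint[OF b(4)] za d(1) by (simp add: algebraic_int_mult algebraic_int_power)
        show "(2::complex) ^ 1 = 2 * 1" by simp
      qed simp
    qed
    moreover have "\<exists>j. a / ?z ^ j \<in> field_adjoin (gens c (l + 1) m)"
    proof -
      have sub: "?R \<subseteq> int_adjoin (gens c (l + 1) m)" by (rule gens_mono) simp
      have fin: "a / ?z ^ j \<in> field_adjoin (gens c (l + 1) m)" if "of_int s * a = b * ?z ^ j" "b \<in> ?R" for b j
      proof (rule field_adjoinI[of s])
        show "s \<noteq> 0" using s(1) by auto
        have "of_int s * (a / ?z ^ j) = b" using that(1) z0 by simp
        then show "of_int s * (a / ?z ^ j) \<in> int_adjoin (gens c (l + 1) m)" using that(2) sub by auto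
      qed
      \<comment> \<open>Only one of the two odd terms survives, so \<open>a\<close> becomes an
        element of a smaller field after division by a single power of \<open>z\<close>.\<close>
      have "b1 = 0 \<or> b3 = 0" using key \<open>c = 0\<close> z0 by simp
      then show ?thesis
      proof
        assume "b1 = 0"
        then have "of_int s * a = b3 * ?z ^ 3" using sa' by simp
        from fin[OF this b(4)] show ?thesis by (rule exI)
      next
        assume "b3 = 0"
        then have "of_int s * a = b1 * ?z ^ 1" using sa' by simp
        from fin[OF this b(2)] show ?thesis by (rule exI)
      qed
    qed
    ultimately show ?thesis by blast
  qed
qed

end

section \<open>The lower bound\<close>

lemma cmod_root_of_unity:
  fixes w :: complex
  assumes "w ^ k = 1" "k > 0"
  shows "cmod w = 1"
proof -
  have "cmod w ^ k = 1 ^ k" using assms(1) by (simp flip: norm_power)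
  then show ?thesis using assms(2) by (simp only: power_eq_iff_eq_base[OF assms(2) norm_ge_zero zero_le_one])
qed

lemma conj_avg_ln_excess_nonneg: "conj_avg (ln_excess r) x \<ge> 0"
  unfolding conj_avg_def by (intro divide_nonneg_nonneg sum_nonneg ln_excess_nonneg) simp

lemma conj_avg_ln_excess_mult_root_of_unity:
  assumes w: "w ^ k = 1" "k > 0" and x: "algebraic x"
  shows "conj_avg (ln_excess r) (x * w) = conj_avg (ln_excess r) x"
proof -
  let ?S = "{x, w}"
  let ?E = "embeddings ?S"
  have wa: "algebraic w" using algebraic_int_root_of_unity[OF w] by blast
  have S: "\<And>s. s \<in> ?S \<Longrightarrow> algebraic s" "finite ?S" using x wa by auto
  have mem: "x \<in> field_adjoin ?S" "x * w \<in> field_adjoin ?S"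
    by (auto intro: field_adjoin_incl field_adjoin_mult)
  have "(\<Sum>\<phi>\<in>?E. ln_excess r (\<phi> (x * w))) = (\<Sum>\<phi>\<in>?E. ln_excess r (\<phi> x))"
  proof (rule sum.cong[OF refl])
    fix \<phi> assume "\<phi> \<in> ?E"
    then obtain g where g: "alg_hom g" "\<phi> = restrict g (field_adjoin ?S)" by (rule embeddingsE)
    have "g w ^ k = 1" using ah_power[OF g(1) wa, of k] ah_one[OF g(1)] w(1) by simp
    then have "cmod (g w) = 1" using w(2) by (rule cmod_root_of_unity)
    then show "ln_excess r (\<phi> (x * w)) = ln_excess r (\<phi> x)"
      using g(2) mem by (simp add: ah_mult[OF g(1) x wa] norm_mult ln_excess_def)
  qed
  moreover have "(\<Sum>\<phi>\<in>?E. ln_excess r (\<phi> (x * w))) = card ?E * conj_avg (ln_excess r) (x * w)"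
    by (rule sum_embeddings(1)[OF S mem(2)])
  moreover have "(\<Sum>\<phi>\<in>?E. ln_excess r (\<phi> x)) = card ?E * conj_avg (ln_excess r) x"
    by (rule sum_embeddings(1)[OF S mem(1)])
  moreover have "card ?E > 0" by (rule card_embeddings_pos[OF S])
  ultimately show ?thesis by simp
qed

lemma qmap_0_iter: "(qmap 0 ^^ N) z = z ^ (2 ^ N)"
  by (induction N) (simp_all add: qmap_def power_mult[symmetric] mult.commute)

lemma infinite_orbit_squaring_mult:
  assumes w: "w ^ k = 1" "k > 0" and inf: "infinite (range (\<lambda>i. (qmap 0 ^^ i) (x * w)))"
  shows "infinite (range (\<lambda>i. (qmap 0 ^^ i) x))"
proof
  assume fin: "finite (range (\<lambda>i. (qmap 0 ^^ i) x))"
  have fk: "finite {z::complex. z ^ k = 1}" by (rule finite_roots_unity) (use w(2) in simp)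
  have "range (\<lambda>i. (qmap 0 ^^ i) (x * w))
      \<subseteq> (\<lambda>(u, v). u * v) ` (range (\<lambda>i. (qmap 0 ^^ i) x) \<times> {z. z ^ k = 1})"
  proof
    fix t assume "t \<in> range (\<lambda>i. (qmap 0 ^^ i) (x * w))"
    then obtain i where t: "t = (qmap 0 ^^ i) x * w ^ (2 ^ i)"
      by (auto simp: qmap_0_iter power_mult_distrib)
    have "(w ^ (2 ^ i)) ^ k = (w ^ k) ^ (2 ^ i)" by (simp add: power_mult[symmetric] mult.commute)
    then have "w ^ (2 ^ i) \<in> {z. z ^ k = 1}" using w(1) by simp
    then have "((qmap 0 ^^ i) x, w ^ (2 ^ i)) \<in> range (\<lambda>i. (qmap 0 ^^ i) x) \<times> {z. z ^ k = 1}" by blast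
    then show "t \<in> (\<lambda>(u, v). u * v) ` (range (\<lambda>i. (qmap 0 ^^ i) x) \<times> {z. z ^ k = 1})"
      unfolding t by (rule rev_image_eqI) simp
  qed
  then have "finite (range (\<lambda>i. (qmap 0 ^^ i) (x * w)))"
    by (rule finite_subset) (intro finite_imageI finite_cartesian_product fin fk)
  with inf show False ..
qed

context periodic_quadratic
begin

text \<open>The critical orbit escapes to infinity if the parameter has absolute value at least 2.\<close>

lemma conjugates_c_lt_2:
  assumes "c' \<in> conjugates c"
  shows "cmod c' < 2"
proof (rule ccontr)
  assume "\<not> cmod c' < 2"
  then have ge: "cmod c' \<ge> 2" by simp
  obtain g where g: "alg_hom g" "g c = c'" by (rule conjugate_alg_hom[OF c_algebraic assms])
  have "g ((qmap c ^^ n) 0) = (qmap c' ^^ n) 0"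
    using ah_qmap[OF g(1) c_algebraic, of 0] ah_zero[OF g(1)] g(2) by simp
  then have per': "(qmap c' ^^ n) 0 = 0" using per ah_zero[OF g(1)] by simp
  have "cmod c' \<le> cmod ((qmap c' ^^ Suc k) 0)" for k
  proof (induction k)
    case 0
    show ?case by (simp add: qmap_def)
  next
    case (Suc k)
    let ?z = "(qmap c' ^^ Suc k) 0"
    have "2 * cmod c' \<le> cmod ?z * cmod ?z" using Suc ge by (intro mult_mono) simp_all
    also have "\<dots> = cmod (?z ^ 2)" by (simp add: norm_mult power2_eq_square)
    finally have "cmod c' \<le> cmod (?z ^ 2) - cmod c'" by simp
    also have "\<dots> \<le> cmod (?z ^ 2 + c')" by (rule norm_diff_ineq)
    also have "?z ^ 2 + c' = (qmap c' ^^ Suc (Suc k)) 0" by (simp add: qmap_def)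
    finally show ?case .
  qed
  from this[of "n - 1"] show False using n per' ge by simp
qed

lemma escape_radius:
  obtains r where "1 \<le> r" "r < 2" "\<And>c'. c' \<in> conjugates c \<Longrightarrow> cmod c' \<le> r ^ 2 - r"
proof -
  define K where "K = Max (cmod ` conjugates c)"
  have fin: "finite (cmod ` conjugates c)" using finite_conjugates[OF c_algebraic] by simp
  have ne: "cmod ` conjugates c \<noteq> {}" using conjugates_self[OF c_algebraic] by blast
  have "K \<in> cmod ` conjugates c" unfolding K_def by (rule Max_in[OF fin ne])
  then have K: "0 \<le> K" "K < 2" using conjugates_c_lt_2 by auto
  \<comment> \<open>The larger root of \<open>r ^ 2 - r = K\<close>; the strict bound
    \<open>K < 2\<close> is what makes it less than 2.\<close>
  define r where "r = (1 + sqrt (1 + 4 * K)) / 2"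
  have "sqrt 1 \<le> sqrt (1 + 4 * K)" using K by (intro real_sqrt_le_mono) simp
  then have r1: "1 \<le> r" by (simp add: r_def)
  have "sqrt (1 + 4 * K) < sqrt (3 ^ 2)" using K by (intro real_sqrt_less_mono) simp
  then have r2: "r < 2" by (simp add: r_def)
  have "sqrt (1 + 4 * K) ^ 2 = 1 + 4 * K" using K by simp
  then have "r ^ 2 - r = K" by (simp add: r_def power2_eq_square field_simps)
  moreover have "cmod c' \<le> K" if "c' \<in> conjugates c" for c'
    unfolding K_def by (rule Max_ge[OF fin]) (use that in simp)
  ultimately have "cmod c' \<le> r ^ 2 - r" if "c' \<in> conjugates c" for c' using that by simp
  from r1 r2 this show ?thesis by (rule that)
qed

context
  fixes r :: real
  assumes r: "1 \<le> r" "r < 2" and esc: "\<And>c'. c' \<in> conjugates c \<Longrightarrow> cmod c' \<le> r ^ 2 - r"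
begin

lemma conj_avg_iter_mono:
  assumes "algebraic x" "j \<le> k"
  shows "conj_avg (ln_excess r) ((qmap c ^^ j) x) \<le> conj_avg (ln_excess r) ((qmap c ^^ k) x)"
  using assms(2)
proof (induction k rule: dec_induct)
  case (step k)
  let ?M = "conj_avg (ln_excess r)"
  have "2 * ?M ((qmap c ^^ k) x) \<le> ?M (qmap c ((qmap c ^^ k) x))"
    by (rule sum_ln_excess_qmap[OF r(1) c_algebraic esc qmap_iter_algebraic[OF c_algebraic assms(1)]])
  then have "?M ((qmap c ^^ k) x) \<le> ?M ((qmap c ^^ Suc k) x)"
    using conj_avg_ln_excess_nonneg[of r "(qmap c ^^ k) x"] by simp
  with step.IH show ?case by (rule order_trans)
qed simp

text \<open>Induction on the 2-power level with a bound that does not depend on it. The base case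
  dictates the iterate \<open>n + 3\<close>; in the wild case the second iterate suffices, and the
  average only grows along the orbit.\<close>

lemma conj_avg_lower_bound_gens:
  assumes k: "k \<ge> 3" and m: "odd m" and a: "algebraic_int a" "a \<in> field_adjoin (gens c k m)"
    and wand: "infinite (range (\<lambda>i. (qmap c ^^ i) a))"
  shows "ln (2 / r) / 2 \<le> conj_avg (ln_excess r) ((qmap c ^^ (n + 3)) a)"
  using k a wand
proof (induction k arbitrary: a rule: nat_induct_at_least)
  case base
  let ?S = "gens c 3 m" and ?M = "conj_avg (ln_excess r)"
  have m0: "m > 0" using m by (rule odd_pos)
  have S: "\<And>s. s \<in> ?S \<Longrightarrow> algebraic s" using gens_algebraic[OF m0] by blast
  have aa: "algebraic a" using base.prems(1) by blast
  have c_mem: "c \<in> field_adjoin ?S" using gens_incl(1) int_adjoin_subset_field_adjoin by blast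
  obtain g where g: "alg_hom g" "g c = c" "g (xi 3) = xi 3" "g (eta m) = eta m ^ (2 ^ n)"
    by (rule frobenius_automorphism[OF m])
  have ga: "g a \<in> field_adjoin ?S"
  proof (rule alg_hom_field_adjoin_mono[OF g(1) S _ base.prems(2)])
    fix x assume "x \<in> int_adjoin ?S"
    then show "g x \<in> int_adjoin ?S" using frobenius_ring_cong[OF m g] by blast
  qed
  \<comment> \<open>Conjugation by \<open>g\<close> leaves the average unchanged, so both summands
    are at most the average at the iterate \<open>n + 3\<close>; this accounts for the factor one
    half.\<close>
  have "ln (2 / r) \<le> ?M ((qmap c ^^ 3) (g a)) + ?M ((qmap c ^^ (n + 3)) a)"
    by (rule conj_avg_lower_bound[OF S finite_gens r(1) qmap_iter_field_adjoin[OF c_mem ga]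
          qmap_iter_field_adjoin[OF c_mem base.prems(2)]
          frobenius_distinct[OF m g base.prems(2,3)] frobenius_congruence[OF m g base.prems(1,2)]])
  also have "(qmap c ^^ 3) (g a) = g ((qmap c ^^ 3) a)"
    using ah_qmap[OF g(1) c_algebraic aa] g(2) by simp
  also have "?M (g ((qmap c ^^ 3) a)) = ?M ((qmap c ^^ 3) a)"
    by (rule conj_avg_alg_hom[OF g(1) qmap_iter_algebraic[OF c_algebraic aa]])
  also have "\<dots> \<le> ?M ((qmap c ^^ (n + 3)) a)" by (rule conj_avg_iter_mono[OF aa]) simp
  finally show ?case by simp
next
  case (Suc k)
  define l where "l = k - 1"
  have l: "l \<ge> 2" "k = l + 1" "Suc k = l + 2" using Suc.hyps by (simp_all add: l_def)
  let ?S = "gens c (l + 2) m" and ?M = "conj_avg (ln_excess r)"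
  have m0: "m > 0" using m by (rule odd_pos)
  have S: "\<And>s. s \<in> ?S \<Longrightarrow> algebraic s" using gens_algebraic[OF m0] by blast
  have aa: "algebraic a" using Suc.prems(1) by blast
  have aS: "a \<in> field_adjoin ?S" using Suc.prems(2) unfolding l(3) .
  have c_mem: "c \<in> field_adjoin ?S" using gens_incl(1) int_adjoin_subset_field_adjoin by blast
  show ?case
  proof (cases "a \<in> field_adjoin (gens c k m)")
    case True
    from Suc.IH[OF Suc.prems(1) this Suc.prems(3)] show ?thesis .
  next
    case False
    then have "a \<notin> field_adjoin (gens c (l + 1) m)" unfolding l(2) .
    from wild_conjugate_congruence[OF l(1) m Suc.prems(1) aS this] show ?thesis
    proof
      assume "c = 0 \<and> (\<exists>j. a / xi (l + 2) ^ j \<in> field_adjoin (gens c (l + 1) m))"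
      then obtain j where c0: "c = 0" and j: "a / xi (l + 2) ^ j \<in> field_adjoin (gens c k m)"
        unfolding l(2) by blast
      define w where "w = xi (l + 2) ^ j"
      have "(xi (l + 2) ^ (2 ^ (l + 2))) ^ j = 1" unfolding xi_power_full by simp
      then have w: "w ^ (2 ^ (l + 2)) = 1" unfolding w_def by (simp only: power_mult[symmetric] mult.commute)
      have w0: "w \<noteq> 0" unfolding w_def by (simp add: xi_nonzero)
      have pos: "(2::nat) ^ (l + 2) > 0" by simp
      \<comment> \<open>For \<open>c = 0\<close> the orbits of \<open>a\<close> and \<open>b\<close>
        differ by roots of unity, whose conjugates have absolute value 1. So \<open>b\<close> is
        wandering too, with the same averages, and it lives one level lower.\<close>
      define b where "b = a / w"
      have ab: "a = b * w" using w0 by (simp add: b_def)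
      have bint: "algebraic_int b"
      proof -
        have "inverse w ^ (2 ^ (l + 2)) = 1" using w by (simp only: power_inverse inverse_1)
        from algebraic_int_mult[OF Suc.prems(1) algebraic_int_root_of_unity[OF this pos]]
        show ?thesis unfolding b_def divide_inverse .
      qed
      have ba: "algebraic b" using bint by blast
      have "infinite (range (\<lambda>i. (qmap c ^^ i) b))"
        using infinite_orbit_squaring_mult[OF w pos, of b] Suc.prems(3) unfolding ab c0 by blast
      from Suc.IH[OF bint j[folded w_def b_def] this]
      have "ln (2 / r) / 2 \<le> ?M ((qmap c ^^ (n + 3)) b)" .
      also have "\<dots> = ?M ((qmap c ^^ (n + 3)) b * w ^ (2 ^ (n + 3)))"
      proof (rule conj_avg_ln_excess_mult_root_of_unity[symmetric, OF _ pos])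
        have "(w ^ (2 ^ (l + 2))) ^ (2 ^ (n + 3)) = 1" unfolding w by simp
        then show "(w ^ (2 ^ (n + 3))) ^ (2 ^ (l + 2)) = 1" by (simp only: power_mult[symmetric] mult.commute)
      qed (rule qmap_iter_algebraic[OF c_algebraic ba])
      also have "(qmap c ^^ (n + 3)) b * w ^ (2 ^ (n + 3)) = (qmap c ^^ (n + 3)) a"
        unfolding ab c0 qmap_0_iter power_mult_distrib ..
      finally show ?thesis .
    next
      assume "\<exists>g. alg_hom g \<and> g c = c \<and> g a \<in> field_adjoin ?S \<and> (qmap c ^^ 2) (g a) \<noteq> (qmap c ^^ 2) a \<and>
        algebraic_int (((qmap c ^^ 2) (g a) - (qmap c ^^ 2) a) / 4)"
      then obtain g where g: "alg_hom g" "g c = c" "g a \<in> field_adjoin ?S"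
        "(qmap c ^^ 2) (g a) \<noteq> (qmap c ^^ 2) a" "algebraic_int (((qmap c ^^ 2) (g a) - (qmap c ^^ 2) a) / 4)"
        by blast
      have "ln (2 / r) \<le> ?M ((qmap c ^^ 2) (g a)) + ?M ((qmap c ^^ 2) a)"
        by (rule conj_avg_lower_bound[OF S finite_gens r(1) qmap_iter_field_adjoin[OF c_mem g(3)]
              qmap_iter_field_adjoin[OF c_mem aS] g(4,5)])
      also have "(qmap c ^^ 2) (g a) = g ((qmap c ^^ 2) a)"
        using ah_qmap[OF g(1) c_algebraic aa] g(2) by simp
      also have "?M (g ((qmap c ^^ 2) a)) = ?M ((qmap c ^^ 2) a)"
        by (rule conj_avg_alg_hom[OF g(1) qmap_iter_algebraic[OF c_algebraic aa]])
      finally have "ln (2 / r) / 2 \<le> ?M ((qmap c ^^ 2) a)" by simp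
      also have "\<dots> \<le> ?M ((qmap c ^^ (n + 3)) a)" by (rule conj_avg_iter_mono[OF aa]) simp
      finally show ?thesis .
    qed
  qed
qed

end

lemma cyclotomic_closure_subset:
  assumes "x \<in> cyclotomic_closure (generated_subfield {c})"
  obtains k m where "k \<ge> 3" "odd m" "x \<in> field_adjoin (gens c k m)"
proof -
  obtain N where N: "N \<ge> 1" "x \<in> generated_subfield (generated_subfield {c} \<union> {cis (2 * pi / real N)})"
    using assms unfolding cyclotomic_closure_def by auto
  obtain e m where em: "N = m * 2 ^ e" "\<not> 2 dvd m"
    using multiplicity_decompose'[of N 2] N(1) by (metis not_one_le_zero odd_one mult.commute)
  \<comment> \<open>Level \<open>e\<close> already contains the root of unity; adding 3 brings the
    level into the range of \<open>conj_avg_lower_bound_gens\<close>.\<close>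
  let ?S = "gens c (e + 3) m"
  have m: "odd m" using em(2) .
  have S: "\<And>s. s \<in> ?S \<Longrightarrow> algebraic s" using gens_algebraic odd_pos[OF m] by blast
  have "c \<in> field_adjoin ?S" using gens_incl(1) int_adjoin_subset_field_adjoin by blast
  then have "generated_subfield {c} \<subseteq> field_adjoin ?S"
    by (intro generated_subfield_subset_field_adjoin S) auto
  moreover have "N dvd 2 ^ (e + 3) * m" unfolding em(1) by (simp add: power_add)
  then have "cis (2 * pi / real N) \<in> field_adjoin ?S"
    using root_of_unity_in_gens[OF m] int_adjoin_subset_field_adjoin by blast
  ultimately have "generated_subfield (generated_subfield {c} \<union> {cis (2 * pi / real N)}) \<subseteq> field_adjoin ?S"
    by (intro generated_subfield_subset_field_adjoin S) auto
  then have "x \<in> field_adjoin ?S" using N(2) by blast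
  then show ?thesis by (intro that[of "e + 3" m] m) simp_all
qed

end

theorem corollary1p2:
  fixes c :: complex and f :: "complex poly"
  assumes "algebraic c"
    and "f = [:c, 0, 1:]"
    and "\<exists>n\<ge>1. (poly f ^^ n) 0 = 0"
  shows "\<exists>C>0. \<forall>\<alpha>\<in>cyclotomic_closure (generated_subfield {c}).
           algebraic_int \<alpha> \<longrightarrow> wandering f \<alpha> \<longrightarrow> canonical_height f \<alpha> \<ge> C"
proof -
  have f: "poly f = qmap c" unfolding assms(2) by (rule poly_qmap)
  obtain n where n: "n \<ge> 1" "(qmap c ^^ n) 0 = 0" using assms(3) unfolding f by blast
  interpret periodic_quadratic c n by unfold_locales (fact n)+
  obtain r where r: "1 \<le> r" "r < 2" "\<And>c'. c' \<in> conjugates c \<Longrightarrow> cmod c' \<le> r ^ 2 - r"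
    by (rule escape_radius) blast
  \<comment> \<open>The numerator is the average guaranteed after \<open>n + 3\<close> iterations,
    each of which doubled the canonical height.\<close>
  define C where "C = ln (2 / r) / 2 / 2 ^ (n + 3)"
  have "C > 0" unfolding C_def using r by simp
  moreover have "C \<le> canonical_height f \<alpha>"
    if \<alpha>: "\<alpha> \<in> cyclotomic_closure (generated_subfield {c})" "algebraic_int \<alpha>" "wandering f \<alpha>" for \<alpha>
  proof -
    obtain k m where km: "k \<ge> 3" "odd m" "\<alpha> \<in> field_adjoin (gens c k m)"
      by (rule cyclotomic_closure_subset[OF \<alpha>(1)])
    have "infinite (range (\<lambda>i. (qmap c ^^ i) \<alpha>))" using \<alpha>(3) unfolding preperiodic_def f .
    from conj_avg_lower_bound_gens[OF r km(1,2) \<alpha>(2) km(3) this]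
    have "C \<le> conj_avg (ln_excess r) ((qmap c ^^ (n + 3)) \<alpha>) / 2 ^ (n + 3)"
      unfolding C_def by (intro divide_right_mono) simp_all
    also have "\<dots> \<le> canonical_height f \<alpha>"
      unfolding assms(2) by (rule canonical_height_ge[OF r(1) c_algebraic_int r(3)]) (use \<alpha>(2) in auto)
    finally show ?thesis .
  qed
  ultimately show ?thesis by blast
qed

end
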